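(* Let $\mu>0$, $h>0$, $\lambda=-\frac{10}{9}h$ and $V_0=\frac{9\mu^4}{10h}$, and let $$\Phi_B(z)=\frac{3\mu}{4\sqrt h}\left[\operatorname{diag}(0,0,0,1,-1)+\frac15\tanh\left(\frac{\mu z}{\sqrt2}\right)\operatorname{diag}(2,2,2,-3,-3)\right],\qquad z\in\mathbb R.$$ Then $\Phi_B$ is a global minimizer of $E$ in $\mathcal A(\Sigma_B^-,\Sigma_B^+)$. More precisely, $\Phi_B\in\mathcal A(\Sigma_B^-,\Sigma_B^+)$ and $$E(\Psi)\ge E(\Phi_B)=\frac{9\sqrt2\,\mu^3}{10h}\qquad\text{for every }\Psi\in\mathcal A(\Sigma_B^-,\Sigma_B^+).$$ Moreover, $$\mathsf d_V(\Sigma_B^-,\Sigma_B^+)=E(\Phi_B).$$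
   Context: Let $\mathfrak h_0(5)=\{Q\in\mathbb C^{5\times5}:Q^\dagger=Q,\ \operatorname{Tr}Q=0\}$, a real Hilbert space with inner product $\langle A,B\rangle_F=\operatorname{Tr}(AB)$ and norm $\lVert A\rVert_F=(\operatorname{Tr}(A^2))^{1/2}$. The potential is $$V(\Phi)=-\mu^2\operatorname{Tr}(\Phi^2)+h\bigl(\operatorname{Tr}(\Phi^2)\bigr)^2+\lambda\operatorname{Tr}(\Phi^4)+V_0,\qquad \Phi\in\mathfrak h_0(5),$$ with the values of $\mu,\lambda,h,V_0$ given in the claim. Set $v=\frac{3\mu}{10\sqrt h}$, $\Phi_B^+=v\operatorname{diag}(1,1,1,1,-4)$, $\Phi_B^-=v\operatorname{diag}(-1,-1,-1,4,-1)$, and $\Sigma_B^\pm=\{U^\dagger\Phi_B^\pm U:U\in\operatorname{SU}(5)\}$. For $A^-,A^+\in\mathfrak h_0(5)$, $\mathcal A(A^-,A^+)$ is the set of $\Psi\in H^1_{\mathrm{loc}}(\mathbb R;\mathfrak h_0(5))$ (continuous representatives) with $\Psi'\in L^2(\mathbb R;\mathfrak h_0(5))$, $V(\Psi)\in L^1(\mathbb R)$, $\lim_{z\to-\infty}\Psi(z)=A^-$ and $\lim_{z\to+\infty}\Psi(z)=A^+$. For nonempty compact sets $S^-,S^+\subset\mathfrak h_0(5)$, $\mathcal A(S^-,S^+)=\bigcup_{A^-\in S^-,A^+\in S^+}\mathcal A(A^-,A^+)$. The energy is $E(\Psi)=\int_{\mathbb R}\bigl(\lVert\Psi'(z)\rVert_F^2+V(\Psi(z))\bigr)\,dz$.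 A global minimizer of $E$ in a class is an element of the class whose energy is at most that of every element of the class. The degenerate weighted distance is $$\mathsf d_V(S^-,S^+)=\inf\left\{2\int_0^1\sqrt{V(\gamma(t))}\,\lVert\gamma'(t)\rVert_F\,dt:\ \gamma\in AC([0,1];\mathfrak h_0(5)),\ \gamma(0)\in S^-,\ \gamma(1)\in S^+\right\},$$ where $AC$ denotes absolutely continuous curves. (With the given parameters $V\ge0$ on $\mathfrak h_0(5)$.) *)

theory Defs
  imports "HOL-Analysis.Analysis"
begin

section \<open>Matrices\<close>

text \<open>
  Matrix products are always written \<open>**\<close>: the type-class operations \<open>*\<close> and \<open>^\<close> act
  componentwise on vectors and matrices.
\<close>

type_synonym cmat5 = "complex^5^5"

definition dagger :: "cmat5 \<Rightarrow> cmat5" where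
  "dagger A = (\<chi> i j. cnj (A $ j $ i))"

definition h0 :: "cmat5 set" where
  "h0 = {Q. dagger Q = Q \<and> trace Q = 0}"

definition SU5 :: "cmat5 set" where
  "SU5 = {U. dagger U ** U = mat 1 \<and> det U = 1}"

text \<open>The diagonal matrix whose diagonal entries are the members of a list of length five.\<close>

definition diag5 :: "real list \<Rightarrow> cmat5" where
  "diag5 xs = (\<chi> i j. if i = j then of_real ((vector xs :: real^5) $ i) else 0)"

text \<open>
  On \<open>h0\<close> the traces below are real, so that \<open>Re\<close> loses nothing, and the Frobenius norm
  coincides with the norm of the type (lemma \<open>frob_norm_eq_norm\<close>).  Limits, continuity,
  measurability and derivatives refer to the topology of the type.
\<close>

definition frob_norm :: "cmat5 \<Rightarrow> real" where
  "frob_norm A = sqrt (Re (trace (A ** A)))"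

lemma frob_norm_eq_norm:
  assumes "A \<in> h0"
  shows "frob_norm A = norm A"
proof -
  have herm: "A $ j $ i = cnj (A $ i $ j)" for i j
  proof -
    have "dagger A $ j $ i = A $ j $ i" using assms by (simp add: h0_def)
    then show ?thesis by (simp add: dagger_def)
  qed
  have "A $ i $ j * A $ j $ i = of_real ((norm (A $ i $ j))\<^sup>2)" for i j
    unfolding herm[of j i] by (simp only: complex_norm_square)
  then have "Re (trace (A ** A)) = (\<Sum>i\<in>UNIV. \<Sum>j\<in>UNIV. (norm (A $ i $ j))\<^sup>2)"
    by (simp add: trace_def matrix_matrix_mult_def)
  also have "\<dots> = (norm A)\<^sup>2"
    by (simp add: norm_vec_def L2_set_def sum_nonneg)
  finally show ?thesis by (simp add: frob_norm_def)
qed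


section \<open>Potential, vacua and kink\<close>

definition potential :: "real \<Rightarrow> real \<Rightarrow> real \<Rightarrow> real \<Rightarrow> cmat5 \<Rightarrow> real" where
  "potential \<mu> h lam V0 \<Phi> =
     - \<mu>\<^sup>2 * Re (trace (\<Phi> ** \<Phi>)) + h * (Re (trace (\<Phi> ** \<Phi>)))\<^sup>2
     + lam * Re (trace (\<Phi> ** \<Phi> ** \<Phi> ** \<Phi>)) + V0"

definition SU5_orbit :: "cmat5 \<Rightarrow> cmat5 set" where
  "SU5_orbit \<Phi> = {dagger U ** \<Phi> ** U | U. U \<in> SU5}"

definition vev :: "real \<Rightarrow> real \<Rightarrow> real" where
  "vev \<mu> h = 3 * \<mu> / (10 * sqrt h)"

definition Sigma_plus :: "real \<Rightarrow> real \<Rightarrow> cmat5 set" where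
  "Sigma_plus \<mu> h = SU5_orbit (vev \<mu> h *\<^sub>R diag5 [1, 1, 1, 1, -4])"

definition Sigma_minus :: "real \<Rightarrow> real \<Rightarrow> cmat5 set" where
  "Sigma_minus \<mu> h = SU5_orbit (vev \<mu> h *\<^sub>R diag5 [-1, -1, -1, 4, -1])"

definition kink :: "real \<Rightarrow> real \<Rightarrow> real \<Rightarrow> cmat5" where
  "kink \<mu> h z = (3 * \<mu> / (4 * sqrt h)) *\<^sub>R
     (diag5 [0, 0, 0, 1, -1] + (1 / 5 * tanh (\<mu> * z / sqrt 2)) *\<^sub>R diag5 [2, 2, 2, -3, -3])"


section \<open>Sobolev functions on the line\<close>

definition test_function :: "(real \<Rightarrow> real) \<Rightarrow> bool" where
  "test_function \<phi> \<longleftrightarrow>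
     (\<forall>k x. (deriv ^^ k) \<phi> field_differentiable (at x)) \<and>
     (\<exists>K. compact K \<and> (\<forall>x. x \<notin> K \<longrightarrow> \<phi> x = 0))"

definition L2_loc :: "(real \<Rightarrow> cmat5) set" where
  "L2_loc = {f. range f \<subseteq> h0 \<and> f \<in> borel_measurable lborel \<and>
     (\<forall>K. compact K \<longrightarrow> set_integrable lborel K (\<lambda>z. (frob_norm (f z))\<^sup>2))}"

definition has_weak_derivative :: "(real \<Rightarrow> cmat5) \<Rightarrow> (real \<Rightarrow> cmat5) \<Rightarrow> bool" where
  "has_weak_derivative \<Psi> g \<longleftrightarrow> \<Psi> \<in> L2_loc \<and> g \<in> L2_loc \<and>
     (\<forall>\<phi>. test_function \<phi> \<longrightarrow>
        (LINT z|lborel. deriv \<phi> z *\<^sub>R \<Psi> z) = - (LINT z|lborel. \<phi> z *\<^sub>R g z))"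

definition H1_loc :: "(real \<Rightarrow> cmat5) set" where
  "H1_loc = {\<Psi>. \<exists>g. has_weak_derivative \<Psi> g}"

text \<open>A representative of the weak derivative, which is unique up to null sets.\<close>

definition weak_deriv :: "(real \<Rightarrow> cmat5) \<Rightarrow> real \<Rightarrow> cmat5" where
  "weak_deriv \<Psi> = (SOME g. has_weak_derivative \<Psi> g)"

definition connecting :: "(cmat5 \<Rightarrow> real) \<Rightarrow> cmat5 \<Rightarrow> cmat5 \<Rightarrow> (real \<Rightarrow> cmat5) set" where
  "connecting V Am Ap = {\<Psi>. \<Psi> \<in> H1_loc \<and> continuous_on UNIV \<Psi> \<and>
     integrable lborel (\<lambda>z. (frob_norm (weak_deriv \<Psi> z))\<^sup>2) \<and>
     integrable lborel (\<lambda>z. V (\<Psi> z)) \<and>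
     (\<Psi> \<longlongrightarrow> Am) at_bot \<and> (\<Psi> \<longlongrightarrow> Ap) at_top}"

definition connecting_sets ::
    "(cmat5 \<Rightarrow> real) \<Rightarrow> cmat5 set \<Rightarrow> cmat5 set \<Rightarrow> (real \<Rightarrow> cmat5) set" where
  "connecting_sets V Sm Sp = (\<Union>Am\<in>Sm. \<Union>Ap\<in>Sp. connecting V Am Ap)"

definition energy :: "(cmat5 \<Rightarrow> real) \<Rightarrow> (real \<Rightarrow> cmat5) \<Rightarrow> real" where
  "energy V \<Psi> = (LINT z|lborel. (frob_norm (weak_deriv \<Psi> z))\<^sup>2 + V (\<Psi> z))"


section \<open>Weighted distance\<close>

definition abs_continuous_on :: "real set \<Rightarrow> (real \<Rightarrow> cmat5) \<Rightarrow> bool" where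
  "abs_continuous_on S f \<longleftrightarrow>
     (\<forall>\<epsilon>>0. \<exists>\<delta>>0. \<forall>I :: (real \<times> real) set.
        finite I \<and> (\<forall>(a, b)\<in>I. a \<le> b \<and> {a..b} \<subseteq> S) \<and>
        disjoint_family_on (\<lambda>(a, b). {a<..<b}) I \<and> (\<Sum>(a, b)\<in>I. b - a) < \<delta>
        \<longrightarrow> (\<Sum>(a, b)\<in>I. norm (f b - f a)) < \<epsilon>)"

text \<open>
  An absolutely continuous curve has a derivative at almost every time, and the length does not
  depend on the values chosen at the remaining times.  This derivative is the function \<open>\<gamma>'\<close>
  below.  Lengths and their infimum are taken in \<open>[0, \<infinity>]\<close>.
\<close>

definition degenerate_dist :: "(cmat5 \<Rightarrow> real) \<Rightarrow> cmat5 set \<Rightarrow> cmat5 set \<Rightarrow> ennreal" where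
  "degenerate_dist V Sm Sp =
     Inf {2 * (\<integral>\<^sup>+t\<in>{0..1}. ennreal (sqrt (V (\<gamma> t)) * frob_norm (\<gamma>' t)) \<partial>lborel) | \<gamma> \<gamma>'.
       \<gamma> ` {0..1} \<subseteq> h0 \<and> abs_continuous_on {0..1} \<gamma> \<and>
       (AE t in lborel. t \<in> {0..1} \<longrightarrow> (\<gamma> has_vector_derivative \<gamma>' t) (at t within {0..1})) \<and>
       \<gamma> 0 \<in> Sm \<and> \<gamma> 1 \<in> Sp}"

end

theory Submission
  imports Defs "HOL-Computational_Algebra.Polynomial"
begin

text \<open>
  The proof is by calibration.  Let \<open>y(\<Phi>)\<close> be minus one sixth of the sum of the largest and the
  smallest eigenvalue of \<open>\<Phi>\<close>, and let \<open>c = 3\<mu> / (20\<surd>h)\<close>.  Then \<open>y = c\<close> on the vacuum manifold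
  of the right end and \<open>y = -c\<close> on that of the left end, \<open>y\<close> is Lipschitz on \<open>h0\<close> with constant
  \<open>1/\<surd>30\<close>, and for the given ratio of the couplings \<open>V(\<Phi>) \<ge> (2000/3) h (y\<^sup>2 - c\<^sup>2)\<^sup>2\<close>.  Hence
  a primitive \<open>G(y)\<close> of \<open>2\<surd>30 \<surd>(2000h/3) (c\<^sup>2 - y\<^sup>2)\<close> grows along a curve \<open>\<gamma>\<close> at rate at most
  \<open>2\<surd>V \<parallel>\<gamma>'\<parallel> \<le> \<parallel>\<gamma>'\<parallel>\<^sup>2 + V\<close>, and both the energy and the weighted length of a connecting curve
  are at least \<open>G(c) - G(-c)\<close>.  The kink runs along a straight segment on which all these
  inequalities are equalities.
\<close>


section \<open>Spectral decomposition of Hermitian matrices\<close>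

text \<open>Where the extreme eigenvalues are simple with unit eigenvectors u and w, the gradient of
  y on \<open>h0\<close> is -1/6 times the traceless part of the sum of the projections onto u and
  w. That part has norm sqrt (6/5), which gives 1/sqrt 30. Orthogonality of u and w is essential:
  estimating the two eigenvalues separately gives a larger constant and loses the sharp energy.

  The obstacle is that y fails to be differentiable where an extreme eigenvalue is multiple, as it
  is on both vacuum manifolds, and a competitor may spend a set of times of positive measure at such
  matrices. Hence there is no chain rule for G(y) along a curve. Instead, local Lipschitz estimates
  with arbitrarily small error are added up over subdivisions of an interval.

  The factor 2000/3 is the one for which V equals its bound along the segment between the vacua. The
  rate \<mu> / sqrt 2 of the tanh profile is the one for which the gradient and the potential carry
  the same energy at every point.\<close>

text \<open>A maximizer \<open>u\<close> of the quadratic form on the unit sphere of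
  \<open>W\<close> is critical: the residual \<open>w\<close> of the eigenvalue equation lies in
  \<open>W\<close> and is orthogonal to \<open>u\<close>, and moving \<open>u\<close> by
  \<open>t\<close> along \<open>w\<close> gains \<open>2 * t * (w \<bullet> w)\<close> to first
  order, which maximality excludes unless \<open>w = 0\<close>.\<close>

lemma rayleigh_maximizer:
  fixes f :: "'a::euclidean_space \<Rightarrow> 'a"
  assumes lin: "linear f" and selfadj: "\<And>x y. x \<bullet> f y = f x \<bullet> y"
    and W: "subspace W" "f ` W \<subseteq> W" and ne: "\<exists>x\<in>W. x \<noteq> 0"
  obtains u where "u \<in> W" "norm u = 1" "f u = (u \<bullet> f u) *\<^sub>R u"
    "\<And>x. x \<in> W \<Longrightarrow> x \<bullet> f x \<le> (u \<bullet> f u) * (x \<bullet> x)"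
proof -
  let ?S = "sphere 0 1 \<inter> W"
  interpret linear f by (rule lin)
  have "compact ?S"
    by (intro compact_Int_closed compact_sphere closed_subspace W)
  moreover obtain x0 where "x0 \<in> W" "x0 \<noteq> 0" using ne by blast
  then have "x0 /\<^sub>R norm x0 \<in> ?S" by (simp add: subspace_scale[OF W(1)])
  then have "?S \<noteq> {}" by blast
  moreover have "continuous_on ?S (\<lambda>x. x \<bullet> f x)"
    by (intro continuous_intros linear_continuous_on) (simp add: lin linear_conv_bounded_linear[symmetric])
  ultimately obtain u where u: "u \<in> ?S" and max: "\<And>x. x \<in> ?S \<Longrightarrow> x \<bullet> f x \<le> u \<bullet> f u"
    using continuous_attains_sup[of ?S "\<lambda>x. x \<bullet> f x"] by blast
  have uW: "u \<in> W" and u1: "norm u = 1" using u by auto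
  define c where "c = u \<bullet> f u"
  have bound: "x \<bullet> f x \<le> c * (x \<bullet> x)" if "x \<in> W" for x
  proof (cases "x = 0")
    case False
    have "x /\<^sub>R norm x \<in> ?S" using that False by (simp add: subspace_scale[OF W(1)])
    from max[OF this] have "(x /\<^sub>R norm x) \<bullet> f (x /\<^sub>R norm x) \<le> c" by (simp add: c_def)
    then have "(x \<bullet> f x) / (norm x)\<^sup>2 \<le> c"
      by (simp add: scale power2_eq_square divide_simps)
    then show ?thesis using False by (simp add: divide_simps power2_norm_eq_inner)
  qed simp
  define w where "w = f u - c *\<^sub>R u"
  have wW: "w \<in> W" using uW W by (auto simp: w_def intro: subspace_diff subspace_scale)
  have uw: "u \<bullet> w = 0" "w \<bullet> u = 0"
    using u1 by (auto simp: w_def inner_diff c_def inner_commute norm_eq_1)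
  have fw: "u \<bullet> f w = w \<bullet> w"
  proof -
    have "u \<bullet> f w = w \<bullet> f u" using selfadj[of u w] by (simp add: inner_commute)
    also have "\<dots> = w \<bullet> (w + c *\<^sub>R u)" by (simp add: w_def)
    finally show ?thesis using uw by (simp add: inner_add)
  qed
  have var: "2 * t * (w \<bullet> w) \<le> t\<^sup>2 * (c * (w \<bullet> w) - w \<bullet> f w)" for t
  proof -
    have "(u + t *\<^sub>R w) \<bullet> f (u + t *\<^sub>R w) \<le> c * ((u + t *\<^sub>R w) \<bullet> (u + t *\<^sub>R w))"
      by (intro bound subspace_add subspace_scale W uW wW)
    moreover have "w \<bullet> f u = w \<bullet> w" using fw selfadj[of u w] by (simp add: inner_commute)
    moreover have "u \<bullet> u = 1" using u1 by (simp add: norm_eq_1)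
    ultimately show ?thesis using uw fw
      by (simp add: add scale inner_add c_def[symmetric] algebra_simps power2_eq_square)
  qed
  have "w \<bullet> w \<le> 0"
  proof (rule ccontr)
    assume "\<not> w \<bullet> w \<le> 0"
    then have pos: "w \<bullet> w > 0" by linarith
    define D where "D = \<bar>c * (w \<bullet> w) - w \<bullet> f w\<bar> + 1"
    have D: "D > 0" "c * (w \<bullet> w) - w \<bullet> f w \<le> D" by (auto simp: D_def)
    \<comment> \<open>For this \<open>t\<close> the quadratic term is at most half of the linear
      one.\<close>
    define t where "t = (w \<bullet> w) / D"
    have t: "t > 0" "t * D = w \<bullet> w" using pos D by (auto simp: t_def)
    have "2 * t * (w \<bullet> w) \<le> t\<^sup>2 * D"
      using var[of t] D(2) by (meson mult_left_mono order_trans zero_le_power2)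
    also have "\<dots> = t * (w \<bullet> w)" using t(2) by (simp add: power2_eq_square)
    finally show False using t(1) pos by (simp add: mult_less_0_iff)
  qed
  then have "w = 0" by (metis inner_gt_zero_iff leD)
  then have "f u = c *\<^sub>R u" by (simp add: w_def)
  then show ?thesis using that[OF uW u1] bound c_def by blast
qed

text \<open>The type class inner product on \<open>complex^'n\<close> is only the real part of this
  form. Diagonalisation by a unitary matrix asks for orthogonality over the complex numbers.\<close>

definition cinner :: "complex^'n \<Rightarrow> complex^'n \<Rightarrow> complex" where
  "cinner x y = (\<Sum>i\<in>UNIV. cnj (x $ i) * y $ i)"

lemma inner_eq_Re_cinner: "x \<bullet> y = Re (cinner x y)"
  by (simp add: cinner_def inner_vec_def inner_complex_def)

lemma cinner_self: "cinner x x = of_real ((norm x)\<^sup>2)"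
proof -
  have "cinner x x = (\<Sum>i\<in>UNIV. of_real ((norm (x $ i))\<^sup>2))"
    unfolding cinner_def by (intro sum.cong refl) (simp only: complex_norm_square mult.commute)
  then show ?thesis by (simp add: norm_vec_def L2_set_def sum_nonneg)
qed

lemma cinner_commute: "cinner y x = cnj (cinner x y)"
  by (simp add: cinner_def mult.commute)

lemma cinner_right:
  "cinner x (y + z) = cinner x y + cinner x z" "cinner x (y - z) = cinner x y - cinner x z"
  "cinner x (r *\<^sub>R y) = of_real r * cinner x y"  "cinner x (c *s y) = c * cinner x y"
  "cinner x 0 = 0"
  unfolding cinner_def
  by (simp_all add: algebra_simps sum.distrib sum_subtractf sum_distrib_left)
     (simp add: scaleR_conv_of_real scaleR_sum_right mult_ac)

lemma cinner_left: 
  "cinner (r *\<^sub>R x) y = of_real r * cinner x y" "cinner (c *s x) y = cnj c * cinner x y"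
  unfolding cinner_def
  by (simp_all add: algebra_simps sum_distrib_left)
     (simp add: scaleR_conv_of_real scaleR_sum_right mult_ac)

definition hermitian :: "complex^'n^'n \<Rightarrow> bool" where
  "hermitian A \<longleftrightarrow> (\<forall>i j. A $ j $ i = cnj (A $ i $ j))"

lemma cinner_hermitian:
  assumes "hermitian A"
  shows "cinner x (A *v y) = cinner (A *v x) y"
proof -
  have eq: "cnj (A $ i $ j) = A $ j $ i" for i j using assms unfolding hermitian_def by metis
  have "cinner x (A *v y) = (\<Sum>i\<in>UNIV. \<Sum>j\<in>UNIV. cnj (x $ i) * (A $ i $ j * y $ j))"
    by (simp add: cinner_def matrix_vector_mult_def sum_distrib_left)
  also have "\<dots> = (\<Sum>j\<in>UNIV. \<Sum>i\<in>UNIV. cnj (x $ i) * (A $ i $ j * y $ j))"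
    by (rule sum.swap)
  also have "\<dots> = (\<Sum>j\<in>UNIV. \<Sum>i\<in>UNIV. cnj (A $ j $ i * x $ i) * y $ j)"
    by (intro sum.cong refl) (simp only: complex_cnj_mult eq mult_ac)
  also have "\<dots> = cinner (A *v x) y"
    by (simp add: cinner_def matrix_vector_mult_def sum_distrib_right)
  finally show ?thesis .
qed

lemma linear_cmatrix: "linear (\<lambda>x. (A :: complex^'n^'m) *v x)"
  by (rule linearI) (auto simp: vec_eq_iff matrix_vector_mult_def algebra_simps sum.distrib scaleR_sum_right)

lemma inner_hermitian: "hermitian A \<Longrightarrow> x \<bullet> (A *v y) = (A *v x) \<bullet> y"
  by (simp add: inner_eq_Re_cinner cinner_hermitian)

text \<open>Induction over sets of indices, so that the eigenvectors come out labelled by the index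
  type. Each step applies \<open>rayleigh_maximizer\<close> to the complex orthogonal complement of
  the eigenvectors found so far, which \<open>A\<close> maps into itself.\<close>

lemma hermitian_eigenbasis:
  fixes A :: "complex^'n^'n"
  assumes A: "hermitian A" and "finite S"
  shows "\<exists>u l. (\<forall>i\<in>S. A *v u i = (l i :: real) *\<^sub>R u i) \<and>
            (\<forall>i\<in>S. \<forall>j\<in>S. cinner (u i) (u j) = (if i = (j::'n) then 1 else 0))"
  using \<open>finite S\<close>
proof (induction S)
  case (insert k S)
  then obtain u l where ul: "\<And>i. i \<in> S \<Longrightarrow> A *v u i = (l i :: real) *\<^sub>R u i"
    "\<And>i j. i \<in> S \<Longrightarrow> j \<in> S \<Longrightarrow> cinner (u i) (u j) = (if i = j then 1 else 0)" by blast
  define W where "W = {x. \<forall>i\<in>S. cinner (u i) x = 0}"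
  have sub: "subspace W" by (auto simp: W_def subspace_def cinner_right)
  have inv: "(\<lambda>x. A *v x) ` W \<subseteq> W"
    by (auto simp: W_def cinner_hermitian[OF A] ul cinner_left)
  have ex: "\<exists>x\<in>W. x \<noteq> 0"
  proof -
    \<comment> \<open>Real orthogonality to \<open>u i\<close> and to i times \<open>u i\<close>
      amounts to complex orthogonality to \<open>u i\<close>; these vectors are too few to span the
      space over the reals.\<close>
    let ?B = "u ` S \<union> (\<lambda>i. \<i> *s u i) ` S"
    have "dim ?B \<le> card ?B" by (rule dim_le_card') (use insert in auto)
    also have "\<dots> \<le> card S + card S"
      by (rule order_trans[OF card_Un_le add_mono[OF card_image_le card_image_le]]) (use insert in auto)
    also have "\<dots> < 2 * CARD('n)"
    proof -
      have "card S < CARD('n)" using insert by (intro psubset_card_mono) auto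
      then show ?thesis by simp
    qed
    finally have "dim ?B < DIM(complex^'n)" by simp
    then obtain x where x: "x \<noteq> 0" "\<And>y. y \<in> span ?B \<Longrightarrow> orthogonal x y"
      using orthogonal_to_subspace_exists by blast
    have "cinner (u i) x = 0" if "i \<in> S" for i
    proof (rule complex_eqI)
      have "u i \<bullet> x = 0" "(\<i> *s u i) \<bullet> x = 0"
        using that x(2)[of "u i"] x(2)[of "\<i> *s u i"]
        by (auto simp: orthogonal_def inner_commute intro!: span_base)
      then show "Re (cinner (u i) x) = Re 0" "Im (cinner (u i) x) = Im 0"
        by (auto simp: inner_eq_Re_cinner cinner_left)
    qed
    then show ?thesis using x(1) by (auto simp: W_def)
  qed
  obtain v where v: "v \<in> W" "norm v = 1" "A *v v = (v \<bullet> (A *v v)) *\<^sub>R v"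
    by (rule rayleigh_maximizer[OF linear_cmatrix[of A] inner_hermitian[OF A] sub inv ex]) blast
  have "cinner (u i) v = 0" "cinner v (u i) = 0" if "i \<in> S" for i
    using v(1) that cinner_commute[of v "u i"] by (auto simp: W_def)
  moreover define c where "c = v \<bullet> (A *v v)"
  moreover have "cinner v v = 1" using v(2) by (simp add: cinner_self)
  moreover have "A *v v = c *\<^sub>R v" unfolding c_def by (rule v(3))
  ultimately show ?case using insert(2) ul
    by (intro exI[of _ "u(k := v)"] exI[of _ "l(k := c)"]) auto
qed simp

lemma trace_similar:
  fixes A :: "'a::field^'n^'n"
  assumes "Q ** P = mat 1"
  shows "trace (P ** A ** Q) = trace A"
  by (metis assms matrix_mul_assoc matrix_mul_lid trace_mul_sym)

text \<open>With the eigenvectors as columns of \<open>U\<close> and its inverse \<open>Q\<close>,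
  \<open>A = U ** D ** Q\<close> for a diagonal \<open>D\<close>, so traces of powers become power
  sums of eigenvalues.\<close>

lemma hermitian_spectral:
  fixes A :: "complex^'n^'n"
  assumes A: "hermitian A"
  obtains u and l :: "'n \<Rightarrow> real" where
    "\<And>i. A *v u i = l i *\<^sub>R u i" "\<And>i j. cinner (u i) (u j) = (if i = j then 1 else 0)"
    "trace A = of_real (\<Sum>i\<in>UNIV. l i)" "trace (A ** A) = of_real (\<Sum>i\<in>UNIV. l i ^ 2)"
    "trace (A ** A ** A ** A) = of_real (\<Sum>i\<in>UNIV. l i ^ 4)"
proof -
  obtain u l where ul: "\<And>i. A *v u i = (l i :: real) *\<^sub>R u i"
    "\<And>i j. cinner (u i) (u j) = (if i = (j::'n) then 1 else 0)"
    using hermitian_eigenbasis[OF A, of UNIV] by auto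
  define U where "U = (\<chi> i j. u j $ i)"
  define Q where "Q = (\<chi> i j. cnj (u i $ j))"
  define D where "D = (\<chi> i j. if i = j then complex_of_real (l i) else 0)"
  have QU: "Q ** U = mat 1"
    using ul(2) by (simp add: Q_def U_def matrix_matrix_mult_def mat_def cinner_def vec_eq_iff)
  then have UQ: "U ** Q = mat 1" by (simp add: matrix_left_right_inverse)
  have "A ** U = U ** D"
  proof -
    have "(A ** U) $ i $ j = (U ** D) $ i $ j" for i j
    proof -
      have "(A ** U) $ i $ j = (A *v u j) $ i"
        by (simp add: U_def matrix_matrix_mult_def matrix_vector_mult_def)
      also have "\<dots> = of_real (l j) * u j $ i" by (simp add: ul(1)) (simp add: scaleR_conv_of_real)
      also have "\<dots> = (U ** D) $ i $ j"
        by (simp add: U_def D_def matrix_matrix_mult_def if_distrib sum.delta' cong: if_cong)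
      finally show ?thesis .
    qed
    then show ?thesis by (simp add: vec_eq_iff)
  qed
  then have AD: "A = U ** D ** Q" by (metis UQ matrix_mul_assoc matrix_mul_rid)
  have mult: "(U ** X ** Q) ** (U ** Y ** Q) = U ** (X ** Y) ** Q" for X Y
    by (metis QU matrix_mul_assoc matrix_mul_rid)
  have DD: "D ** D = (\<chi> i j. if i = j then complex_of_real (l i ^ 2) else 0)"
    by (simp add: D_def matrix_matrix_mult_def vec_eq_iff if_distrib[of "\<lambda>x. _ * x"] power2_eq_square cong: if_cong)
  have D4: "D ** D ** (D ** D) = (\<chi> i j. if i = j then complex_of_real (l i ^ 4) else 0)"
    unfolding DD by (simp add: matrix_matrix_mult_def vec_eq_iff if_distrib[of "\<lambda>x. _ * x"] power4_eq_xxxx power2_eq_square mult_ac cong: if_cong)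
  have tr: "trace A = trace D" "trace (A ** A) = trace (D ** D)"
    by (simp_all add: AD mult trace_similar[OF QU])
  have "A ** A ** A ** A = (A ** A) ** (A ** A)" by (simp add: matrix_mul_assoc)
  then have "trace (A ** A ** A ** A) = trace (D ** D ** (D ** D))"
    by (simp add: AD mult trace_similar[OF QU])
  moreover have "trace (D ** D ** (D ** D)) = of_real (\<Sum>i\<in>UNIV. l i ^ 4)"
    unfolding D4 by (simp add: trace_def)
  moreover have "trace (D ** D) = of_real (\<Sum>i\<in>UNIV. l i ^ 2)" "trace D = of_real (\<Sum>i\<in>UNIV. l i)"
    unfolding DD by (simp_all add: trace_def D_def)
  ultimately show ?thesis using that[OF ul] tr by simp
qed

lemma cinner_orthonormal_complete:
  fixes u :: "'n \<Rightarrow> complex^'n"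
  assumes "\<And>i j. cinner (u i) (u j) = (if i = j then 1 else 0)" "\<And>i. cinner (u i) x = 0"
  shows "x = 0"
proof -
  define U where "U = (\<chi> i j. u j $ i)"
  define Q where "Q = (\<chi> i j. cnj (u i $ j))"
  have "Q ** U = mat 1"
    using assms(1) by (simp add: Q_def U_def matrix_matrix_mult_def mat_def cinner_def vec_eq_iff)
  then have "U ** Q = mat 1" by (simp add: matrix_left_right_inverse)
  moreover have "Q *v x = 0"
    using assms(2) by (simp add: Q_def matrix_vector_mult_def cinner_def vec_eq_iff)
  ultimately show ?thesis
    by (metis matrix_vector_mul_assoc matrix_vector_mul_lid matrix_vector_mult_0_right)
qed

section \<open>Norm estimates and the largest eigenvalue of a Hermitian matrix\<close>

lemma norm_sum_mult_le: "norm (\<Sum>i\<in>UNIV. x $ i * y $ i) \<le> norm x * norm (y :: complex^'n)"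
proof -
  have "norm (\<Sum>i\<in>UNIV. x $ i * y $ i) \<le> (\<Sum>i\<in>UNIV. \<bar>norm (x $ i)\<bar> * \<bar>norm (y $ i)\<bar>)"
    by (rule order_trans[OF norm_sum]) (simp add: norm_mult)
  also have "\<dots> \<le> norm x * norm y" unfolding norm_vec_def by (rule L2_set_mult_ineq)
  finally show ?thesis .
qed

lemma cmod_cinner_le: "cmod (cinner x y) \<le> norm x * norm y"
  using norm_sum_mult_le[of "\<chi> i. cnj (x $ i)" y] by (simp add: cinner_def norm_vec_def)

lemma norm_cmatrix_vector_le: "norm (M *v x) \<le> norm M * norm (x :: complex^'n)"
proof -
  have "norm (M *v x) \<le> L2_set (\<lambda>i. norm (M $ i) * norm x) UNIV"
    unfolding norm_vec_def[of "M *v x"]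
    by (rule L2_set_mono) (auto simp: matrix_vector_mult_def norm_sum_mult_le)
  also have "\<dots> = norm M * norm x" by (simp add: L2_set_left_distrib norm_vec_def)
  finally show ?thesis .
qed

text \<open>For Hermitian \<open>A\<close> this is the largest eigenvalue. As a supremum it can be
  compared for two matrices by testing one with the maximizer of the other.\<close>

definition lmax :: "complex^'n^'n \<Rightarrow> real" where
  "lmax A = (SUP x\<in>sphere 0 1. x \<bullet> (A *v x))"

lemma lmax_attained:
  assumes A: "hermitian (A :: complex^'n^'n)"
  obtains u where "norm u = 1" "A *v u = lmax A *\<^sub>R u" "u \<bullet> (A *v u) = lmax A"
    "\<And>x. norm x = 1 \<Longrightarrow> x \<bullet> (A *v x) \<le> lmax A"
proof -
  have "\<exists>x\<in>UNIV. x \<noteq> (0 :: complex^'n)"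
    by (rule bexI[of _ "axis undefined 1"]) (auto simp: axis_eq_0_iff)
  from rayleigh_maximizer[OF linear_cmatrix[of A] inner_hermitian[OF A] subspace_UNIV _ this]
  obtain u where u: "norm u = 1" "A *v u = (u \<bullet> (A *v u)) *\<^sub>R u"
      "\<And>x. x \<bullet> (A *v x) \<le> (u \<bullet> (A *v u)) * (x \<bullet> x)"
    by (metis UNIV_I subset_UNIV)
  have le: "x \<bullet> (A *v x) \<le> u \<bullet> (A *v u)" if "norm x = 1" for x
    using u(3)[of x] that unfolding norm_eq_1 by simp
  have "lmax A = u \<bullet> (A *v u)"
    unfolding lmax_def using u(1) le by (intro cSup_eq_maximum) auto
  with that u le show ?thesis by metis
qed

lemma le_lmax: "hermitian A \<Longrightarrow> norm x = 1 \<Longrightarrow> x \<bullet> (A *v x) \<le> lmax A"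
  by (metis lmax_attained)

lemma hermitianI: "(\<And>i j. A $ j $ i = cnj (A $ i $ j)) \<Longrightarrow> hermitian A"
  unfolding hermitian_def by blast

lemma hermitianD: "hermitian A \<Longrightarrow> A $ j $ i = cnj (A $ i $ j)"
  unfolding hermitian_def by blast

lemma hermitian_scaleR: "hermitian A \<Longrightarrow> hermitian (r *\<^sub>R A)"
  by (rule hermitianI) (simp, metis hermitianD)

lemma hermitian_minus: "hermitian A \<Longrightarrow> hermitian (- A)"
  using hermitian_scaleR[of A "- 1"] by simp

lemma hermitian_add: "hermitian A \<Longrightarrow> hermitian B \<Longrightarrow> hermitian (A + B)"
  by (rule hermitianI) (simp, metis hermitianD)


lemma cmatrix_vector_algebra:
  "(- A) *v x = - (A *v x)" "(r *\<^sub>R A) *v x = r *\<^sub>R (A *v (x :: complex^'n))"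
  by (auto simp: vec_eq_iff matrix_vector_mult_def scaleR_sum_right sum_negf)

lemma lmax_eq_Max:
  assumes A: "hermitian (A :: complex^'n^'n)" and l: "\<And>i::'n. A *v u i = l i *\<^sub>R u i"
    and u: "\<And>i j. cinner (u i) (u j) = (if i = j then 1 else 0)"
  shows "lmax A = Max (range l)"
proof (rule antisym)
  obtain v where v: "norm v = 1" "A *v v = lmax A *\<^sub>R v" using lmax_attained[OF A] by metis
  then have "v \<noteq> 0" by auto
  then obtain i where i: "cinner (u i) v \<noteq> 0" using cinner_orthonormal_complete[of u v] u by blast
  have "of_real (lmax A) * cinner (u i) v = of_real (l i) * cinner (u i) v"
    using cinner_hermitian[OF A, of "u i" v] by (simp add: l v(2) cinner_left cinner_right)
  with i have "lmax A = l i" by simp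
  then show "lmax A \<le> Max (range l)" by simp
next
  have "l i \<le> lmax A" for i
  proof -
    have 1: "cinner (u i) (u i) = 1" using u by simp
    then have "u i \<bullet> u i = 1" by (simp add: inner_eq_Re_cinner)
    then have "norm (u i) = 1" by (simp add: norm_eq_1)
    from le_lmax[OF A this] show ?thesis by (simp add: l \<open>u i \<bullet> u i = 1\<close>)
  qed
  then show "Max (range l) \<le> lmax A" by simp
qed

lemma lmax_scale:
  assumes A: "hermitian A" and t: "t \<ge> 0"
  shows "lmax (t *\<^sub>R A) = t * lmax A"
proof (rule antisym)
  obtain u where u: "norm u = 1" "u \<bullet> (A *v u) = lmax A" using lmax_attained[OF A] by metis
  obtain v where v: "norm v = 1" "v \<bullet> ((t *\<^sub>R A) *v v) = lmax (t *\<^sub>R A)"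
    using lmax_attained[OF hermitian_scaleR[OF A]] by metis
  have "t * (v \<bullet> (A *v v)) \<le> t * lmax A" using le_lmax[OF A v(1)] t by (rule mult_left_mono)
  then show "lmax (t *\<^sub>R A) \<le> t * lmax A" using v(2) by (simp add: cmatrix_vector_algebra)
  show "t * lmax A \<le> lmax (t *\<^sub>R A)"
    using le_lmax[OF hermitian_scaleR[OF A] u(1), of t] by (simp add: cmatrix_vector_algebra u(2))
qed

text \<open>The maximizer of \<open>A\<close> is admissible in the supremum for
  \<open>B\<close>.\<close>

lemma lmax_diff_le:
  assumes "hermitian A" "hermitian B" "norm u = 1" "u \<bullet> (A *v u) = lmax A"
  shows "lmax A - lmax B \<le> u \<bullet> ((A - B) *v u)"
  using le_lmax[OF assms(2,3)] assms(4) by (simp add: matrix_vector_mult_diff_rdistrib inner_diff_right)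

lemma lmax_Lipschitz:
  assumes A: "hermitian A" and B: "hermitian B"
  shows "lmax A - lmax B \<le> norm (A - B)"
proof -
  obtain u where u: "norm u = 1" "u \<bullet> (A *v u) = lmax A" using lmax_attained[OF A] by metis
  have "u \<bullet> ((A - B) *v u) \<le> norm u * norm ((A - B) *v u)" by (rule norm_cauchy_schwarz)
  also have "\<dots> \<le> norm (A - B)" using norm_cmatrix_vector_le[of "A - B" u] u(1) by simp
  finally show ?thesis using lmax_diff_le[OF A B u] by linarith
qed


section \<open>The kink coordinate\<close>

text \<open>\<open>- lmax (- A)\<close> is the smallest eigenvalue. The factor 1/6 makes the
  coordinate of \<open>kink_line \<mu> h \<tau>\<close> equal to
  \<open>kink_amp \<mu> h * \<tau>\<close> for -1 \<le> \<tau> \<le> 1.\<close>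

definition kink_coord :: "complex^'n^'n \<Rightarrow> real" where
  "kink_coord A = (lmax (- A) - lmax A) / 6"

lemma h0_iff: "A \<in> h0 \<longleftrightarrow> hermitian A \<and> trace A = 0"
proof -
  have "dagger A = A \<longleftrightarrow> hermitian A"
    unfolding hermitian_def dagger_def vec_eq_iff vec_lambda_beta by metis
  then show ?thesis by (simp add: h0_def)
qed

lemma kink_coord_scale:
  assumes A: "hermitian A" shows "kink_coord (t *\<^sub>R A) = t * kink_coord A"
proof (cases "t \<ge> 0")
  case True
  then show ?thesis
    using lmax_scale[OF A True] lmax_scale[OF hermitian_minus[OF A] True]
    by (simp add: kink_coord_def algebra_simps diff_divide_distrib)
next
  case False
  then have "-t \<ge> 0" by simp
  from lmax_scale[OF A this] lmax_scale[OF hermitian_minus[OF A] this]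
  show ?thesis by (simp add: kink_coord_def algebra_simps diff_divide_distrib)
qed

section \<open>The sharp Lipschitz constant of the kink coordinate\<close>

text \<open>For a unit vector this is the projection onto its line. It turns the quadratic form at
  \<open>u\<close> into an inner product with the matrix, so that a sum of two such forms falls
  under a single Cauchy-Schwarz inequality.\<close>

definition rank_one :: "complex^'n \<Rightarrow> complex^'n^'n" where
  "rank_one u = (\<chi> i j. u $ i * cnj (u $ j))"

lemma inner_rank_one: "M \<bullet> rank_one u = u \<bullet> (M *v u)"
proof -
  have "M \<bullet> rank_one u = Re (\<Sum>i\<in>UNIV. \<Sum>j\<in>UNIV. cnj (u $ i) * (M $ i $ j * u $ j))"
    unfolding inner_vec_def inner_complex_def rank_one_def
    by (simp, intro sum.cong refl) (simp add: algebra_simps)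
  also have "\<dots> = u \<bullet> (M *v u)"
    by (simp add: inner_eq_Re_cinner cinner_def matrix_vector_mult_def sum_distrib_left)
  finally show ?thesis .
qed

lemma rank_one_inner: "rank_one w *v u = cinner w u *s w"
  by (simp add: rank_one_def matrix_vector_mult_def cinner_def vec_eq_iff sum_distrib_left sum_distrib_right mult_ac)

lemma rank_one_inner_rank_one: "rank_one w \<bullet> rank_one u = (cmod (cinner u w))\<^sup>2"
proof -
  have "rank_one w \<bullet> rank_one u = Re (cinner w u * cinner u w)"
    by (simp add: inner_rank_one rank_one_inner inner_eq_Re_cinner cinner_right)
  also have "cinner w u * cinner u w = of_real ((cmod (cinner u w))\<^sup>2)"
    unfolding cinner_commute[of w u] complex_norm_square by (simp add: mult.commute)
  finally show ?thesis by simp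
qed

lemma inner_mat_one: "M \<bullet> mat 1 = Re (trace M)"
proof -
  have "M \<bullet> mat 1 = (\<Sum>i\<in>UNIV. \<Sum>j\<in>UNIV. if i = j then Re (M $ i $ j) else 0)"
    unfolding inner_vec_def mat_def inner_complex_def by (intro sum.cong refl) simp
  then show ?thesis by (simp add: trace_def)
qed

text \<open>
  Subtracting the trace part \<open>2/5\<close> of the sum of two projections is what produces the sharp
  constant \<open>6/5\<close>.
\<close>

lemma two_vector_bound:
  fixes M :: cmat5
  assumes tr: "trace M = 0" and u: "norm u = 1" and w: "norm w = 1"
  shows "u \<bullet> (M *v u) + w \<bullet> (M *v w) \<le> norm M * sqrt (6/5 + 2 * (cmod (cinner u w))\<^sup>2)"
proof -
  define R where "R = rank_one u + rank_one w - (2/5) *\<^sub>R mat 1"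
  have 1: "rank_one v \<bullet> rank_one v = 1" "rank_one v \<bullet> mat 1 = 1" if "norm v = 1" for v :: "complex^5"
  proof -
    have "cinner v v = 1" using that by (simp add: cinner_self)
    then show "rank_one v \<bullet> rank_one v = 1" by (simp add: rank_one_inner_rank_one)
    have "mat 1 \<bullet> rank_one v = 1" using that by (simp add: inner_rank_one norm_eq_1)
    then show "rank_one v \<bullet> mat 1 = 1" by (simp add: inner_commute)
  qed
  have mm: "(mat 1 :: cmat5) \<bullet> mat 1 = 5" unfolding inner_mat_one by (simp add: trace_def mat_def)
  have "R \<bullet> R = 6/5 + 2 * (rank_one w \<bullet> rank_one u)"
    using 1[OF u] 1[OF w] mm inner_commute[of "mat 1" "rank_one u"] inner_commute[of "mat 1" "rank_one w"]
      inner_commute[of "rank_one u" "rank_one w"]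
    unfolding R_def inner_add inner_diff inner_scaleR_left inner_scaleR_right
    by (simp add: algebra_simps)
  then have "norm R = sqrt (6/5 + 2 * (cmod (cinner u w))\<^sup>2)"
    by (simp add: norm_eq_sqrt_inner rank_one_inner_rank_one)
  moreover have "u \<bullet> (M *v u) + w \<bullet> (M *v w) = M \<bullet> R"
    by (simp add: R_def inner_add inner_diff inner_mat_one tr inner_rank_one)
  moreover have "M \<bullet> R \<le> norm M * norm R" by (rule norm_cauchy_schwarz)
  ultimately show ?thesis by simp
qed

lemma sqrt_six_fifths: "sqrt (6/5) = 6 / sqrt 30"
proof -
  have "sqrt (6/5) * sqrt 30 = sqrt 36" by (simp only: real_sqrt_mult[symmetric]) simp
  then show ?thesis by (simp add: field_simps)
qed

lemma lmax_minus_eq_Max: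
  assumes A: "hermitian (A :: complex^'n^'n)" and l: "\<And>i::'n. A *v u i = l i *\<^sub>R u i"
    and u: "\<And>i j. cinner (u i) (u j) = (if i = j then 1 else 0)"
  shows "lmax (- A) = Max (range (\<lambda>i. - l i))"
  by (rule lmax_eq_Max[where u = u, OF hermitian_minus[OF A] _ u]) (simp add: l cmatrix_vector_algebra)

text \<open>Without a gap all eigenvalues agree; trace zero makes them vanish, and with them the
  Frobenius norm.\<close>

lemma spectral_gap_pos:
  assumes C: "C \<in> h0" "C \<noteq> 0" shows "lmax C + lmax (- C) > 0"
proof (rule ccontr)
  assume neg: "\<not> ?thesis"
  have hC: "hermitian C" "trace C = 0" using C by (auto simp: h0_iff)
  obtain u and l :: "5 \<Rightarrow> real" where l: "\<And>i. C *v u i = l i *\<^sub>R u i"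
    "\<And>i j. cinner (u i) (u j) = (if i = j then 1 else 0)" "trace C = of_real (\<Sum>i\<in>UNIV. l i)"
    "trace (C ** C) = of_real (\<Sum>i\<in>UNIV. l i ^ 2)"
    "trace (C ** C ** C ** C) = of_real (\<Sum>i\<in>UNIV. l i ^ 4)"
    by (fact hermitian_spectral[OF hC(1)])
  have m: "lmax C = Max (range l)" "lmax (- C) = Max (range (\<lambda>i. - l i))"
    using lmax_eq_Max[OF hC(1) l(1,2)] lmax_minus_eq_Max[OF hC(1) l(1,2)] by blast+
  have le: "l i \<le> lmax C" "- l i \<le> lmax (- C)" for i unfolding m by (auto intro: Max_ge)
  have "l i \<le> l j" for i j using le(1)[of i] le(2)[of j] neg by linarith
  then have eq: "l i = l undefined" for i by (intro antisym) blast+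
  have "(\<Sum>i\<in>UNIV. l i) = 0" using l(3) hC(2) by (metis of_real_eq_0_iff)
  then have "(\<Sum>i\<in>(UNIV::5 set). l undefined) = 0" by (subst (asm) sum.cong[OF refl eq]) simp_all
  then have "l undefined = 0" by simp
  then have "l i = 0" for i using eq[of i] by simp
  then have "trace (C ** C) = 0" using l(4) by simp
  then have "norm C = 0" using frob_norm_eq_norm[OF C(1)] by (simp add: frob_norm_def)
  with C show False by simp
qed

text \<open>An estimate of Davis-Kahan type: the form of \<open>A - B\<close> between the two
  eigenvectors is \<open>a + b\<close> times their overlap. A top eigenvector and a bottom
  eigenvector of nearby matrices are therefore almost orthogonal.\<close>

lemma eigenvector_overlap:
  assumes A: "hermitian A" and u: "A *v u = a *\<^sub>R u" and w: "B *v w = (- b) *\<^sub>R w"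
    and n: "norm u = 1" "norm w = 1" and ab: "a + b \<ge> 0"
  shows "(a + b) * cmod (cinner u w) \<le> norm (A - B)"
proof -
  have "cinner u ((A - B) *v w) = of_real (a + b) * cinner u w"
    using cinner_hermitian[OF A, of u w]
    by (simp add: matrix_vector_mult_diff_rdistrib u w cinner_right cinner_left algebra_simps)
  then have "(a + b) * cmod (cinner u w) = cmod (cinner u ((A - B) *v w))"
    using ab by (simp add: norm_mult del: of_real_add)
  also have "\<dots> \<le> norm u * norm ((A - B) *v w)" by (rule cmod_cinner_le)
  also have "\<dots> \<le> norm (A - B)" using norm_cmatrix_vector_le[of "A - B" w] n by simp
  finally show ?thesis .
qed

lemma bottom_eigenvector:
  assumes B: "hermitian B"
  obtains w where "norm w = 1" "B *v w = (- lmax (- B)) *\<^sub>R w" "w \<bullet> (- B *v w) = lmax (- B)"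
proof -
  obtain w where "norm w = 1" "- B *v w = lmax (- B) *\<^sub>R w" "w \<bullet> (- B *v w) = lmax (- B)"
    using lmax_attained[OF hermitian_minus[OF B]] by metis
  moreover have "- B *v w = - (B *v w)" by (simp add: cmatrix_vector_algebra)
  ultimately show ?thesis using that by (metis minus_minus scaleR_minus_left)
qed

text \<open>Six times the difference is \<open>lmax A - lmax B\<close> plus
  \<open>lmax (- B) - lmax (- A)\<close>. The first is tested with the top eigenvector of
  \<open>A\<close>, the second with the bottom eigenvector of \<open>B\<close>. Belonging to
  different matrices, these need not be orthogonal, but their overlap is at most
  \<open>norm (A - B) / g\<close>, so the loss against the sharp constant is of second
  order.\<close>

lemma kink_coord_diff_le:
  fixes A B :: cmat5
  assumes "A \<in> h0" "B \<in> h0" and gap: "g > 0" "g \<le> lmax A + lmax (- B)"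
  shows "kink_coord B - kink_coord A \<le> norm (A - B) * (1 / sqrt 30 + norm (A - B) / g)"
proof -
  have A: "hermitian A" "trace A = 0" and B: "hermitian B" "trace B = 0"
    using assms by (auto simp: h0_iff)
  obtain u where u: "norm u = 1" "A *v u = lmax A *\<^sub>R u" "u \<bullet> (A *v u) = lmax A"
    using lmax_attained[OF A(1)] by metis
  obtain w where w: "norm w = 1" "B *v w = (- lmax (- B)) *\<^sub>R w" "w \<bullet> (- B *v w) = lmax (- B)"
    using bottom_eigenvector[OF B(1)] by metis
  define c where "c = cmod (cinner u w)"
  have "g * c \<le> (lmax A + lmax (- B)) * c" using gap by (intro mult_right_mono) (auto simp: c_def)
  also have "\<dots> \<le> norm (A - B)"
    using eigenvector_overlap[OF A(1) u(2) w(2) u(1) w(1)] gap by (simp add: c_def)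
  finally have c: "c \<le> norm (A - B) / g" using gap(1) by (simp add: field_simps)
  have "sqrt (6/5 + 2 * c\<^sup>2) \<le> sqrt (6/5) + sqrt 2 * c"
  proof -
    have "sqrt (6/5 + 2 * c\<^sup>2) \<le> sqrt (6/5) + sqrt (2 * c\<^sup>2)" by (intro sqrt_add_le_add_sqrt) auto
    then show ?thesis by (simp add: real_sqrt_mult c_def)
  qed
  \<comment> \<open>Enlarging \<open>sqrt 2\<close> to 6 lets the whole bound absorb the factor 1/6
    of \<open>kink_coord\<close>.\<close>
  also have "\<dots> \<le> 6 / sqrt 30 + 6 * c"
    using mult_right_mono[of "sqrt 2" 6 c] by (simp add: sqrt_six_fifths c_def real_le_lsqrt)
  finally have s: "sqrt (6/5 + 2 * c\<^sup>2) \<le> 6 * (1 / sqrt 30 + norm (A - B) / g)" using c by simp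
  have "trace (A - B) = 0" using A B by (simp add: trace_sub)
  then have "u \<bullet> ((A - B) *v u) + w \<bullet> ((A - B) *v w) \<le> norm (A - B) * sqrt (6/5 + 2 * c\<^sup>2)"
    unfolding c_def by (rule two_vector_bound) (use u w in auto)
  also have "\<dots> \<le> norm (A - B) * (6 * (1 / sqrt 30 + norm (A - B) / g))"
    by (intro mult_left_mono s) simp
  finally have "u \<bullet> ((A - B) *v u) + w \<bullet> ((A - B) *v w) \<le> 6 * (norm (A - B) * (1 / sqrt 30 + norm (A - B) / g))"
    by (simp only: mult.left_commute)
  moreover have "lmax A - lmax B \<le> u \<bullet> ((A - B) *v u)"
    by (rule lmax_diff_le) (use A B u in auto)
  moreover have "lmax (- B) - lmax (- A) \<le> w \<bullet> ((A - B) *v w)"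
    using lmax_diff_le[OF hermitian_minus[OF B(1)] hermitian_minus[OF A(1)] w(1,3)] by simp
  ultimately have "6 * (kink_coord B - kink_coord A) \<le> 6 * (norm (A - B) * (1 / sqrt 30 + norm (A - B) / g))"
    unfolding kink_coord_def by argo
  then show ?thesis by (simp only: mult_le_cancel_left_pos zero_less_numeral)
qed

text \<open>For a single matrix the top and bottom eigenvectors are exactly orthogonal, and
  \<open>two_vector_bound\<close> gives the sharp constant without error. By homogeneity this
  controls segments through 0.\<close>

lemma kink_coord_le:
  assumes C: "C \<in> h0" shows "\<bar>kink_coord C\<bar> \<le> norm C / sqrt 30"
proof (cases "C = 0")
  case True
  then have "kink_coord C = 0" by (simp add: kink_coord_def)
  with True show ?thesis by simp
next
  case False
  have A: "hermitian C" "trace C = 0" using assms by (auto simp: h0_iff)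
  obtain u where u: "norm u = 1" "C *v u = lmax C *\<^sub>R u" "u \<bullet> (C *v u) = lmax C"
    using lmax_attained[OF A(1)] by metis
  obtain w where w: "norm w = 1" "C *v w = (- lmax (- C)) *\<^sub>R w" "w \<bullet> (- C *v w) = lmax (- C)"
    using bottom_eigenvector[OF A(1)] by metis
  have gap: "lmax C + lmax (- C) > 0" using spectral_gap_pos[OF C False] .
  have "(lmax C + lmax (- C)) * cmod (cinner u w) \<le> 0"
    using eigenvector_overlap[OF A(1) u(2) w(2) u(1) w(1)] gap by simp
  then have c: "cmod (cinner u w) = 0" using gap by (smt (verit) mult_pos_pos norm_ge_zero)
  have "6 * kink_coord C = - (u \<bullet> (C *v u) + w \<bullet> (C *v w))"
    using u(3) w(3) by (simp add: kink_coord_def cmatrix_vector_algebra)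
  moreover have "u \<bullet> (C *v u) + w \<bullet> (C *v w) \<le> norm C * (6 / sqrt 30)"
    using two_vector_bound[OF A(2) u(1) w(1)] by (simp add: c sqrt_six_fifths)
  moreover have "- (u \<bullet> (C *v u) + w \<bullet> (C *v w)) \<le> norm C * (6 / sqrt 30)"
  proof -
    have "trace (- C) = 0" using A(2) by (simp add: trace_def sum_negf)
    from two_vector_bound[OF this u(1) w(1)] show ?thesis
      by (simp add: c sqrt_six_fifths cmatrix_vector_algebra)
  qed
  moreover have "norm C * (6 / sqrt 30) = 6 * (norm C / sqrt 30)" by simp
  ultimately show ?thesis unfolding abs_le_iff by linarith
qed

lemma h0_subspace: "subspace h0"
proof -
  have "hermitian (0 :: cmat5)" "trace (0 :: cmat5) = 0" by (auto simp: hermitian_def trace_def)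
  moreover have "trace (c *\<^sub>R A) = c *\<^sub>R trace A" for c and A :: cmat5
    by (simp add: trace_def scaleR_sum_right)
  ultimately show ?thesis
    by (simp add: subspace_def h0_iff hermitian_add hermitian_scaleR trace_add)
qed

text \<open>
  At \<open>0\<close> the spectral gap closes and the local estimate fails; a segment through \<open>0\<close> is treated by
  homogeneity in \<open>kink_coord_Lipschitz\<close>.
\<close>

lemma kink_coord_local_Lipschitz:
  assumes C: "C \<in> h0" "C \<noteq> 0" and e: "e > 0"
  obtains d where "d > 0" "\<And>X Y. X \<in> h0 \<Longrightarrow> Y \<in> h0 \<Longrightarrow> norm (X - C) < d \<Longrightarrow> norm (Y - C) < d \<Longrightarrow>
    \<bar>kink_coord X - kink_coord Y\<bar> \<le> (1 / sqrt 30 + e) * norm (X - Y)"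
proof -
  define g where "g = (lmax C + lmax (- C)) / 2"
  have g: "g > 0" using spectral_gap_pos[OF C] by (simp add: g_def)
  \<comment> \<open>The gap at \<open>C\<close> is \<open>2 * g\<close>, and its two eigenvalues
    lose less than \<open>g / 2\<close> each, so at least \<open>g\<close> remains. The second bound
    keeps \<open>X\<close> and \<open>Y\<close> at most \<open>e * g\<close> apart.\<close>
  define d where "d = min (g / 2) (e * g / 2)"
  have d: "d > 0" "d \<le> g / 2" "d \<le> e * g / 2" using g e by (auto simp: d_def)
  have one: "kink_coord Y - kink_coord X \<le> (1 / sqrt 30 + e) * norm (X - Y)"
    if X: "X \<in> h0" "norm (X - C) < d" and Y: "Y \<in> h0" "norm (Y - C) < d" for X Y
  proof -
    have hX: "hermitian X" "hermitian Y" "hermitian C" using X Y C by (auto simp: h0_iff)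
    have "lmax C - lmax X \<le> norm (C - X)" by (rule lmax_Lipschitz[OF hX(3,1)])
    moreover have "lmax (- C) - lmax (- Y) \<le> norm (- C - - Y)"
      by (rule lmax_Lipschitz[OF hermitian_minus[OF hX(3)] hermitian_minus[OF hX(2)]])
    moreover have "norm (- C - - Y) = norm (Y - C)" by simp
    ultimately have gap: "g \<le> lmax X + lmax (- Y)"
      using X(2) Y(2) d(2) by (simp add: g_def norm_minus_commute)
    have "norm (X - Y) \<le> e * g"
      using norm_triangle_ineq4[of "X - C" "Y - C"] X(2) Y(2) d(3) by simp
    then have "norm (X - Y) / g \<le> e" using g by (simp add: field_simps)
    then have "norm (X - Y) * (1 / sqrt 30 + norm (X - Y) / g) \<le> norm (X - Y) * (1 / sqrt 30 + e)"
      by (intro mult_left_mono) auto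
    then show ?thesis using kink_coord_diff_le[OF X(1) Y(1) g gap] by (simp add: mult.commute)
  qed
  show ?thesis
    by (rule that[OF d(1)]) (use one in \<open>force simp: abs_le_iff norm_minus_commute\<close>)
qed

text \<open>Subdividing the segment adds up local bounds whose constant exceeds the sharp one by
  \<open>e\<close>, and \<open>e\<close> is arbitrarily small.\<close>

lemma kink_coord_Lipschitz:
  assumes A: "A \<in> h0" and B: "B \<in> h0"
  shows "\<bar>kink_coord B - kink_coord A\<bar> \<le> norm (B - A) / sqrt 30"
proof (rule field_le_epsilon)
  fix e0 :: real assume e0: "e0 > 0"
  define e where "e = e0 / (norm (B - A) + 1)"
  have e: "e > 0" using e0 by (simp add: e_def add_nonneg_pos)
  define K where "K = (1 / sqrt 30 + e) * norm (B - A)"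
  define p where "p t = A + t *\<^sub>R (B - A)" for t
  have p: "p t \<in> h0" for t unfolding p_def
    using A B by (intro subspace_add subspace_scale subspace_diff h0_subspace)
  have BA: "B - A \<in> h0" using A B by (intro subspace_diff h0_subspace)
  have pp: "p b - p a = (b - a) *\<^sub>R (B - A)" for a b by (simp add: p_def algebra_simps)
  have "\<bar>kink_coord (p 1) - kink_coord (p 0)\<bar> \<le> K * (1 - 0)"
  proof (rule Bolzano[where P = "\<lambda>a b. \<bar>kink_coord (p b) - kink_coord (p a)\<bar> \<le> K * (b - a)"])
    fix t :: real
    show "\<exists>d>0. \<forall>a b. a \<le> t \<and> t \<le> b \<and> b - a < d \<longrightarrow> \<bar>kink_coord (p b) - kink_coord (p a)\<bar> \<le> K * (b - a)"
    proof (cases "p t = 0")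
      \<comment> \<open>If the segment meets 0, all its points are multiples of
        \<open>B - A\<close>, and \<open>kink_coord\<close> is affine in the parameter.\<close>
      case True
      have "kink_coord (p s) = (s - t) * kink_coord (B - A)" for s
        using pp[of s t] True BA kink_coord_scale[of "B - A" "s - t"] by (simp add: h0_iff)
      then have "kink_coord (p b) - kink_coord (p a) = (b - a) * kink_coord (B - A)" for a b
        by (simp only:) (simp add: algebra_simps)
      moreover have "\<bar>kink_coord (B - A)\<bar> \<le> K"
      proof -
        have "norm (B - A) / sqrt 30 \<le> K" using e by (simp add: K_def algebra_simps)
        then show ?thesis using kink_coord_le[OF BA] by linarith
      qed
      ultimately have "\<bar>kink_coord (p b) - kink_coord (p a)\<bar> \<le> K * (b - a)" if "a \<le> b" for a b
        using that by (simp add: abs_mult) (metis diff_ge_0_iff_ge mult.commute mult_left_mono)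
      then show ?thesis by (intro exI[of _ 1]) auto
    next
      case False
      obtain d where d: "d > 0" "\<And>X Y. X \<in> h0 \<Longrightarrow> Y \<in> h0 \<Longrightarrow> norm (X - p t) < d \<Longrightarrow> norm (Y - p t) < d \<Longrightarrow>
          \<bar>kink_coord X - kink_coord Y\<bar> \<le> (1 / sqrt 30 + e) * norm (X - Y)"
        using kink_coord_local_Lipschitz[OF p False e] by metis
      define r where "r = d / (norm (B - A) + 1)"
      have r: "r > 0" using d(1) by (simp add: r_def add_nonneg_pos)
      have near: "norm (p s - p t) < d" if "\<bar>s - t\<bar> < r" for s
      proof -
        have "norm (p s - p t) = \<bar>s - t\<bar> * norm (B - A)" by (simp add: pp)
        also have "\<dots> \<le> \<bar>s - t\<bar> * (norm (B - A) + 1)" by (intro mult_left_mono) auto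
        also have "\<dots> < r * (norm (B - A) + 1)"
          using that by (intro mult_strict_right_mono) (auto simp: add_nonneg_pos)
        also have "\<dots> = d" by (simp add: r_def) (metis add_nonneg_eq_0_iff norm_ge_zero zero_le_one zero_neq_one)
        finally show ?thesis .
      qed
      show ?thesis
      proof (intro exI[of _ r] conjI allI impI r, elim conjE)
        fix a b assume ab: "a \<le> t" "t \<le> b" "b - a < r"
        then have "\<bar>kink_coord (p b) - kink_coord (p a)\<bar> \<le> (1 / sqrt 30 + e) * norm (p b - p a)"
          by (intro d(2) p near) auto
        then show "\<bar>kink_coord (p b) - kink_coord (p a)\<bar> \<le> K * (b - a)"
          using ab by (simp add: pp K_def mult_ac)
      qed
    qed
  qed (auto simp: algebra_simps)
  moreover have "K \<le> norm (B - A) / sqrt 30 + e0"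
  proof -
    have "e * norm (B - A) \<le> e * (norm (B - A) + 1)" using e by (intro mult_left_mono) auto
    also have "\<dots> = e0" by (simp add: e_def) (metis add_nonneg_eq_0_iff norm_ge_zero zero_le_one zero_neq_one)
    finally show ?thesis by (simp add: K_def algebra_simps)
  qed
  ultimately show "\<bar>kink_coord B - kink_coord A\<bar> \<le> norm (B - A) / sqrt 30 + e0"
    by (simp add: p_def)
qed


section \<open>The lower bound for the potential\<close>

text \<open>
  The eigenvalues are parametrised so that \<open>P\<close>, \<open>Q\<close> are the extreme ones and \<open>y\<close> is the kink
  coordinate; \<open>m\<close> stands for \<open>\<mu>\<^sup>2 / h\<close>, and the potential has been divided by \<open>h\<close>.
\<close>

lemma quintic_identity:
  fixes x y a b m :: real
  defines "c \<equiv> - a - b"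
  defines "P \<equiv> x - 3 * y" and "Q \<equiv> - x - 3 * y" and "A \<equiv> 2 * y + a" and "B \<equiv> 2 * y + b" and "C \<equiv> 2 * y + c"
  defines "s \<equiv> P\<^sup>2 + Q\<^sup>2 + A\<^sup>2 + B\<^sup>2 + C\<^sup>2" and "q \<equiv> P^4 + Q^4 + A^4 + B^4 + C^4"
  shows "s\<^sup>2 - 10/9 * q - m * s + 9/10 * m\<^sup>2 - 2000/3 * (y\<^sup>2 - 9/400 * m)\<^sup>2 =
    9/16 * (m - 16/9 * x\<^sup>2 - 8/9 * (a\<^sup>2 + b\<^sup>2 + c\<^sup>2))\<^sup>2
    + a\<^sup>2 * (100/3 * y\<^sup>2 + 20/9 * x\<^sup>2 - 80/9 * y * a)
    + b\<^sup>2 * (100/3 * y\<^sup>2 + 20/9 * x\<^sup>2 - 80/9 * y * b)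
    + c\<^sup>2 * (100/3 * y\<^sup>2 + 20/9 * x\<^sup>2 - 80/9 * y * c)"
  unfolding assms by algebra

text \<open>The difference of the two sides is a square plus three terms, one for each middle
  eigenvalue; extremality of \<open>P\<close> and \<open>Q\<close> makes the three nonnegative. On
  the kink segment the deviations \<open>a\<close>, \<open>b\<close>, \<open>c\<close> of
  \<open>quintic_identity\<close> are 0 and \<open>x\<^sup>2 = 9/16 * m\<close>, so everything
  discarded vanishes there.\<close>

lemma quintic_bound:
  fixes P Q A B C m :: real
  assumes sum: "P + Q + A + B + C = 0" and bds: "\<And>d. d \<in> {A, B, C} \<Longrightarrow> Q \<le> d \<and> d \<le> P"
  defines "y \<equiv> - (P + Q) / 6"
  defines "s \<equiv> P\<^sup>2 + Q\<^sup>2 + A\<^sup>2 + B\<^sup>2 + C\<^sup>2" and "q \<equiv> P^4 + Q^4 + A^4 + B^4 + C^4"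
  shows "2000/3 * (y\<^sup>2 - 9/400 * m)\<^sup>2 \<le> s\<^sup>2 - 10/9 * q - m * s + 9/10 * m\<^sup>2"
proof -
  define x where "x = (P - Q) / 2"
  define a b where "a = A - 2 * y" and "b = B - 2 * y"
  have PQ: "P = x - 3 * y" "Q = - x - 3 * y" "A = 2 * y + a" "B = 2 * y + b" "C = 2 * y + (- a - b)"
    using sum by (simp_all add: x_def a_def b_def y_def field_simps)
  have pos: "d\<^sup>2 * (100/3 * y\<^sup>2 + 20/9 * x\<^sup>2 - 80/9 * y * d) \<ge> 0" if "2 * y + d \<in> {A, B, C}" for d
  proof -
    \<comment> \<open>This says that the eigenvalue \<open>2 * y + d\<close> lies between
      \<open>- x - 3 * y\<close> and \<open>x - 3 * y\<close>. It bounds \<open>x\<^sup>2\<close>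
      from below, after which the bracket is a sum of squares.\<close>
    have "\<bar>d + 5 * y\<bar> \<le> x" using bds[OF that] PQ(1,2) by simp linarith
    then have "(d + 5 * y)\<^sup>2 \<le> x\<^sup>2" by (metis abs_ge_zero power2_abs power_mono)
    moreover have "300 * y\<^sup>2 + 20 * (d + 5 * y)\<^sup>2 - 80 * y * d = 20 * ((d + 3 * y)\<^sup>2 + 31 * y\<^sup>2)"
      by algebra
    ultimately have "100/3 * y\<^sup>2 + 20/9 * x\<^sup>2 - 80/9 * y * d \<ge> 20/9 * ((d + 3 * y)\<^sup>2 + 31 * y\<^sup>2)"
      by linarith
    moreover have "20/9 * ((d + 3 * y)\<^sup>2 + 31 * y\<^sup>2) \<ge> 0" by simp
    ultimately have "100/3 * y\<^sup>2 + 20/9 * x\<^sup>2 - 80/9 * y * d \<ge> 0" by linarith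
    then show ?thesis by simp
  qed
  note id = quintic_identity[where x = x and y = y and a = a and b = b and m = m,
      folded PQ(1,2), folded PQ(3,4,5), folded s_def q_def]
  have "9/16 * (m - 16/9 * x\<^sup>2 - 8/9 * (a\<^sup>2 + b\<^sup>2 + (- a - b)\<^sup>2))\<^sup>2 \<ge> 0" by simp
  moreover have "2 * y + a \<in> {A, B, C}" "2 * y + b \<in> {A, B, C}" "2 * y + (- a - b) \<in> {A, B, C}"
    using PQ(3-5) by auto
  ultimately show ?thesis using id pos[of a] pos[of b] pos[of "- a - b"] by linarith
qed

definition crit_potential :: "real \<Rightarrow> real \<Rightarrow> cmat5 \<Rightarrow> real" where
  "crit_potential \<mu> h = potential \<mu> h (- (10 / 9) * h) (9 * \<mu> ^ 4 / (10 * h))"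

definition kink_amp :: "real \<Rightarrow> real \<Rightarrow> real" where
  "kink_amp \<mu> h = 3 * \<mu> / (20 * sqrt h)"

lemma five_split:
  assumes "p \<noteq> (q :: 5)"
  obtains a b c where "distinct [p, q, a, b, c]" "UNIV = {p, q, a, b, c}"
proof -
  have "card (UNIV - {p, q}) = 3" using assms by (simp add: card_Diff_subset)
  then obtain a b c where abc: "UNIV - {p, q} = {a, b, c}" "a \<noteq> b" "a \<noteq> c" "b \<noteq> c"
    by (auto simp: card_3_iff)
  have "UNIV = {p, q} \<union> (UNIV - {p, q})" by blast
  also have "\<dots> = {p, q, a, b, c}" using abc(1) by blast
  finally have "UNIV = {p, q, a, b, c}" .
  moreover have "a \<in> UNIV - {p, q}" "b \<in> UNIV - {p, q}" "c \<in> UNIV - {p, q}" using abc by simp_all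
  ultimately show ?thesis using that[of a b c] assms abc by auto
qed

lemma potential_lower_bound:
  assumes h: "h > 0" and A: "A \<in> h0"
  shows "crit_potential \<mu> h A \<ge> 2000/3 * h * ((kink_coord A)\<^sup>2 - (kink_amp \<mu> h)\<^sup>2)\<^sup>2"
proof -
  have hA: "hermitian A" "trace A = 0" using A by (auto simp: h0_iff)
  obtain u and l :: "5 \<Rightarrow> real" where l: "\<And>i. A *v u i = l i *\<^sub>R u i"
    "\<And>i j. cinner (u i) (u j) = (if i = j then 1 else 0)" "trace A = of_real (\<Sum>i\<in>UNIV. l i)"
    "trace (A ** A) = of_real (\<Sum>i\<in>UNIV. l i ^ 2)"
    "trace (A ** A ** A ** A) = of_real (\<Sum>i\<in>UNIV. l i ^ 4)"
    by (fact hermitian_spectral[OF hA(1)])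
  have sum0: "(\<Sum>i\<in>UNIV. l i) = 0" using l(3) hA(2) by (metis of_real_eq_0_iff)
  have m: "lmax A = Max (range l)" "lmax (- A) = Max (range (\<lambda>i. - l i))"
    using lmax_eq_Max[OF hA(1) l(1,2)] lmax_minus_eq_Max[OF hA(1) l(1,2)] by blast+
  have le: "l i \<le> lmax A" "- l i \<le> lmax (- A)" for i unfolding m by (auto intro: Max_ge)
  have "lmax A \<in> range l" unfolding m by (rule Max_in) auto
  then obtain p where p: "lmax A = l p" by blast
  have "lmax (- A) \<in> range (\<lambda>i. - l i)" unfolding m by (rule Max_in) auto
  then obtain q0 where q0: "lmax (- A) = - l q0" by blast
  \<comment> \<open>If the maximum and the minimum sit at the same index, all eigenvalues are equal
    and any other index can carry the minimum.\<close>
  obtain q where q: "lmax (- A) = - l q" "p \<noteq> q"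
  proof (cases "p = q0")
    case True
    have "card {p} < card (UNIV :: 5 set)" by simp
    then obtain q where "q \<noteq> p" by (metis UNIV_eq_I less_irrefl singletonI)
    moreover have "l q = l p" using le[of q] p q0 True by simp
    ultimately show ?thesis using that[of q] q0 True by simp
  qed (use q0 that in blast)
  obtain a b c where abc: "distinct [p, q, a, b, c]" "UNIV = {p, q, a, b, c}"
    using five_split[OF q(2)] .
  have S: "(\<Sum>i\<in>UNIV. f i) = f p + f q + f a + f b + f c" for f :: "5 \<Rightarrow> real"
    unfolding abc(2) using abc(1) by simp
  define mm where "mm = \<mu>\<^sup>2 / h"
  have "2000/3 * ((- (l p + l q) / 6)\<^sup>2 - 9/400 * mm)\<^sup>2 \<le>
      (\<Sum>i\<in>UNIV. l i ^ 2)\<^sup>2 - 10/9 * (\<Sum>i\<in>UNIV. l i ^ 4) - mm * (\<Sum>i\<in>UNIV. l i ^ 2) + 9/10 * mm\<^sup>2"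
    unfolding S by (rule quintic_bound) (use sum0 le p q in \<open>auto simp: S\<close>)
  then have "h * (2000/3 * ((- (l p + l q) / 6)\<^sup>2 - 9/400 * mm)\<^sup>2) \<le>
      h * ((\<Sum>i\<in>UNIV. l i ^ 2)\<^sup>2 - 10/9 * (\<Sum>i\<in>UNIV. l i ^ 4) - mm * (\<Sum>i\<in>UNIV. l i ^ 2) + 9/10 * mm\<^sup>2)"
    using h by simp
  also have "\<dots> = crit_potential \<mu> h A"
    using h by (simp add: crit_potential_def potential_def l(4,5) mm_def field_simps power2_eq_square power4_eq_xxxx)
  also have "- (l p + l q) / 6 = kink_coord A" by (simp add: kink_coord_def p q)
  also have "9/400 * mm = (kink_amp \<mu> h)\<^sup>2"
    using h by (simp add: mm_def kink_amp_def power_divide power_mult_distrib)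
  finally show ?thesis by (simp only: mult_ac)
qed

section \<open>Unitary invariance and diagonal matrices\<close>

text \<open>\<open>U\<close> maps the unit sphere onto itself, so both suprema run over the same
  values.\<close>

lemma lmax_unitary:
  assumes U: "U \<in> SU5" shows "lmax (dagger U ** A ** U) = lmax A"
proof -
  have d: "cinner x (dagger U *v y) = cinner (U *v x) y" for x y
  proof -
    have "cinner x (dagger U *v y) = (\<Sum>i\<in>UNIV. \<Sum>j\<in>UNIV. cnj (x $ i) * (cnj (U $ j $ i) * y $ j))"
      by (simp add: cinner_def dagger_def matrix_vector_mult_def sum_distrib_left)
    also have "\<dots> = (\<Sum>j\<in>UNIV. \<Sum>i\<in>UNIV. cnj (x $ i) * (cnj (U $ j $ i) * y $ j))" by (rule sum.swap)
    also have "\<dots> = (\<Sum>j\<in>UNIV. \<Sum>i\<in>UNIV. cnj (U $ j $ i * x $ i) * y $ j)"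
      by (intro sum.cong refl) simp
    also have "\<dots> = cinner (U *v x) y"
      by (simp add: cinner_def matrix_vector_mult_def sum_distrib_right)
    finally show ?thesis .
  qed
  have dU: "dagger U ** U = mat 1" using U by (simp add: SU5_def)
  then have Ud: "U ** dagger U = mat 1" by (simp add: matrix_left_right_inverse)
  have n: "norm (U *v x) = norm x" for x
  proof -
    have "(U *v x) \<bullet> (U *v x) = x \<bullet> (dagger U *v (U *v x))" by (simp add: inner_eq_Re_cinner d)
    also have "\<dots> = x \<bullet> x" by (simp add: matrix_vector_mul_assoc dU)
    finally show ?thesis by (simp add: norm_eq_sqrt_inner)
  qed
  have "(\<lambda>x. x \<bullet> ((dagger U ** A ** U) *v x)) = (\<lambda>x. x \<bullet> (A *v x)) \<circ> (\<lambda>x. U *v x)"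
    by (simp add: fun_eq_iff inner_eq_Re_cinner d matrix_vector_mul_assoc[symmetric])
  moreover have "(\<lambda>x. U *v x) ` sphere 0 1 = sphere 0 1"
  proof -
    have "x \<in> (\<lambda>x. U *v x) ` sphere 0 1" if "norm x = 1" for x
    proof (rule image_eqI)
      show "x = U *v (dagger U *v x)" by (simp add: matrix_vector_mul_assoc Ud)
      then show "dagger U *v x \<in> sphere 0 1" using n[of "dagger U *v x"] that by simp
    qed
    then show ?thesis by (auto simp: n)
  qed
  ultimately show ?thesis unfolding lmax_def by (metis image_comp)
qed


lemma lmax_diag:
  fixes d :: "'n::finite \<Rightarrow> real"
  shows "lmax (\<chi> i j. if i = j then of_real (d i) else 0) = Max (range d)"
proof (rule lmax_eq_Max)
  show "hermitian (\<chi> i j. if i = j then complex_of_real (d i) else 0)" by (simp add: hermitian_def)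
  show "(\<chi> i j. if i = j then of_real (d i) else 0) *v axis k 1 = d k *\<^sub>R (axis k 1 :: complex^'n)" for k
    by (simp add: vec_eq_iff matrix_vector_mult_def axis_def if_distrib[of "\<lambda>x. x * _"] scaleR_conv_of_real[of "d k" "_::complex"] cong: if_cong) 
  show "cinner (axis i 1) (axis j 1) = (if i = j then 1 else (0::complex))" for i j :: 'n
    by (simp add: cinner_def axis_def if_distrib[of cnj] if_distrib[of "\<lambda>x. x * _"] cong: if_cong)
qed


section \<open>The segment of the kink\<close>

lemma UNIV_5: "UNIV = {1, 2, 3, 4, 5 :: 5}"
proof -
  have "x = 1 \<or> x = 2 \<or> x = 3 \<or> x = 4 \<or> x = 5" for x :: 5
  proof (induct x)
    case (of_int z)
    then have "z = 0 \<or> z = 1 \<or> z = 2 \<or> z = 3 \<or> z = 4" by fastforce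
    then show ?case by auto
  qed
  then show ?thesis by auto
qed

lemma forall_5: "(\<forall>i::5. P i) \<longleftrightarrow> P 1 \<and> P 2 \<and> P 3 \<and> P 4 \<and> P 5"
  using UNIV_5 by (metis UNIV_I empty_iff insert_iff)

lemma sum_5: "(\<Sum>i\<in>UNIV. f i) = f 1 + f 2 + f 3 + f 4 + f (5 :: 5)"
  unfolding UNIV_5 by (simp add: ac_simps)

lemma vector_5:
  "(vector [a, b, c, d, e] :: 'a::zero^5) $ 1 = a" "(vector [a, b, c, d, e] :: 'a::zero^5) $ 2 = b"
  "(vector [a, b, c, d, e] :: 'a::zero^5) $ 3 = c" "(vector [a, b, c, d, e] :: 'a::zero^5) $ 4 = d"
  "(vector [a, b, c, d, e] :: 'a::zero^5) $ 5 = e"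
  unfolding vector_def by simp_all

lemma diag5_scaleR: "r *\<^sub>R diag5 [a, b, c, d, e] = diag5 [r * a, r * b, r * c, r * d, r * e]"
proof -
  have "r * (vector [a, b, c, d, e] :: real^5) $ i = (vector [r * a, r * b, r * c, r * d, r * e] :: real^5) $ i" for i
    by (rule spec[of _ i]) (simp add: forall_5 vector_5)
  then show ?thesis by (simp add: diag5_def vec_eq_iff scaleR_conv_of_real[of _ "_::complex"] of_real_mult[symmetric] del: of_real_mult)
qed

lemma diag5_add: "diag5 [a, b, c, d, e] + diag5 [a', b', c', d', e'] = diag5 [a + a', b + b', c + c', d + d', e + e']"
proof -
  have "(vector [a, b, c, d, e] :: real^5) $ i + (vector [a', b', c', d', e'] :: real^5) $ i
      = (vector [a + a', b + b', c + c', d + d', e + e'] :: real^5) $ i" for i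
    by (rule spec[of _ i]) (simp add: forall_5 vector_5)
  then show ?thesis by (simp add: diag5_def vec_eq_iff of_real_add[symmetric] del: of_real_add)
qed

lemma diag5_mult: "diag5 [a, b, c, d, e] ** diag5 [a', b', c', d', e'] = diag5 [a * a', b * b', c * c', d * d', e * e']"
proof -
  have "(vector [a, b, c, d, e] :: real^5) $ i * (vector [a', b', c', d', e'] :: real^5) $ i
      = (vector [a * a', b * b', c * c', d * d', e * e'] :: real^5) $ i" for i
    by (rule spec[of _ i]) (simp add: forall_5 vector_5)
  then show ?thesis
    by (simp add: diag5_def matrix_matrix_mult_def vec_eq_iff if_distrib[of "\<lambda>x. _ * x"] of_real_mult[symmetric]
        del: of_real_mult cong: if_cong)
qed

lemma trace_diag5: "trace (diag5 [a, b, c, d, e]) = of_real (a + b + c + d + e)"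
  by (simp add: trace_def diag5_def sum_5 vector_5)

lemma lmax_diag5: "lmax (diag5 [a, b, c, d, e]) = Max {a, b, c, d, e}"
proof -
  have "range (\<lambda>i. (vector [a, b, c, d, e] :: real^5) $ i) = {a, b, c, d, e}"
    unfolding UNIV_5 by (simp add: vector_5)
  then show ?thesis unfolding diag5_def lmax_diag by simp
qed

lemma diag5_hermitian: "hermitian (diag5 xs)"
  by (simp add: hermitian_def diag5_def)

lemma kink_coord_diag5:
  "kink_coord (diag5 [a, b, c, d, e]) = (Max {-a, -b, -c, -d, -e} - Max {a, b, c, d, e}) / 6"
  using diag5_scaleR[of "- 1" a b c d e] by (simp add: kink_coord_def lmax_diag5)

lemma kink_coord_Sigma:
  "A \<in> Sigma_plus \<mu> h \<Longrightarrow> kink_coord A = kink_amp \<mu> h" "A \<in> Sigma_minus \<mu> h \<Longrightarrow> kink_coord A = - kink_amp \<mu> h"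
proof -
  have inv: "kink_coord (dagger U ** B ** U) = kink_coord B" if "U \<in> SU5" for U B
  proof -
    have "- (dagger U ** B ** U) = dagger U ** (- B) ** U"
      by (simp add: vec_eq_iff matrix_matrix_mult_def sum_negf)
    then show ?thesis by (simp add: kink_coord_def lmax_unitary[OF that])
  qed
  show "A \<in> Sigma_plus \<mu> h \<Longrightarrow> kink_coord A = kink_amp \<mu> h"
    by (auto simp: Sigma_plus_def SU5_orbit_def inv kink_coord_scale diag5_hermitian kink_coord_diag5 vev_def kink_amp_def)
  show "A \<in> Sigma_minus \<mu> h \<Longrightarrow> kink_coord A = - kink_amp \<mu> h"
    by (auto simp: Sigma_minus_def SU5_orbit_def inv kink_coord_scale diag5_hermitian kink_coord_diag5 vev_def kink_amp_def)
qed

text \<open>The path of the kink without its tanh profile. The energy and the weighted distance use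
  it with different parametrisations.\<close>

definition kink_line :: "real \<Rightarrow> real \<Rightarrow> real \<Rightarrow> cmat5" where
  "kink_line \<mu> h \<tau> = (3 * \<mu> / (4 * sqrt h)) *\<^sub>R diag5 [0, 0, 0, 1, -1] + (kink_amp \<mu> h * \<tau>) *\<^sub>R diag5 [2, 2, 2, -3, -3]"

lemma kink_eq: "kink \<mu> h z = kink_line \<mu> h (tanh (\<mu> * z / sqrt 2))"
  by (simp add: kink_def kink_line_def kink_amp_def scaleR_add_right)

lemma kink_line_diag:
  "kink_line \<mu> h \<tau> = (let c = kink_amp \<mu> h in
     diag5 [2 * c * \<tau>, 2 * c * \<tau>, 2 * c * \<tau>, 5 * c - 3 * c * \<tau>, - 5 * c - 3 * c * \<tau>])"
  by (simp add: kink_line_def diag5_scaleR diag5_add Let_def) (simp add: kink_amp_def mult_ac)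

lemma kink_line_h0: "kink_line \<mu> h \<tau> \<in> h0"
  by (simp add: kink_line_diag Let_def h0_iff diag5_hermitian trace_diag5)

lemma mat1_SU5: "mat 1 \<in> SU5"
proof -
  have "dagger (mat 1) = mat 1" by (simp add: dagger_def mat_def vec_eq_iff)
  then show ?thesis by (simp add: SU5_def)
qed

lemma SU5_orbit_refl: "\<Phi> \<in> SU5_orbit \<Phi>"
proof -
  have "dagger (mat 1) = mat 1" by (simp add: dagger_def mat_def vec_eq_iff)
  then show ?thesis unfolding SU5_orbit_def using mat1_SU5 by (intro CollectI exI[of _ "mat 1"]) simp
qed

lemma kink_line_endpoints:
  "kink_line \<mu> h (- 1) \<in> Sigma_minus \<mu> h" "kink_line \<mu> h 1 \<in> Sigma_plus \<mu> h"
proof -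
  have "vev \<mu> h = 2 * kink_amp \<mu> h" by (simp add: vev_def kink_amp_def)
  then have "kink_line \<mu> h (- 1) = vev \<mu> h *\<^sub>R diag5 [-1, -1, -1, 4, -1]"
    "kink_line \<mu> h 1 = vev \<mu> h *\<^sub>R diag5 [1, 1, 1, 1, -4]"
    by (simp_all add: kink_line_diag Let_def diag5_scaleR)
  then show "kink_line \<mu> h (- 1) \<in> Sigma_minus \<mu> h" "kink_line \<mu> h 1 \<in> Sigma_plus \<mu> h"
    by (simp_all add: Sigma_minus_def Sigma_plus_def SU5_orbit_refl)
qed

text \<open>Between the vacua this is the case of equality in
  \<open>potential_lower_bound\<close>.\<close>

lemma crit_potential_kink_line:
  assumes "h > 0"
  shows "crit_potential \<mu> h (kink_line \<mu> h \<tau>) = 2000/3 * h * (kink_amp \<mu> h)^4 * (1 - \<tau>\<^sup>2)\<^sup>2"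
proof -
  define c where "c = kink_amp \<mu> h"
  \<comment> \<open>The power sums of order two and four of the diagonal entries in
    \<open>kink_line_diag\<close>.\<close>
  define s q where "s = 30 * (c * \<tau>)\<^sup>2 + 50 * c\<^sup>2" and "q = 210 * (c * \<tau>)^4 + 2700 * c\<^sup>2 * (c * \<tau>)\<^sup>2 + 1250 * c^4"
  have mu: "\<mu>\<^sup>2 = 400/9 * h * c\<^sup>2"
    using assms by (simp add: c_def kink_amp_def power_divide power_mult_distrib)
  have "\<mu>^4 = (\<mu>\<^sup>2)\<^sup>2" by simp
  also have "\<dots> = (400/9)\<^sup>2 * h\<^sup>2 * c^4" unfolding mu by algebra
  finally have mu4: "\<mu>^4 = (400/9)\<^sup>2 * h\<^sup>2 * c^4" .
  have s: "Re (trace (kink_line \<mu> h \<tau> ** kink_line \<mu> h \<tau>)) = s"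
    unfolding kink_line_diag Let_def diag5_mult trace_diag5 c_def[symmetric] s_def Re_complex_of_real by algebra
  have q: "Re (trace (kink_line \<mu> h \<tau> ** kink_line \<mu> h \<tau> ** kink_line \<mu> h \<tau> ** kink_line \<mu> h \<tau>)) = q"
    unfolding kink_line_diag Let_def diag5_mult trace_diag5 c_def[symmetric] q_def Re_complex_of_real by algebra
  have "9 * \<mu> ^ 4 / (10 * h) = 16000/9 * h * c^4"
    unfolding mu4 using assms by (simp add: power2_eq_square field_simps)
  then have "crit_potential \<mu> h (kink_line \<mu> h \<tau>) = - (400/9 * h * c\<^sup>2) * s + h * s\<^sup>2 + (- (10 / 9) * h) * q + 16000/9 * h * c^4"
    by (simp add: crit_potential_def potential_def s q mu)
  also have "\<dots> = 2000/3 * h * c^4 * (1 - \<tau>\<^sup>2)\<^sup>2" unfolding s_def q_def by algebra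
  finally show ?thesis by (simp add: c_def)
qed

definition kink_dir :: "real \<Rightarrow> real \<Rightarrow> cmat5" where
  "kink_dir \<mu> h = kink_amp \<mu> h *\<^sub>R diag5 [2, 2, 2, -3, -3]"

lemma kink_dir_h0: "kink_dir \<mu> h \<in> h0"
  unfolding kink_dir_def
  by (intro subspace_scale[OF h0_subspace]) (simp add: h0_iff diag5_hermitian trace_diag5)

lemma norm_kink_dir: "kink_amp \<mu> h \<ge> 0 \<Longrightarrow> norm (kink_dir \<mu> h) = sqrt 30 * kink_amp \<mu> h"
proof -
  have "diag5 [2, 2, 2, -3, -3] \<in> h0" by (simp add: h0_iff diag5_hermitian trace_diag5)
  then have "norm (diag5 [2, 2, 2, -3, -3]) = sqrt 30"
    by (simp add: frob_norm_eq_norm[symmetric] frob_norm_def diag5_mult trace_diag5)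
  then show "kink_amp \<mu> h \<ge> 0 \<Longrightarrow> ?thesis" by (simp add: kink_dir_def)
qed

lemma kink_line_derivative: "(kink_line \<mu> h has_vector_derivative kink_dir \<mu> h) (at x within S)"
  unfolding kink_line_def kink_dir_def
  by (auto intro!: derivative_eq_intros)


section \<open>Smooth step functions\<close>

text \<open>Smoothness by coinduction: no formula for the iterated derivatives is required, only a
  set of functions that contains a derivative of each member.\<close>

lemma smooth_coinduct:
  fixes f :: "real \<Rightarrow> real"
  assumes closed: "\<And>f. f \<in> S \<Longrightarrow> \<exists>f'\<in>S. \<forall>x. (f has_field_derivative f' x) (at x)" and "f \<in> S"
  shows "(deriv ^^ k) f field_differentiable (at x)"
proof -
  have step: "deriv f \<in> S" "f field_differentiable (at x)" if "f \<in> S" for f x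
  proof -
    obtain f' where f': "f' \<in> S" "\<And>x. (f has_field_derivative f' x) (at x)" using closed[OF \<open>f \<in> S\<close>] by blast
    have "deriv f = f'" by (rule ext) (rule DERIV_imp_deriv[OF f'(2)])
    with f' show "deriv f \<in> S" "f field_differentiable (at x)" by (auto simp: field_differentiable_def)
  qed
  have "(deriv ^^ k) f \<in> S" using \<open>f \<in> S\<close> by (induction k) (auto intro: step)
  then show ?thesis by (rule step)
qed

text \<open>Functions p(1/x) exp(-1/x), continued by 0, are closed under differentiation: with t =
  1/x the polynomial p turns into t^2 (p - p'). Indexing by the polynomial covers all derivatives at
  once.\<close>

definition flat :: "real poly \<Rightarrow> real \<Rightarrow> real" where
  "flat p x = (if x > 0 then poly p (1 / x) * exp (- (1 / x)) else 0)"

lemma poly_div_exp_tendsto_0: "((\<lambda>t. poly p t * exp (- t)) \<longlongrightarrow> (0::real)) at_top"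
proof -
  have "((\<lambda>t. \<Sum>i\<le>degree p. coeff p i * (t ^ i / exp t)) \<longlongrightarrow> (\<Sum>i\<le>degree p. coeff p i * 0)) at_top"
    by (intro tendsto_intros tendsto_power_div_exp_0)
  then show ?thesis
    by (simp add: poly_altdef sum_distrib_right exp_minus divide_inverse mult.assoc)
qed

lemma flat_tendsto_0: "(flat p \<longlongrightarrow> 0) (at 0)"
proof -
  have "((\<lambda>x. poly p (inverse x) * exp (- (inverse x))) \<longlongrightarrow> 0) (at_right (0::real))"
    by (rule filterlim_compose[OF poly_div_exp_tendsto_0 filterlim_inverse_at_top_right])
  then have "(flat p \<longlongrightarrow> 0) (at_right 0)"
    by (rule Lim_transform_eventually)
       (auto simp: eventually_at_right_field flat_def divide_inverse intro!: exI[of _ 1])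
  moreover have "(flat p \<longlongrightarrow> 0) (at_left 0)"
    by (rule Lim_transform_eventually[OF tendsto_const])
       (auto simp: eventually_at_left_field flat_def intro!: exI[of _ "-1"])
  ultimately show ?thesis by (simp add: filterlim_split_at)
qed

lemma flat_derivative:
  "(flat p has_field_derivative flat ([:0, 0, 1:] * (p - pderiv p)) x) (at x)"
proof -
  consider "x > 0" | "x < 0" | "x = 0" by linarith
  then show ?thesis
  proof cases
    case 1
    have "((\<lambda>x. poly p (1 / x) * exp (- (1 / x))) has_field_derivative
       flat ([:0, 0, 1:] * (p - pderiv p)) x) (at x)"
      using 1 by (auto intro!: derivative_eq_intros DERIV_chain'[OF _ poly_DERIV] simp: flat_def field_simps power2_eq_square)
    then show ?thesis
      by (rule has_field_derivative_transform_within_open[of _ _ _ "{0<..}"]) (use 1 in \<open>auto simp: flat_def\<close>)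
  next
    case 2
    have "((\<lambda>x. 0) has_field_derivative flat ([:0, 0, 1:] * (p - pderiv p)) x) (at x)"
      using 2 by (auto intro!: derivative_eq_intros simp: flat_def)
    then show ?thesis
      by (rule has_field_derivative_transform_within_open[of _ _ _ "{..<0}"]) (use 2 in \<open>auto simp: flat_def\<close>)
  next
    case 3
    \<comment> \<open>At 0 the difference quotient is again a flat function, with polynomial t p(t),
      so \<open>flat_tendsto_0\<close> gives derivative 0.\<close>
    have "(\<lambda>h. (flat p h - flat p 0) / (h - 0)) = flat (pCons 0 p)"
      by (auto simp: flat_def fun_eq_iff)
    then have "((\<lambda>h. (flat p h - flat p 0) / (h - 0)) \<longlongrightarrow> 0) (at 0)" using flat_tendsto_0 by simp
    then show ?thesis using 3 by (simp add: has_field_derivative_iff flat_def)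
  qed
qed

text \<open>The products are supported in \<open>{0..1}\<close>. Sums enter through the product
  rule, while signs and factors go into the polynomials.\<close>

inductive_set bumps :: "(real \<Rightarrow> real) set" where
  bumps_mult: "(\<lambda>x. flat p x * flat q (1 - x)) \<in> bumps"
| bumps_add: "f \<in> bumps \<Longrightarrow> g \<in> bumps \<Longrightarrow> (\<lambda>x. f x + g x) \<in> bumps"

lemma flat_minus: "flat (- p) x = - flat p x"
  by (simp add: flat_def)

lemma bumps_deriv:
  assumes "f \<in> bumps" shows "\<exists>f'\<in>bumps. \<forall>x. (f has_field_derivative f' x) (at x)"
  using assms
proof induction
  case (bumps_mult p q)
  define D where "D p = [:0, 0, 1:] * (p - pderiv p)" for p :: "real poly"
  have d: "(flat p has_field_derivative flat (D p) x) (at x)" for p x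
    unfolding D_def by (rule flat_derivative)
  have "((\<lambda>x. flat p x * flat q (1 - x)) has_field_derivative
      (flat (D p) x * flat q (1 - x) + flat p x * flat (- D q) (1 - x))) (at x)" for x
    by (auto intro!: derivative_eq_intros d DERIV_chain'[where g = "flat q", OF _ d] simp: flat_minus)
  then show ?case by (intro bexI[where x = "\<lambda>x. flat (D p) x * flat q (1 - x) + flat p x * flat (- D q) (1 - x)"])
      (auto intro: bumps.intros)
next
  case (bumps_add f g)
  then obtain f' g' where "f' \<in> bumps" "g' \<in> bumps" "\<forall>x. (f has_field_derivative f' x) (at x)"
    "\<forall>x. (g has_field_derivative g' x) (at x)" by blast
  then show ?case by (intro bexI[where x = "\<lambda>x. f' x + g' x"]) (auto intro: bumps.intros derivative_intros)
qed

text \<open>\<open>B\<close> is the primitive of a bump, normalised to rise from 0 to 1.\<close>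

lemma smooth_step:
  obtains B b :: "real \<Rightarrow> real" where
    "\<And>k x. (deriv ^^ k) B field_differentiable (at x)"
    "\<And>x. (B has_field_derivative b x) (at x)" "continuous_on UNIV b"
    "\<And>x. b x \<ge> 0" "\<And>x. x \<notin> {0..1} \<Longrightarrow> b x = 0"
    "\<And>x. x \<le> 0 \<Longrightarrow> B x = 0" "\<And>x. x \<ge> 1 \<Longrightarrow> B x = 1" "\<And>x. 0 \<le> B x" "\<And>x. B x \<le> 1"
proof -
  define f where "f x = flat 1 x * flat 1 (1 - x)" for x
  have f: "f \<in> bumps" using bumps_mult[of 1 1] by (simp add: f_def[abs_def])
  have fpos: "f x \<ge> 0" "x \<notin> {0..1} \<Longrightarrow> f x = 0" for x by (auto simp: f_def flat_def)
  have "f field_differentiable (at x)" for x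
    using smooth_coinduct[OF bumps_deriv f, of 0] by simp
  then have fc: "continuous_on UNIV f"
    by (simp add: continuous_at_imp_continuous_on field_differentiable_imp_continuous_at)
  obtain F where F: "\<And>x. (F has_field_derivative f x) (at x)"
    using einterval_antiderivative[of "-\<infinity>" "\<infinity>" f] fc
    by (auto simp: continuous_on_eq_continuous_at has_real_derivative_iff_has_vector_derivative)
  have mono: "F x \<le> F y" if "x \<le> y" for x y
    by (rule DERIV_nonneg_imp_nondecreasing[where f = F, OF that]) (use F fpos in blast)
  have "F 0 < F 1"
  proof (rule DERIV_pos_imp_increasing_open[where f = F])
    fix x :: real assume "0 < x" "x < 1"
    then have "f x > 0" by (simp add: f_def flat_def)
    then show "\<exists>y. (F has_field_derivative y) (at x) \<and> 0 < y" using F by blast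
  next
    show "continuous_on {0..1} F"
      using F by (intro continuous_at_imp_continuous_on ballI) (blast intro: DERIV_isCont)
  qed simp
  define I where "I = F 1 - F 0"
  have I: "I > 0" using \<open>F 0 < F 1\<close> by (simp add: I_def)
  have const: "F x = F y" if "convex S" "x \<in> S" "y \<in> S" "\<And>x. x \<in> S \<Longrightarrow> f x = 0" for x y S
  proof -
    have "(F has_field_derivative 0) (at x within S)" if "x \<in> S" for x
      using F[of x] \<open>\<And>x. x \<in> S \<Longrightarrow> f x = 0\<close>[OF that] by (auto intro: has_field_derivative_at_within)
    then obtain c where "\<And>x. x \<in> S \<Longrightarrow> F x = c"
      using has_field_derivative_zero_constant[OF \<open>convex S\<close>] by blast
    then show ?thesis using that by simp
  qed
  have F0: "F x = F 0" if "x \<le> 0" for x by (rule const[of "{..0}"]) (use that in \<open>auto simp: f_def flat_def\<close>)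
  have F1: "F x = F 1" if "x \<ge> 1" for x by (rule const[of "{1..}"]) (use that in \<open>auto simp: f_def flat_def\<close>)
  define B where "B x = (F x - F 0) / I" for x
  \<comment> \<open>The factor \<open>1 / I\<close> sits in the polynomial so that \<open>b\<close>
    belongs to \<open>bumps\<close>; then \<open>insert B bumps\<close> is closed under
    differentiation.\<close>
  define b where "b x = flat [:1 / I:] x * flat 1 (1 - x)" for x
  have b: "b \<in> bumps" "b x = f x / I" for x
    using bumps_mult[of "[:1 / I:]" 1] by (auto simp: b_def[abs_def] f_def flat_def)
  have Bb: "(B has_field_derivative b x) (at x)" for x
    unfolding B_def b(2) using DERIV_cdivide[OF DERIV_diff[OF F DERIV_const]] by simp
  show ?thesis
  proof (rule that[of B b])
    show "(deriv ^^ k) B field_differentiable (at x)" for k x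
    proof (rule smooth_coinduct[where S = "insert B bumps"])
      show "\<exists>f'\<in>insert B bumps. \<forall>x. (f has_field_derivative f' x) (at x)" if "f \<in> insert B bumps" for f
        using that Bb b(1) bumps_deriv by blast
    qed simp
    show "(B has_field_derivative b x) (at x)" for x by (rule Bb)
    have "b = (\<lambda>x. f x / I)" using b(2) by (rule ext)
    then show "continuous_on UNIV b" using continuous_on_divide[OF fc continuous_on_const] I by simp
    show "b x \<ge> 0" "x \<notin> {0..1} \<Longrightarrow> b x = 0" for x
      unfolding b(2) using fpos[of x] I by simp_all
    show "x \<le> 0 \<Longrightarrow> B x = 0" "x \<ge> 1 \<Longrightarrow> B x = 1" for x
      using F0[of x] F1[of x] I unfolding B_def I_def by simp_all
    have "F 0 \<le> F x" for x using mono[of 0 x] F0[of x] by (cases "x \<le> 0") auto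
    moreover have "F x \<le> F 1" for x using mono[of x 1] F1[of x] by (cases "x \<le> 1") auto
    ultimately show "0 \<le> B x" "B x \<le> 1" for x using I by (auto simp: B_def I_def)
  qed
qed


section \<open>Weak derivatives on the line\<close>

text \<open>For s < t and large \<open>N\<close> this is a smooth version of the indicator of the
  interval from \<open>s\<close> to \<open>t\<close>. The support is compact because both steps
  equal 1 far to the right and cancel.\<close>

lemma test_function_smooth_step:
  assumes B: "\<And>k x. (deriv ^^ k) B field_differentiable (at x)"
    "\<And>x. x \<le> 0 \<Longrightarrow> B x = 0" "\<And>x. x \<ge> 1 \<Longrightarrow> B x = 1" and N: "N > 0"
  shows "test_function (\<lambda>x. B (N * (x - s)) - B (N * (x - t)))"
  unfolding test_function_def
proof (intro conjI allI)
  \<comment> \<open>All derivatives have this form, with \<open>c\<close> collecting the powers of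
    \<open>N\<close>.\<close>
  define S where "S = {(\<lambda>x. c * (deriv ^^ k) B (N * (x - s)) - c * (deriv ^^ k) B (N * (x - t))) | c k. True}"
  have d: "((deriv ^^ k) B has_field_derivative (deriv ^^ Suc k) B x) (at x)" for k x
    using B(1)[of k x] by (simp add: field_differentiable_derivI)
  show "(deriv ^^ k) (\<lambda>x. B (N * (x - s)) - B (N * (x - t))) field_differentiable (at x)" for k x
  proof (rule smooth_coinduct[where S = S])
    have "(\<lambda>x. B (N * (x - s)) - B (N * (x - t))) =
        (\<lambda>x. 1 * (deriv ^^ 0) B (N * (x - s)) - 1 * (deriv ^^ 0) B (N * (x - t)))" by simp
    then show "(\<lambda>x. B (N * (x - s)) - B (N * (x - t))) \<in> S" unfolding S_def by blast
    fix f assume "f \<in> S"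
    then obtain c k where f: "f = (\<lambda>x. c * (deriv ^^ k) B (N * (x - s)) - c * (deriv ^^ k) B (N * (x - t)))"
      unfolding S_def by blast
    show "\<exists>f'\<in>S. \<forall>x. (f has_field_derivative f' x) (at x)"
    proof (intro bexI allI)
      show "(\<lambda>x. (c * N) * (deriv ^^ Suc k) B (N * (x - s)) - (c * N) * (deriv ^^ Suc k) B (N * (x - t))) \<in> S"
        unfolding S_def by blast
      have "((\<lambda>x. (deriv ^^ k) B (N * (x - r))) has_field_derivative (deriv ^^ Suc k) B (N * (x - r)) * N) (at x)" for x r
        by (rule DERIV_chain'[OF _ d]) (auto intro!: derivative_eq_intros)
      then show "(f has_field_derivative (c * N) * (deriv ^^ Suc k) B (N * (x - s)) - (c * N) * (deriv ^^ Suc k) B (N * (x - t))) (at x)" for x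
        unfolding f by (auto intro!: derivative_eq_intros simp: mult_ac)
    qed
  qed
  define K where "K = {min s t..max s t + 1 / N}"
  have "B (N * (x - s)) - B (N * (x - t)) = 0" if "x \<notin> K" for x
  proof -
    from that consider "x \<le> min s t" | "x \<ge> max s t + 1 / N" unfolding K_def by fastforce
    then show ?thesis
    proof cases
      case 1
      then have "N * (x - s) \<le> 0" "N * (x - t) \<le> 0" using N by (auto simp: mult_le_0_iff)
      then show ?thesis using B(2) by simp
    next
      case 2
      then have "1 / N \<le> x - s" "1 / N \<le> x - t" by auto
      then have "N * (x - s) \<ge> 1" "N * (x - t) \<ge> 1" using N by (auto simp: field_simps)
      then show ?thesis using B(3) by simp
    qed
  qed
  then show "\<exists>K. compact K \<and> (\<forall>x. x \<notin> K \<longrightarrow> B (N * (x - s)) - B (N * (x - t)) = 0)"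
    by (intro exI[of _ K]) (auto simp: K_def)
qed

text \<open>A one-sided approximate identity: the weights are nonnegative, have mass 1 and live on
  \<open>{s..s + 1 / real (Suc n)}\<close>, so continuity of \<open>f\<close> at \<open>s\<close>
  gives the limit.\<close>

lemma mollifier_limit:
  fixes f :: "real \<Rightarrow> 'a::euclidean_space" and s :: real
  assumes B: "\<And>x. (B has_field_derivative b x) (at x)" "continuous_on UNIV b"
    "\<And>x. b x \<ge> 0" "\<And>x. x \<notin> {0..1} \<Longrightarrow> b x = 0" "B 0 = 0" "B 1 = 1"
    and f: "continuous_on UNIV f"
  shows "integrable lborel (\<lambda>x. (real (Suc n) * b (real (Suc n) * (x - s))) *\<^sub>R f x)"
    "(\<lambda>n. LINT x|lborel. (real (Suc n) * b (real (Suc n) * (x - s))) *\<^sub>R f x) \<longlonglongrightarrow> f s"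
proof -
  define w where "w n x = real (Suc n) * b (real (Suc n) * (x - s))" for n x
  have w0: "w n x \<ge> 0" for n x using B(3) by (simp add: w_def)
  have ws: "w n x = 0" if "x \<notin> {s..s + 1 / real (Suc n)}" for n x
  proof -
    have "real (Suc n) * (x - s) \<notin> {0..1}" using that by (auto simp: zero_le_mult_iff field_simps simp del: of_nat_Suc)
    then show ?thesis using B(4) by (simp add: w_def)
  qed
  have wc: "continuous_on UNIV (w n)" for n unfolding w_def
    by (intro continuous_intros continuous_on_compose2[OF B(2)]) auto
  have w1: "has_bochner_integral lborel (w n) 1" for n
  proof -
    define F where "F x = B (real (Suc n) * (x - s))" for x
    have "has_bochner_integral lborel (\<lambda>x. w n x * indicator {s..s + 1 / real (Suc n)} x) (F (s + 1 / real (Suc n)) - F s)"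
    proof (rule has_bochner_integral_FTC_Icc_nonneg)
      show "w n \<in> borel_measurable borel" by (rule borel_measurable_continuous_onI[OF wc])
      show "(F has_real_derivative w n x) (at x)" for x unfolding F_def w_def mult.commute[of "real (Suc n)" "b _"]
        by (rule DERIV_chain'[OF _ B(1)]) (auto intro!: derivative_eq_intros)
    qed (auto simp: w0)
    moreover have "(\<lambda>x. w n x * indicator {s..s + 1 / real (Suc n)} x) = w n"
      using ws by (auto simp: indicator_def fun_eq_iff)
    moreover have "F (s + 1 / real (Suc n)) - F s = 1" using B(5,6) by (simp add: F_def)
    ultimately show ?thesis by simp
  qed
  have int: "integrable lborel (\<lambda>x. w n x *\<^sub>R g x)" if "continuous_on UNIV g" for n and g :: "real \<Rightarrow> 'a"
  proof -
    have "continuous_on {s..s + 1 / real (Suc n)} (\<lambda>x. w n x *\<^sub>R g x)"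
      by (intro continuous_intros continuous_on_subset[OF that] continuous_on_subset[OF wc]) auto
    then have "integrable lborel (\<lambda>x. indicator {s..s + 1 / real (Suc n)} x *\<^sub>R (w n x *\<^sub>R g x))"
      by (intro borel_integrable_compact) auto
    moreover have "(\<lambda>x. indicator {s..s + 1 / real (Suc n)} x *\<^sub>R (w n x *\<^sub>R g x)) = (\<lambda>x. w n x *\<^sub>R g x)"
      using ws by (auto simp: indicator_def fun_eq_iff)
    ultimately show ?thesis by simp
  qed
  show "integrable lborel (\<lambda>x. (real (Suc n) * b (real (Suc n) * (x - s))) *\<^sub>R f x)"
    using int[OF f, of n] unfolding w_def .
  have lim0: "(\<lambda>n. 1 / real (Suc n)) \<longlonglongrightarrow> 0" by (rule LIMSEQ_inverse_real_of_nat[unfolded inverse_eq_divide])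
  have "(\<lambda>n. LINT x|lborel. w n x *\<^sub>R f x) \<longlonglongrightarrow> f s"
  proof (rule LIMSEQ_I)
    fix e :: real assume e: "e > 0"
    have "isCont f s" using f by (simp add: continuous_on_eq_continuous_at)
    then obtain d where d: "d > 0" "\<And>x. dist x s < d \<Longrightarrow> dist (f x) (f s) < e / 2"
      using e unfolding continuous_at_eps_delta by (meson half_gt_zero)
    obtain n0 where n0: "\<And>n. n \<ge> n0 \<Longrightarrow> 1 / real (Suc n) < d"
      using order_tendstoD(2)[OF lim0 d(1)] unfolding eventually_sequentially by blast
    have "norm ((LINT x|lborel. w n x *\<^sub>R f x) - f s) < e" if "n \<ge> n0" for n
    proof -
      have "(LINT x|lborel. w n x *\<^sub>R f s) = f s"
        using w1[of n] by (simp add: has_bochner_integral_iff)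
      then have "(LINT x|lborel. w n x *\<^sub>R f x) - f s = (LINT x|lborel. w n x *\<^sub>R (f x - f s))"
        using int[OF f, of n] int[of "\<lambda>_. f s" n] by (simp add: scaleR_diff_right)
      also have "norm \<dots> \<le> (LINT x|lborel. w n x * (e / 2))"
      proof (rule Bochner_Integration.integral_norm_bound_integral)
        show "integrable lborel (\<lambda>x. w n x *\<^sub>R (f x - f s))"
          by (intro int continuous_intros f)
        show "integrable lborel (\<lambda>x. w n x * (e / 2))"
          using w1[of n] by (simp add: has_bochner_integral_iff)
        fix x
        show "norm (w n x *\<^sub>R (f x - f s)) \<le> w n x * (e / 2)"
        proof (cases "x \<in> {s..s + 1 / real (Suc n)}")
          case True
          then have "dist x s < d" using n0[OF that] by (auto simp: dist_real_def)
          from d(2)[OF this] have "norm (f x - f s) \<le> e / 2" by (simp add: dist_norm)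
          from mult_left_mono[OF this w0[of n x]] show ?thesis using w0[of n x] by simp
        qed (simp add: ws)
      qed
      also have "\<dots> = e / 2" using w1[of n] by (simp add: has_bochner_integral_iff)
      finally show ?thesis using e by simp
    qed
    then show "\<exists>no. \<forall>n\<ge>no. norm ((LINT x|lborel. w n x *\<^sub>R f x) - f s) < e" by blast
  qed
  then show "(\<lambda>n. LINT x|lborel. (real (Suc n) * b (real (Suc n) * (x - s))) *\<^sub>R f x) \<longlonglongrightarrow> f s"
    unfolding w_def .
qed

lemma L2_loc_norm: "f \<in> L2_loc \<Longrightarrow> frob_norm (f z) = norm (f z)"
  by (rule frob_norm_eq_norm) (auto simp: L2_loc_def)

lemma L2_loc_integrable:
  assumes f: "f \<in> L2_loc" and K: "compact K"
  shows "integrable lborel (\<lambda>x. indicator K x *\<^sub>R f x)"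
proof (rule Bochner_Integration.integrable_bound)
  have [measurable]: "f \<in> borel_measurable lborel" using f by (simp add: L2_loc_def)
  have [measurable]: "K \<in> sets lborel" using K by (simp add: borel_compact)
  show "(\<lambda>x. indicator K x *\<^sub>R f x) \<in> borel_measurable lborel" by measurable
  have "integrable lborel (\<lambda>x. indicator K x *\<^sub>R (norm (f x))\<^sup>2)"
    using f K by (auto simp: L2_loc_def set_integrable_def L2_loc_norm[OF f])
  moreover have "integrable lborel (\<lambda>x. indicator K x *\<^sub>R (1::real))"
    by (rule borel_integrable_compact[OF K]) auto
  ultimately show "integrable lborel (\<lambda>x. indicator K x *\<^sub>R (1::real) + indicator K x *\<^sub>R (norm (f x))\<^sup>2)"
    by simp
  have "t \<le> 1 + t\<^sup>2" for t :: real
    using sum_squares_ge_zero[of "t - 1/2" 0] by (simp add: power2_eq_square algebra_simps) 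
  then show "AE x in lborel. norm (indicator K x *\<^sub>R f x) \<le> norm (indicator K x *\<^sub>R (1::real) + indicator K x *\<^sub>R (norm (f x))\<^sup>2)"
    by (auto simp: indicator_def)
qed

text \<open>The weak derivative is tested with smooth steps \<open>\<phi> n\<close>. Their
  derivatives are differences of approximate identities at \<open>s\<close> and \<open>t\<close>,
  which pick out \<open>f s - f t\<close>, while \<open>\<phi> n\<close> itself tends to the
  indicator of the interval.\<close>

lemma weak_derivative_FTC:
  assumes w: "has_weak_derivative f g" and f: "continuous_on UNIV f" and st: "s < t"
  shows "integrable lborel (\<lambda>x. indicator {s<..t} x *\<^sub>R g x)"
    "(LINT x|lborel. indicator {s<..t} x *\<^sub>R g x) = f t - f s"
proof -
  obtain B b :: "real \<Rightarrow> real" where B: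
    "\<And>k x. (deriv ^^ k) B field_differentiable (at x)"
    "\<And>x. (B has_field_derivative b x) (at x)" "continuous_on UNIV b"
    "\<And>x. b x \<ge> 0" "\<And>x. x \<notin> {0..1} \<Longrightarrow> b x = 0"
    "\<And>x. x \<le> 0 \<Longrightarrow> B x = 0" "\<And>x. x \<ge> 1 \<Longrightarrow> B x = 1" "\<And>x. 0 \<le> B x" "\<And>x. B x \<le> 1"
    using smooth_step by metis
  define \<phi> where "\<phi> n = (\<lambda>x. B (real (Suc n) * (x - s)) - B (real (Suc n) * (x - t)))" for n
  have g: "g \<in> L2_loc" using w by (simp add: has_weak_derivative_def)
  have gm[measurable]: "g \<in> borel_measurable borel" using g by (simp add: L2_loc_def)
  have Bc: "continuous_on UNIV B"
    using B(2) by (intro continuous_at_imp_continuous_on ballI) (blast intro: DERIV_isCont)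
  have Bm[measurable]: "B \<in> borel_measurable borel" by (rule borel_measurable_continuous_onI[OF Bc])
  have d\<phi>: "deriv (\<phi> n) x = real (Suc n) * b (real (Suc n) * (x - s)) - real (Suc n) * b (real (Suc n) * (x - t))" for n x
    unfolding \<phi>_def
    by (rule DERIV_imp_deriv) (auto intro!: derivative_eq_intros DERIV_chain'[OF _ B(2)])
  \<comment> \<open>The falling edge of \<open>\<phi> n\<close> reaches at most to
    \<open>t + 1\<close>, so this function dominates for every \<open>n\<close>.\<close>
  have gint: "integrable lborel (\<lambda>x. indicator {s..t + 1} x *\<^sub>R g x)"
    by (rule L2_loc_integrable[OF g]) simp
  show gst: "integrable lborel (\<lambda>x. indicator {s<..t} x *\<^sub>R g x)"
    by (rule Bochner_Integration.integrable_bound[OF gint]) (auto simp: indicator_def)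
  have lim1: "(\<lambda>n. LINT x|lborel. deriv (\<phi> n) x *\<^sub>R f x) \<longlonglongrightarrow> f s - f t"
  proof -
    have ml1: "integrable lborel (\<lambda>x. (real (Suc n) * b (real (Suc n) * (x - r))) *\<^sub>R f x)"
      and ml2: "(\<lambda>n. LINT x|lborel. (real (Suc n) * b (real (Suc n) * (x - r))) *\<^sub>R f x) \<longlonglongrightarrow> f r" for n r
      by (rule mollifier_limit[where B = B]; use B(2-7) f in simp)+
    show ?thesis
      using tendsto_diff[OF ml2[of s] ml2[of t]]
      unfolding d\<phi> scaleR_diff_left Bochner_Integration.integral_diff[OF ml1 ml1] .
  qed
  have lim2: "(\<lambda>n. LINT x|lborel. \<phi> n x *\<^sub>R g x) \<longlonglongrightarrow> (LINT x|lborel. indicator {s<..t} x *\<^sub>R g x)"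
  proof (rule integral_dominated_convergence)
    show "(\<lambda>x. indicator {s<..t} x *\<^sub>R g x) \<in> borel_measurable lborel" by measurable
    show "(\<lambda>x. \<phi> n x *\<^sub>R g x) \<in> borel_measurable lborel" for n unfolding \<phi>_def by measurable
    show "integrable lborel (\<lambda>x. norm (indicator {s..t + 1} x *\<^sub>R g x))" using gint by (rule integrable_norm)
    show "AE x in lborel. (\<lambda>n. \<phi> n x *\<^sub>R g x) \<longlonglongrightarrow> indicator {s<..t} x *\<^sub>R g x"
    proof (rule AE_I2)
      fix x
      \<comment> \<open>The step is 0 up to and including \<open>r\<close> and eventually 1 beyond
        it; this is why the limiting interval is half-open on the left.\<close>
      have lim: "(\<lambda>n. B (real (Suc n) * (x - r))) \<longlonglongrightarrow> indicator {r<..} x" for r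
      proof (cases "x > r")
        case True
        obtain n0 where "1 / (x - r) < real n0" using reals_Archimedean2 by blast
        then have n0: "1 < real n0 * (x - r)" using True by (simp add: field_simps)
        have "real (Suc n) * (x - r) \<ge> 1" if "n \<ge> n0" for n
        proof -
          have "real n0 * (x - r) \<le> real (Suc n) * (x - r)"
            using True that by (intro mult_right_mono) auto
          with n0 show ?thesis by linarith
        qed
        then have "eventually (\<lambda>n. B (real (Suc n) * (x - r)) = 1) sequentially"
          using B(7) unfolding eventually_sequentially by blast
        then show ?thesis using True by (simp add: tendsto_eventually)
      next
        case False
        then have "real (Suc n) * (x - r) \<le> 0" for n by (auto simp: mult_le_0_iff)
        then show ?thesis using False B(6) by simp
      qed
      have "(\<lambda>n. \<phi> n x) \<longlonglongrightarrow> indicator {s<..} x - indicator {t<..} x"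
        unfolding \<phi>_def by (intro tendsto_diff lim)
      moreover have "indicator {s<..} x - indicator {t<..} x = (indicator {s<..t} x :: real)"
        using st by (auto simp: indicator_def)
      ultimately show "(\<lambda>n. \<phi> n x *\<^sub>R g x) \<longlonglongrightarrow> indicator {s<..t} x *\<^sub>R g x"
        by (auto intro: tendsto_scaleR)
    qed
    show "AE x in lborel. norm (\<phi> n x *\<^sub>R g x) \<le> norm (indicator {s..t + 1} x *\<^sub>R g x)" for n
    proof (rule AE_I2)
      fix x
      have 1: "\<bar>\<phi> n x\<bar> \<le> 1" unfolding \<phi>_def
        using B(8,9)[of "real (Suc n) * (x - s)"] B(8,9)[of "real (Suc n) * (x - t)"] by linarith
      have 0: "\<phi> n x = 0" if "x \<notin> {s..t + 1}"
      proof (cases "x \<le> s")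
        case True
        then have "real (Suc n) * (x - s) \<le> 0" "real (Suc n) * (x - t) \<le> 0"
          using st by (auto simp: mult_le_0_iff)
        then show ?thesis using B(6) by (simp add: \<phi>_def)
      next
        case False
        then have "1 \<le> x - s" "1 \<le> x - t" using that st by auto
        then have "1 * 1 \<le> real (Suc n) * (x - s)" "1 * 1 \<le> real (Suc n) * (x - t)"
          by (intro mult_mono; simp)+
        then show ?thesis using B(7) by (simp add: \<phi>_def)
      qed
      show "norm (\<phi> n x *\<^sub>R g x) \<le> norm (indicator {s..t + 1} x *\<^sub>R g x)"
      proof (cases "x \<in> {s..t + 1}")
        case True
        then show ?thesis using mult_right_mono[OF 1, of "norm (g x)"] by simp
      qed (simp add: 0)
    qed
  qed
  have parts: "(LINT x|lborel. deriv (\<phi> n) x *\<^sub>R f x) = - (LINT x|lborel. \<phi> n x *\<^sub>R g x)" for n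
  proof -
    have "test_function (\<phi> n)" unfolding \<phi>_def
      by (rule test_function_smooth_step[OF B(1)]) (rule B(6), assumption, rule B(7), assumption, simp)
    then show ?thesis using w unfolding has_weak_derivative_def by blast
  qed
  have "f s - f t = - (LINT x|lborel. indicator {s<..t} x *\<^sub>R g x)"
    by (rule LIMSEQ_unique[OF lim1[unfolded parts] tendsto_minus[OF lim2]])
  then have "- (LINT x|lborel. indicator {s<..t} x *\<^sub>R g x) = - (f t - f s)"
    unfolding minus_diff_eq by (rule sym)
  then show "(LINT x|lborel. indicator {s<..t} x *\<^sub>R g x) = f t - f s"
    by (rule neg_equal_iff_equal[THEN iffD1])
qed

section \<open>Uniqueness and computation of weak derivatives\<close>

text \<open>Half-lines are an intersection-stable generator of the Borel sets, so vanishing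
  integrals spread from them to all Borel sets. Truncation to \<open>{- real n<..real n}\<close>
  supplies integrability on the line and cuts a half-line down to one of the given
  intervals.\<close>

lemma integrable_zero_intervals_AE:
  fixes f :: "real \<Rightarrow> 'a::euclidean_space"
  assumes int: "\<And>s t. s < t \<Longrightarrow> integrable lborel (\<lambda>x. indicator {s<..t} x *\<^sub>R f x)"
    and zero: "\<And>s t. s < t \<Longrightarrow> (LINT x|lborel. indicator {s<..t} x *\<^sub>R f x) = 0"
  shows "AE x in lborel. f x = 0"
proof -
  have "AE x in lborel. indicator {- real n<..real n} x *\<^sub>R f x = 0" if n: "n > 0" for n
  proof -
    define g where "g x = indicator {- real n<..real n} x *\<^sub>R f x" for x
    have g: "integrable lborel g" unfolding g_def using n by (intro int) simp
    have gA: "set_integrable lborel A g" if "A \<in> sets borel" for A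
      unfolding set_integrable_def by (intro integrable_mult_indicator g) (use that in simp)
    have "(LINT x:A|lborel. g x) = 0" if "A \<in> sets lborel" for A
    proof -
      have borel: "sets borel = sigma_sets UNIV (range (\<lambda>a::real. {..a}))"
        unfolding borel_eq_atMost by (rule sets_measure_of) simp
      show ?thesis
      proof (rule sigma_sets_induct_disjoint[where A = A and P = "\<lambda>A. (LINT x:A|lborel. g x) = 0"])
        show "A \<in> sigma_sets UNIV (range (\<lambda>a::real. {..a}))" using that borel by simp
      next
        show "Int_stable (range (\<lambda>a::real. {..a}))"
          by (auto simp: Int_stable_def)
      next
        fix A assume "A \<in> range (\<lambda>a::real. {..a})"
        then obtain a where A: "A = {..a}" by blast
        have "(LINT x:A|lborel. g x) = (LINT x|lborel. indicator {- real n<..min a (real n)} x *\<^sub>R f x)"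
          unfolding set_lebesgue_integral_def A g_def
          by (rule Bochner_Integration.integral_cong) (auto simp: indicator_def)
        also have "\<dots> = 0"
        proof (cases "- real n < min a (real n)")
          case False
          then have e: "{- real n<..min a (real n)} = {}" unfolding greaterThanAtMost_empty_iff by linarith
          show ?thesis unfolding e by simp
        qed (rule zero)
        finally show "(LINT x:A|lborel. g x) = 0" .
      next
        fix A assume A: "A \<in> sigma_sets UNIV (range (\<lambda>a::real. {..a}))" "(LINT x:A|lborel. g x) = 0"
        have Ab: "A \<in> sets borel" using A(1) borel by simp
        have "(LINT x:UNIV - A|lborel. g x) = (LINT x|lborel. g x - indicator A x *\<^sub>R g x)"
          unfolding set_lebesgue_integral_def by (rule Bochner_Integration.integral_cong) (auto simp: indicator_def)
        also have "\<dots> = (LINT x|lborel. g x) - (LINT x:A|lborel. g x)"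
          unfolding set_lebesgue_integral_def
          by (rule Bochner_Integration.integral_diff[OF g gA[OF Ab, unfolded set_integrable_def]])
        also have "(LINT x|lborel. g x) = 0" unfolding g_def using n by (intro zero) simp
        finally show "(LINT x:UNIV - A|lborel. g x) = 0" using A(2) by simp
      next
        fix A :: "nat \<Rightarrow> real set"
        assume A: "disjoint_family A" "range A \<subseteq> sigma_sets UNIV (range (\<lambda>a::real. {..a}))"
          "\<And>i. (LINT x:A i|lborel. g x) = 0"
        have Ab: "A i \<in> sets borel" for i using A(2) borel by auto
        have "(LINT x:(\<Union>i. A i)|lborel. g x) = (\<Sum>i. LINT x:A i|lborel. g x)"
          using Ab A(1) by (intro lebesgue_integral_countable_add gA) (auto simp: disjoint_family_on_def)
        then show "(LINT x:(\<Union>i. A i)|lborel. g x) = 0" using A(3) by simp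
      qed (auto simp: set_lebesgue_integral_def)
    qed
    from sigma_finite_measure.density_zero[OF sigma_finite_lborel g this]
    show ?thesis unfolding g_def .
  qed
  then have "AE x in lborel. \<forall>n. n > 0 \<longrightarrow> indicator {- real n<..real n} x *\<^sub>R f x = 0"
    by (simp add: AE_all_countable)
  then show ?thesis
  proof (rule AE_mp, intro AE_I2 impI)
    fix x assume *: "\<forall>n. n > 0 \<longrightarrow> indicator {- real n<..real n} x *\<^sub>R f x = 0"
    obtain n where "\<bar>x\<bar> < real n" using reals_Archimedean2 by blast
    with *[rule_format, of n] show "f x = 0" by (auto simp: indicator_def split: if_splits)
  qed
qed

text \<open>\<open>weak_deriv\<close> is an arbitrary choice; this lets the energy of the kink be
  computed from its classical derivative.\<close>

lemma weak_derivative_unique: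
  assumes g: "has_weak_derivative f g" "has_weak_derivative f g'" and f: "continuous_on UNIV f"
  shows "AE x in lborel. g x = g' x"
proof -
  note i = weak_derivative_FTC(1)[OF g(1) f] weak_derivative_FTC(1)[OF g(2) f]
  note e = weak_derivative_FTC(2)[OF g(1) f] weak_derivative_FTC(2)[OF g(2) f]
  have "AE x in lborel. g x - g' x = 0"
  proof (rule integrable_zero_intervals_AE)
    fix s t :: real assume st: "s < t"
    show "integrable lborel (\<lambda>x. indicator {s<..t} x *\<^sub>R (g x - g' x))"
      unfolding scaleR_diff_right by (intro Bochner_Integration.integrable_diff i st)
    show "(LINT x|lborel. indicator {s<..t} x *\<^sub>R (g x - g' x)) = 0"
      unfolding scaleR_diff_right Bochner_Integration.integral_diff[OF i(1)[OF st] i(2)[OF st]] e(1)[OF st] e(2)[OF st] by simp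
  qed
  then show ?thesis by simp
qed

lemma has_weak_derivativeI:
  assumes d: "\<And>x. (f has_vector_derivative f' x) (at x)" and c: "continuous_on UNIV f'"
    and h: "range f \<subseteq> h0" "range f' \<subseteq> h0"
  shows "has_weak_derivative f f'"
proof -
  have fc: "continuous_on UNIV f"
    using d by (intro continuous_at_imp_continuous_on ballI) (blast intro: has_vector_derivative_continuous)
  have L2: "u \<in> L2_loc" if "continuous_on UNIV u" "range u \<subseteq> h0" for u
  proof -
    have "set_integrable lborel K (\<lambda>z. (norm (u z))\<^sup>2)" if "compact K" for K
      unfolding set_integrable_def
      by (intro borel_integrable_compact that continuous_intros continuous_on_subset[OF \<open>continuous_on UNIV u\<close>]) auto
    moreover have "frob_norm (u z) = norm (u z)" for z using that(2) by (intro frob_norm_eq_norm) auto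
    ultimately show ?thesis using that by (auto simp: L2_loc_def intro: borel_measurable_continuous_onI)
  qed
  have "(LINT z|lborel. deriv \<phi> z *\<^sub>R f z) = - (LINT z|lborel. \<phi> z *\<^sub>R f' z)" if \<phi>: "test_function \<phi>" for \<phi>
  proof -
    have \<phi>d: "(\<phi> has_field_derivative deriv \<phi> x) (at x)" "deriv \<phi> field_differentiable (at x)" for x
      using \<phi>[unfolded test_function_def, THEN conjunct1, rule_format, of 0 x]
        \<phi>[unfolded test_function_def, THEN conjunct1, rule_format, of 1 x]
      by (auto simp: field_differentiable_derivI)
    have \<phi>c: "continuous_on UNIV \<phi>" "continuous_on UNIV (deriv \<phi>)"
      using DERIV_isCont[OF \<phi>d(1)] field_differentiable_imp_continuous_at[OF \<phi>d(2)]
      by (auto intro!: continuous_at_imp_continuous_on)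
    obtain K where K: "compact K" "\<And>x. x \<notin> K \<Longrightarrow> \<phi> x = 0" using \<phi> by (auto simp: test_function_def)
    obtain R where R: "R > 0" "\<And>x. x \<in> K \<Longrightarrow> \<bar>x\<bar> < R"
      using compact_imp_bounded[OF K(1)] by (auto simp: bounded_pos_less)
    have \<phi>0: "\<phi> x = 0" if "\<bar>x\<bar> \<ge> R" for x using K(2) R(2) that by force
    have d\<phi>0: "deriv \<phi> x = 0" if "\<bar>x\<bar> > R" for x
    proof -
      have "(\<phi> has_field_derivative 0) (at x)"
      proof (rule has_field_derivative_transform_within_open)
        show "((\<lambda>x. 0) has_field_derivative 0) (at x)" by simp
        show "open {x. \<bar>x\<bar> > R}" by (intro open_Collect_less continuous_intros)
      qed (use that \<phi>0 in auto)
      then show ?thesis by (rule DERIV_imp_deriv)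
    qed
    \<comment> \<open>\<open>deriv \<phi>\<close> is known to vanish where
      \<open>\<bar>x\<bar> > R\<close>. The margin 1 moves the complement of the interval into that
      region and removes the boundary terms.\<close>
    let ?I = "indicator {- R - 1..R + 1} :: real \<Rightarrow> real"
    have "(LINT x|lborel. ?I x *\<^sub>R (\<phi> x *\<^sub>R f' x + deriv \<phi> x *\<^sub>R f x)) = \<phi> (R + 1) *\<^sub>R f (R + 1) - \<phi> (- R - 1) *\<^sub>R f (- R - 1)"
    proof (rule integral_FTC_Icc)
      show "((\<lambda>x. \<phi> x *\<^sub>R f x) has_vector_derivative \<phi> x *\<^sub>R f' x + deriv \<phi> x *\<^sub>R f x) (at x within {- R - 1..R + 1})" for x
        by (rule has_vector_derivative_at_within) (intro has_vector_derivative_scaleR \<phi>d d)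
      show "continuous_on {- R - 1..R + 1} (\<lambda>x. \<phi> x *\<^sub>R f' x + deriv \<phi> x *\<^sub>R f x)"
        by (rule continuous_on_subset[of UNIV]) (intro continuous_intros \<phi>c c fc, simp)
    qed (use R in simp)
    also have "\<dots> = 0" using R by (simp add: \<phi>0)
    finally have 0: "(LINT x|lborel. ?I x *\<^sub>R (\<phi> x *\<^sub>R f' x) + ?I x *\<^sub>R (deriv \<phi> x *\<^sub>R f x)) = 0"
      by (simp add: scaleR_add_right)
    have i: "integrable lborel (\<lambda>x. ?I x *\<^sub>R (\<phi> x *\<^sub>R f' x))" "integrable lborel (\<lambda>x. ?I x *\<^sub>R (deriv \<phi> x *\<^sub>R f x))"
      by (intro borel_integrable_compact continuous_intros; auto intro: continuous_on_subset[OF \<phi>c(1)]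
          continuous_on_subset[OF \<phi>c(2)] continuous_on_subset[OF c] continuous_on_subset[OF fc])+
    have eq: "(\<lambda>x. ?I x *\<^sub>R (\<phi> x *\<^sub>R f' x)) = (\<lambda>x. \<phi> x *\<^sub>R f' x)" "(\<lambda>x. ?I x *\<^sub>R (deriv \<phi> x *\<^sub>R f x)) = (\<lambda>x. deriv \<phi> x *\<^sub>R f x)"
    proof -
      have out: "\<phi> x = 0" "deriv \<phi> x = 0" if "x \<notin> {- R - 1..R + 1}" for x
      proof -
        have "\<bar>x\<bar> > R" using that by auto
        then show "\<phi> x = 0" "deriv \<phi> x = 0" using \<phi>0[of x] d\<phi>0[of x] by simp_all
      qed
      show "(\<lambda>x. ?I x *\<^sub>R (\<phi> x *\<^sub>R f' x)) = (\<lambda>x. \<phi> x *\<^sub>R f' x)"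
        by (rule ext, case_tac "x \<in> {- R - 1..R + 1}") (simp_all add: out del: atLeastAtMost_iff)
      show "(\<lambda>x. ?I x *\<^sub>R (deriv \<phi> x *\<^sub>R f x)) = (\<lambda>x. deriv \<phi> x *\<^sub>R f x)"
        by (rule ext, case_tac "x \<in> {- R - 1..R + 1}") (simp_all add: out del: atLeastAtMost_iff)
    qed
    from 0 have "(LINT x|lborel. \<phi> x *\<^sub>R f' x) + (LINT x|lborel. deriv \<phi> x *\<^sub>R f x) = 0"
      unfolding Bochner_Integration.integral_add[OF i] eq .
    then show ?thesis unfolding eq_neg_iff_add_eq_0 by (subst add.commute)
  qed
  then show ?thesis using L2 c fc h by (auto simp: has_weak_derivative_def)
qed

lemma AE_weak_deriv:
  assumes "has_weak_derivative f f'" "continuous_on UNIV f"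
  shows "has_weak_derivative f (weak_deriv f)" "AE x in lborel. weak_deriv f x = f' x"
proof -
  show "has_weak_derivative f (weak_deriv f)" unfolding weak_deriv_def using assms(1) by (rule someI[of "has_weak_derivative f"])
  then show "AE x in lborel. weak_deriv f x = f' x" using weak_derivative_unique assms by blast
qed


section \<open>The calibration\<close>

definition calibration :: "real \<Rightarrow> real \<Rightarrow> cmat5 \<Rightarrow> real" where
  "calibration \<mu> h \<Phi> = (let y = kink_coord \<Phi> in
     sqrt 30 * (2 * sqrt (2000/3 * h)) * ((kink_amp \<mu> h)\<^sup>2 * y - y ^ 3 / 3))"

lemma crit_potential_nonneg: "h > 0 \<Longrightarrow> A \<in> h0 \<Longrightarrow> crit_potential \<mu> h A \<ge> 0"
  by (rule order_trans[OF _ potential_lower_bound[of h A \<mu>]]) simp_all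

lemma sqrt_crit_potential_lower_bound:
  assumes h: "h > 0" and A: "A \<in> h0"
  shows "sqrt (2000/3 * h) * \<bar>(kink_coord A)\<^sup>2 - (kink_amp \<mu> h)\<^sup>2\<bar> \<le> sqrt (crit_potential \<mu> h A)"
proof -
  have "sqrt (2000/3 * h) * \<bar>(kink_coord A)\<^sup>2 - (kink_amp \<mu> h)\<^sup>2\<bar>
      = sqrt (2000/3 * h * ((kink_coord A)\<^sup>2 - (kink_amp \<mu> h)\<^sup>2)\<^sup>2)"
    unfolding real_sqrt_mult real_sqrt_abs ..
  also have "\<dots> \<le> sqrt (crit_potential \<mu> h A)" using potential_lower_bound[OF h A] by simp
  finally show ?thesis .
qed

text \<open>The increment of the cubic in y is the increment of y times a divided difference. Only
  the Lipschitz bound for y is then used, never a derivative, and the constant at \<open>P\<close>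
  comes out as twice the root of the potential up to \<open>e\<close>.\<close>

lemma calibration_local:
  assumes h: "h > 0" and P: "P \<in> h0" and e: "e > 0"
  obtains d where "d > 0" "\<And>X Y. X \<in> h0 \<Longrightarrow> Y \<in> h0 \<Longrightarrow> norm (X - P) < d \<Longrightarrow> norm (Y - P) < d \<Longrightarrow>
    \<bar>calibration \<mu> h X - calibration \<mu> h Y\<bar> \<le> (2 * sqrt (crit_potential \<mu> h P) + e) * norm (X - Y)"
proof -
  define c where "c = kink_amp \<mu> h"
  define k where "k = 2 * sqrt (2000/3 * h)"
  have k: "k > 0" using h by (simp add: k_def)
  \<comment> \<open>The modulus of the divided difference of
    \<open>c\<^sup>2 * y - y ^ 3 / 3\<close>; on the diagonal it is \<bar>c^2 - y^2\<bar>, which the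
    potential controls.\<close>
  define q where "q = (\<lambda>(a, b). \<bar>c\<^sup>2 - (a\<^sup>2 + a * b + b\<^sup>2) / 3\<bar> :: real)"
  define y where "y = kink_coord P"
  have "continuous_on UNIV q" unfolding q_def case_prod_unfold by (intro continuous_intros) auto
  then have "isCont q (y, y)" by (simp add: continuous_on_eq_continuous_at)
  moreover have "e / k > 0" using e k by simp
  ultimately obtain r where r: "r > 0" "\<And>p. dist p (y, y) < r \<Longrightarrow> dist (q p) (q (y, y)) < e / k"
    unfolding continuous_at_eps_delta by meson
  have qy: "k * q (y, y) \<le> 2 * sqrt (crit_potential \<mu> h P)"
  proof -
    have "q (y, y) = \<bar>y\<^sup>2 - c\<^sup>2\<bar>" by (simp add: q_def power2_eq_square abs_minus_commute)
    then show ?thesis using sqrt_crit_potential_lower_bound[OF h P, of \<mu>] by (simp add: k_def y_def c_def)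
  qed
  have Lip: "\<bar>kink_coord X - kink_coord Y\<bar> \<le> norm (X - Y) / sqrt 30" if "X \<in> h0" "Y \<in> h0" for X Y
    using kink_coord_Lipschitz[OF that(2,1)] .
  have "\<bar>calibration \<mu> h X - calibration \<mu> h Y\<bar> \<le> (2 * sqrt (crit_potential \<mu> h P) + e) * norm (X - Y)"
    if X: "X \<in> h0" "norm (X - P) < r / 2" and Y: "Y \<in> h0" "norm (Y - P) < r / 2" for X Y
  proof -
    define a b where "a = kink_coord X" and "b = kink_coord Y"
    have s30: "norm Z / sqrt 30 \<le> norm Z" for Z :: cmat5
    proof -
      have "1 \<le> sqrt 30" by simp
      then show ?thesis by (simp add: divide_le_eq mult_le_cancel_left1)
    qed
    have "\<bar>a - y\<bar> < r / 2" "\<bar>b - y\<bar> < r / 2"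
      using Lip[OF X(1) P] Lip[OF Y(1) P] s30[of "X - P"] s30[of "Y - P"] X(2) Y(2) unfolding a_def b_def y_def by linarith+
    then have "dist a y + dist b y < r" by (simp add: dist_real_def)
    then have "dist (a, b) (y, y) < r"
      using sqrt_sum_squares_le_sum[of "dist a y" "dist b y"] by (simp add: dist_Pair_Pair)
    from r(2)[OF this] have "q (a, b) < q (y, y) + e / k" by (simp add: dist_real_def)
    then have "k * q (a, b) \<le> k * (q (y, y) + e / k)" using k by simp
    also have "\<dots> \<le> 2 * sqrt (crit_potential \<mu> h P) + e" using qy k by (simp add: distrib_left)
    finally have kq: "k * q (a, b) \<le> 2 * sqrt (crit_potential \<mu> h P) + e" .
    have "calibration \<mu> h X - calibration \<mu> h Y = sqrt 30 * k * ((a - b) * (c\<^sup>2 - (a\<^sup>2 + a * b + b\<^sup>2) / 3))"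
      unfolding calibration_def Let_def a_def[symmetric] b_def[symmetric] c_def[symmetric] k_def[symmetric]
      by (simp add: field_simps power2_eq_square power3_eq_cube)
    then have "\<bar>calibration \<mu> h X - calibration \<mu> h Y\<bar> = (k * q (a, b)) * (sqrt 30 * \<bar>a - b\<bar>)"
      using k by (simp add: abs_mult q_def mult_ac)
    also have "\<dots> \<le> (2 * sqrt (crit_potential \<mu> h P) + e) * norm (X - Y)"
    proof (rule mult_mono[OF kq])
      show "sqrt 30 * \<bar>a - b\<bar> \<le> norm (X - Y)"
        using Lip[OF X(1) Y(1)] by (simp add: a_def b_def field_simps)
      show "0 \<le> 2 * sqrt (crit_potential \<mu> h P) + e" using crit_potential_nonneg[OF h P, of \<mu>] e by simp
    qed simp
    finally show ?thesis .
  qed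
  then show ?thesis using that[of "r / 2"] r(1) by simp
qed

lemma continuous_crit_potential: "continuous_on UNIV (crit_potential \<mu> h)"
  unfolding crit_potential_def potential_def trace_def matrix_matrix_mult_def
  by (intro continuous_intros)

lemma continuous_calibration: "continuous_on h0 (calibration \<mu> h)"
proof -
  have "continuous_on h0 (kink_coord :: cmat5 \<Rightarrow> real)"
    unfolding continuous_on_iff
  proof (intro ballI allI impI)
    fix x e assume x: "x \<in> h0" and e: "(0::real) < e"
    have "dist (kink_coord x') (kink_coord x) < e" if "x' \<in> h0" "dist x' x < e" for x'
    proof -
      have "dist (kink_coord x') (kink_coord x) \<le> dist x' x / sqrt 30"
        using kink_coord_Lipschitz[OF x that(1)] by (simp add: dist_norm dist_real_def)
      also have "\<dots> \<le> dist x' x" by (simp add: divide_le_eq mult_le_cancel_left1)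
      finally show ?thesis using that(2) by simp
    qed
    then show "\<exists>d>0. \<forall>x'\<in>h0. dist x' x < d \<longrightarrow> dist (kink_coord x') (kink_coord x) < e" using e by blast
  qed
  then show ?thesis unfolding calibration_def Let_def by (intro continuous_intros) auto
qed

text \<open>This takes the place of the chain rule. The local bound, the estimate of
  \<open>norm (\<Psi> t - \<Psi> s)\<close> by the integral of \<open>norm (g x)\<close> and the
  continuity of \<open>\<omega>\<close> give the inequality with error \<open>e\<close> on short
  intervals; it then extends to long ones by additivity.\<close>

lemma calibration_path_bound:
  fixes \<Psi> g :: "real \<Rightarrow> cmat5"
  assumes h: "h > 0" and \<Psi>: "continuous_on UNIV \<Psi>" "range \<Psi> \<subseteq> h0"
    and g: "\<And>s t. s < t \<Longrightarrow> integrable lborel (\<lambda>x. indicator {s<..t} x *\<^sub>R g x)"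
    and FTC: "\<And>s t. s < t \<Longrightarrow> (LINT x|lborel. indicator {s<..t} x *\<^sub>R g x) = \<Psi> t - \<Psi> s"
    and st: "s \<le> t"
  shows "\<bar>calibration \<mu> h (\<Psi> t) - calibration \<mu> h (\<Psi> s)\<bar>
     \<le> (LINT x|lborel. indicator {s<..t} x * (2 * sqrt (crit_potential \<mu> h (\<Psi> x)) * norm (g x)))"
proof (rule field_le_epsilon)
  define \<omega> where "\<omega> x = 2 * sqrt (crit_potential \<mu> h (\<Psi> x))" for x
  have \<omega>c: "continuous_on UNIV \<omega>" unfolding \<omega>_def
    by (intro continuous_intros continuous_on_compose2[OF continuous_crit_potential \<Psi>(1)]) auto
  have gn: "integrable lborel (\<lambda>x. indicator {s<..t} x * norm (g x))" for s t
  proof (cases "s < t")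
    case True
    from integrable_norm[OF g[OF this]] show ?thesis by simp
  qed simp
  have gw: "integrable lborel (\<lambda>x. indicator {s<..t} x * ((\<omega> x + e) * norm (g x)))" for s t e
  proof -
    have "compact (\<omega> ` {s..t})" by (intro compact_continuous_image continuous_on_subset[OF \<omega>c]) auto
    then have "bounded (\<omega> ` {s..t})" by (rule compact_imp_bounded)
    then obtain M where "\<forall>x\<in>{s..t}. \<bar>\<omega> x\<bar> \<le> M" by (auto simp: bounded_iff)
    then have M: "\<And>x. x \<in> {s..t} \<Longrightarrow> \<bar>\<omega> x\<bar> \<le> M" by blast
    show ?thesis
    proof (rule Bochner_Integration.integrable_bound)
      show "integrable lborel (\<lambda>x. (M + \<bar>e\<bar>) * (indicator {s<..t} x * norm (g x)))"
        by (intro integrable_mult_right gn)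
      have [measurable]: "\<omega> \<in> borel_measurable borel" by (rule borel_measurable_continuous_onI[OF \<omega>c])
      have [measurable]: "(\<lambda>x. indicator {s<..t} x * norm (g x)) \<in> borel_measurable lborel"
        using gn by (rule borel_measurable_integrable)
      have "(\<lambda>x. (\<omega> x + e) * (indicator {s<..t} x * norm (g x))) \<in> borel_measurable lborel" by measurable
      then show "(\<lambda>x. indicator {s<..t} x * ((\<omega> x + e) * norm (g x))) \<in> borel_measurable lborel"
        by (simp add: mult_ac)
      show "AE x in lborel. norm (indicator {s<..t} x * ((\<omega> x + e) * norm (g x))) \<le> norm ((M + \<bar>e\<bar>) * (indicator {s<..t} x * norm (g x)))"
      proof (rule AE_I2)
        fix x
        show "norm (indicator {s<..t} x * ((\<omega> x + e) * norm (g x))) \<le> norm ((M + \<bar>e\<bar>) * (indicator {s<..t} x * norm (g x)))"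
        proof (cases "x \<in> {s<..t}")
          case True
          then have "\<bar>\<omega> x + e\<bar> \<le> \<bar>M + \<bar>e\<bar>\<bar>" using M[of x] by auto
          then show ?thesis using True by (simp add: abs_mult mult_right_mono)
        qed simp
      qed
    qed
  qed
  have nb: "norm (\<Psi> t - \<Psi> s) \<le> (LINT x|lborel. indicator {s<..t} x * norm (g x))" if "s \<le> t" for s t
  proof (cases "s < t")
    case True
    have "norm (LINT x|lborel. indicator {s<..t} x *\<^sub>R g x) \<le> (LINT x|lborel. norm (indicator {s<..t} x *\<^sub>R g x))"
      by (rule integral_norm_bound)
    then show ?thesis using FTC[OF True] by simp
  qed (use that in simp)
  fix e0 :: real assume e0: "e0 > 0"
  define J where "J = (LINT x|lborel. indicator {s<..t} x * norm (g x))"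
  have J: "J \<ge> 0" unfolding J_def by (rule integral_nonneg_AE) (auto simp: indicator_def)
  define e where "e = e0 / (J + 1)"
  have e: "e > 0" using e0 J by (simp add: e_def)
  have "\<bar>calibration \<mu> h (\<Psi> t) - calibration \<mu> h (\<Psi> s)\<bar> \<le> (LINT x|lborel. indicator {s<..t} x * ((\<omega> x + e) * norm (g x)))"
    using st
  proof (induction rule: Bolzano)
    case (trans a b c)
    have "(LINT x|lborel. indicator {a<..c} x * ((\<omega> x + e) * norm (g x)))
       = (LINT x|lborel. indicator {a<..b} x * ((\<omega> x + e) * norm (g x)) + indicator {b<..c} x * ((\<omega> x + e) * norm (g x)))"
      using trans(3,4) by (intro Bochner_Integration.integral_cong) (auto simp: indicator_def)
    also have "\<dots> = (LINT x|lborel. indicator {a<..b} x * ((\<omega> x + e) * norm (g x))) + (LINT x|lborel. indicator {b<..c} x * ((\<omega> x + e) * norm (g x)))"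
      by (rule Bochner_Integration.integral_add[OF gw gw])
    finally show ?case using trans(1,2) by linarith
  next
    case (local x)
    have Px: "\<Psi> z \<in> h0" for z using \<Psi>(2) by auto
    \<comment> \<open>One half of \<open>e\<close> pays for the local Lipschitz constant, the other
      for the oscillation of \<open>\<omega>\<close> near \<open>x\<close>.\<close>
    have "e / 2 > 0" using e by simp
    from calibration_local[OF h Px this, of x \<mu>] obtain d where d: "d > 0"
      "\<And>X Y. X \<in> h0 \<Longrightarrow> Y \<in> h0 \<Longrightarrow> norm (X - \<Psi> x) < d \<Longrightarrow> norm (Y - \<Psi> x) < d \<Longrightarrow>
        \<bar>calibration \<mu> h X - calibration \<mu> h Y\<bar> \<le> (2 * sqrt (crit_potential \<mu> h (\<Psi> x)) + e / 2) * norm (X - Y)" by blast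
    have "isCont \<Psi> x" "isCont \<omega> x" using \<Psi>(1) \<omega>c by (auto simp: continuous_on_eq_continuous_at)
    then have "\<exists>r>0. \<forall>z. dist z x < r \<longrightarrow> dist (\<Psi> z) (\<Psi> x) < d" "\<exists>r>0. \<forall>z. dist z x < r \<longrightarrow> dist (\<omega> z) (\<omega> x) < e / 2"
      using d(1) \<open>e / 2 > 0\<close> unfolding continuous_at_eps_delta by blast+
    then obtain r1 r2 where r: "r1 > 0" "\<And>z. dist z x < r1 \<Longrightarrow> dist (\<Psi> z) (\<Psi> x) < d"
        "r2 > 0" "\<And>z. dist z x < r2 \<Longrightarrow> dist (\<omega> z) (\<omega> x) < e / 2"
      by blast
    show ?case
    proof (intro exI[of _ "min r1 r2"] conjI allI impI)
      fix a b assume ab: "a \<le> x \<and> x \<le> b \<and> b - a < min r1 r2"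
      then have near: "dist z x < r1 \<and> dist z x < r2" if "a \<le> z" "z \<le> b" for z
        using that by (auto simp: dist_real_def)
      have "\<bar>calibration \<mu> h (\<Psi> b) - calibration \<mu> h (\<Psi> a)\<bar> \<le> (\<omega> x + e / 2) * norm (\<Psi> b - \<Psi> a)"
        unfolding \<omega>_def using ab near[of a] near[of b] r(2)[of a] r(2)[of b] by (intro d(2) Px) (auto simp: dist_norm)
      also have "\<dots> \<le> (\<omega> x + e / 2) * (LINT z|lborel. indicator {a<..b} z * norm (g z))"
      proof (intro mult_left_mono nb)
        show "0 \<le> \<omega> x + e / 2" using crit_potential_nonneg[OF h Px, of \<mu> x] e by (simp add: \<omega>_def)
      qed (use ab in simp)
      also have "\<dots> = (LINT z|lborel. (\<omega> x + e / 2) * (indicator {a<..b} z * norm (g z)))" by simp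
      also have "\<dots> \<le> (LINT z|lborel. indicator {a<..b} z * ((\<omega> z + e) * norm (g z)))"
      proof (rule integral_mono)
        show "integrable lborel (\<lambda>z. (\<omega> x + e / 2) * (indicator {a<..b} z * norm (g z)))"
          by (intro integrable_mult_right gn)
        show "integrable lborel (\<lambda>z. indicator {a<..b} z * ((\<omega> z + e) * norm (g z)))" by (rule gw)
        fix z
        show "(\<omega> x + e / 2) * (indicator {a<..b} z * norm (g z)) \<le> indicator {a<..b} z * ((\<omega> z + e) * norm (g z))"
        proof (cases "z \<in> {a<..b}")
          case True
          then have "dist (\<omega> z) (\<omega> x) < e / 2" using near[of z] r(4)[of z] by auto
          then have "\<omega> x + e / 2 \<le> \<omega> z + e" unfolding dist_real_def by linarith
          then show ?thesis using True by (simp add: mult_right_mono)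
        qed simp
      qed
      finally show "\<bar>calibration \<mu> h (\<Psi> b) - calibration \<mu> h (\<Psi> a)\<bar> \<le> (LINT x|lborel. indicator {a<..b} x * ((\<omega> x + e) * norm (g x)))" .
    qed (use r in simp)
  qed
  also have "\<dots> = (LINT x|lborel. indicator {s<..t} x * ((\<omega> x + 0) * norm (g x)) + e * (indicator {s<..t} x * norm (g x)))"
    by (intro Bochner_Integration.integral_cong) (auto simp: algebra_simps)
  also have "\<dots> = (LINT x|lborel. indicator {s<..t} x * ((\<omega> x + 0) * norm (g x))) + (LINT x|lborel. e * (indicator {s<..t} x * norm (g x)))"
    by (rule Bochner_Integration.integral_add[OF gw integrable_mult_right[OF gn]])
  also have "(LINT x|lborel. e * (indicator {s<..t} x * norm (g x))) = e * J" by (simp add: J_def)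
  also have "e * J \<le> e0" using e0 J by (simp add: e_def field_simps)
  finally show "\<bar>calibration \<mu> h (\<Psi> t) - calibration \<mu> h (\<Psi> s)\<bar>
     \<le> (LINT x|lborel. indicator {s<..t} x * (2 * sqrt (crit_potential \<mu> h (\<Psi> x)) * norm (g x))) + e0"
    by (simp add: \<omega>_def)
qed


section \<open>Absolutely continuous curves\<close>

text \<open>
  An absolutely continuous curve \<open>\<gamma>\<close> may move on the exceptional set \<open>N\<close> only by a total amount that
  is as small as we like, because the tagged intervals with tag in \<open>N\<close> can be kept inside an open set
  of small measure.
\<close>

lemma abs_continuous_gauge_bound:
  fixes F f :: "real \<Rightarrow> real" and \<gamma> :: "real \<Rightarrow> cmat5"
  assumes ac: "abs_continuous_on {0..1} \<gamma>" and I: "(f has_integral I) {0..1}" and f0: "\<And>x. f x \<ge> 0"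
    and N: "negligible N" and C: "C \<ge> 0"
    and out: "\<And>x e. x \<in> {0..1} - N \<Longrightarrow> e > 0 \<Longrightarrow>
      \<exists>d>0. \<forall>u v. 0 \<le> u \<and> u \<le> x \<and> x \<le> v \<and> v \<le> 1 \<and> v - u < d \<longrightarrow> \<bar>F v - F u\<bar> \<le> (f x + e) * (v - u)"
    and inn: "\<And>x. x \<in> {0..1} \<inter> N \<Longrightarrow>
      \<exists>d>0. \<forall>u v. 0 \<le> u \<and> u \<le> x \<and> x \<le> v \<and> v \<le> 1 \<and> v - u < d \<longrightarrow> \<bar>F v - F u\<bar> \<le> C * norm (\<gamma> v - \<gamma> u)"
  shows "\<bar>F 1 - F 0\<bar> \<le> I"
proof (rule field_le_epsilon)
  fix e0 :: real assume e0: "e0 > 0"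
  \<comment> \<open>Off \<open>N\<close> the error is \<open>2 * e\<close>: one part from the
    Riemann sum, one from the slack over total length 1. Tags in \<open>N\<close> add
    \<open>C * e\<close>.\<close>
  define e where "e = e0 / (C + 2)"
  have e: "e > 0" using e0 C by (simp add: e_def)
  obtain \<delta> where \<delta>0: "\<delta> > 0" and \<delta>1: "\<forall>J. finite J \<and> (\<forall>(a, b)\<in>J. a \<le> b \<and> {a..b} \<subseteq> {0..1}) \<and>
      disjoint_family_on (\<lambda>(a, b). {a<..<b}) J \<and> (\<Sum>(a, b)\<in>J. b - a) < \<delta> \<longrightarrow>
      (\<Sum>(a, b)\<in>J. norm (\<gamma> b - \<gamma> a)) < e"
    using ac[unfolded abs_continuous_on_def, THEN spec, THEN mp, OF e] by (elim exE conjE) (rule that)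
  have \<delta>2: "(\<Sum>(a, b)\<in>J. norm (\<gamma> b - \<gamma> a)) < e" if "finite J" "\<forall>(a, b)\<in>J. a \<le> b \<and> {a..b} \<subseteq> {0..1}"
      "disjoint_family_on (\<lambda>(a, b). {a<..<b}) J" "(\<Sum>(a, b)\<in>J. b - a) < \<delta>" for J
    using \<delta>1[THEN spec, THEN mp, OF conjI, OF that(1) conjI, OF that(2) conjI, OF that(3,4)] .
  obtain T where T: "open T" "N \<subseteq> T" "T \<in> lmeasurable" "measure lebesgue T < \<delta>"
  proof -
    have Nl: "N \<in> sets lebesgue" "emeasure lebesgue N = 0"
      using N unfolding negligible_iff_null_sets by (rule null_setsD2, rule null_setsD1)
    obtain T where T: "open T" "N \<subseteq> T" "T - N \<in> lmeasurable" "emeasure lebesgue (T - N) < ennreal \<delta>"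
      using sets_lebesgue_outer_open[OF Nl(1) \<delta>0] by blast
    have lm: "T \<in> lmeasurable"
      using fmeasurable.Un[OF T(3), of N] N T(2) by (metis Diff_partition Un_commute negligible_imp_measurable)
    have "emeasure lebesgue T \<le> emeasure lebesgue (T - N) + emeasure lebesgue N"
      using emeasure_subadditive[of "T - N" lebesgue N] T Nl(1) by (simp add: Un_absorb2 fmeasurableD)
    then have "emeasure lebesgue T < ennreal \<delta>" using T(4) Nl(2) by simp
    then have "measure lebesgue T < \<delta>" using lm \<delta>0 by (simp add: emeasure_eq_measure2 ennreal_less_iff)
    with T lm that show ?thesis by blast
  qed
  have "\<exists>d>0. (x \<in> {0..1} - N \<longrightarrow> (\<forall>u v. 0 \<le> u \<and> u \<le> x \<and> x \<le> v \<and> v \<le> 1 \<and> v - u < d \<longrightarrow> \<bar>F v - F u\<bar> \<le> (f x + e) * (v - u)))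
     \<and> (x \<in> {0..1} \<inter> N \<longrightarrow> (\<forall>u v. 0 \<le> u \<and> u \<le> x \<and> x \<le> v \<and> v \<le> 1 \<and> v - u < d \<longrightarrow> \<bar>F v - F u\<bar> \<le> C * norm (\<gamma> v - \<gamma> u)))" for x
    using out[of x, OF _ e] inn[of x] by (cases "x \<in> N"; cases "x \<in> {0..1}") (auto intro: exI[of _ "1::real"])
  then obtain d where d: "\<And>x. d x > 0"
    and dout: "\<And>x u v. x \<in> {0..1} - N \<Longrightarrow> 0 \<le> u \<Longrightarrow> u \<le> x \<Longrightarrow> x \<le> v \<Longrightarrow> v \<le> 1 \<Longrightarrow> v - u < d x \<Longrightarrow> \<bar>F v - F u\<bar> \<le> (f x + e) * (v - u)"
    and dinn: "\<And>x u v. x \<in> {0..1} \<inter> N \<Longrightarrow> 0 \<le> u \<Longrightarrow> u \<le> x \<Longrightarrow> x \<le> v \<Longrightarrow> v \<le> 1 \<Longrightarrow> v - u < d x \<Longrightarrow> \<bar>F v - F u\<bar> \<le> C * norm (\<gamma> v - \<gamma> u)"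
    by metis
  obtain G0 where G0: "gauge G0" and G0I: "\<forall>p. p tagged_division_of {0..1} \<and> G0 fine p \<longrightarrow>
      norm ((\<Sum>(x, k)\<in>p. measure lborel k *\<^sub>R f x) - I) < e"
    using I[unfolded has_integral_real, THEN spec, THEN mp, OF e] by (elim exE conjE) (rule that)
  \<comment> \<open>Tags in \<open>N\<close> keep their intervals inside \<open>T\<close>, and the
    halved radius makes every interval shorter than \<open>d x\<close>.\<close>
  define G where "G x = G0 x \<inter> ball x (d x / 2) \<inter> (if x \<in> N then T else UNIV)" for x
  have "gauge G"
    using G0 d T(1,2) unfolding gauge_def G_def by (auto intro!: open_Int)
  then obtain p where p: "p tagged_division_of {0..1}" "G fine p"
    using fine_division_exists_real by blast
  have fin: "finite p" using p(1) by (rule tagged_division_of_finite)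
  have K: "K = {Inf K..Sup K}" "Inf K \<le> x" "x \<le> Sup K" "0 \<le> Inf K" "Sup K \<le> 1" "Sup K - Inf K < d x"
      "measure lborel K = Sup K - Inf K" "K \<subseteq> G x" "x \<in> {0..1}"
    if xKp: "(x, K) \<in> p" for x K
  proof -
    obtain a b where ab: "K = cbox a b" using tagged_division_ofD(4)[OF p(1) xKp] by blast
    have xK: "x \<in> K" using tagged_division_ofD(2)[OF p(1) xKp] .
    then have "a \<le> b" using ab by auto
    then have IS: "Inf K = a" "Sup K = b" using ab by auto
    show "K = {Inf K..Sup K}" "Inf K \<le> x" "x \<le> Sup K" using IS ab xK by auto
    have "K \<subseteq> {0..1}" using tagged_division_ofD(3)[OF p(1) xKp] .
    then show "0 \<le> Inf K" "Sup K \<le> 1" "x \<in> {0..1}" using IS ab \<open>a \<le> b\<close> xK by auto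
    show KG: "K \<subseteq> G x" using p(2) xKp by (auto simp: fine_def)
    have "a \<in> ball x (d x / 2)" "b \<in> ball x (d x / 2)" using KG ab \<open>a \<le> b\<close> unfolding G_def by auto
    then show "Sup K - Inf K < d x" unfolding IS mem_ball dist_real_def by linarith
    show "measure lborel K = Sup K - Inf K" using IS ab \<open>a \<le> b\<close> by simp
  qed
  define pN where "pN = {(x, K) \<in> p. x \<in> N}"
  have pN: "pN \<subseteq> p" by (auto simp: pN_def)
  have "F 1 - F 0 = (\<Sum>(x, K)\<in>p. F (Sup K) - F (Inf K))"
    using additive_tagged_division_1[OF _ p(1), of F] by simp
  also have "\<bar>\<dots>\<bar> \<le> (\<Sum>(x, K)\<in>p. \<bar>F (Sup K) - F (Inf K)\<bar>)"
    by (rule order_trans[OF sum_abs]) (simp add: case_prod_unfold)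
  also have "\<dots> = (\<Sum>(x, K)\<in>p - pN. \<bar>F (Sup K) - F (Inf K)\<bar>) + (\<Sum>(x, K)\<in>pN. \<bar>F (Sup K) - F (Inf K)\<bar>)"
    by (rule sum.subset_diff[OF pN fin])
  also have "(\<Sum>(x, K)\<in>p - pN. \<bar>F (Sup K) - F (Inf K)\<bar>) \<le> I + 2 * e"
  proof -
    have "(\<Sum>(x, K)\<in>p - pN. \<bar>F (Sup K) - F (Inf K)\<bar>) \<le> (\<Sum>(x, K)\<in>p - pN. (f x + e) * measure lborel K)"
    proof (rule sum_mono, safe)
      fix x K assume xK: "(x, K) \<in> p" "(x, K) \<notin> pN"
      have "x \<in> {0..1} - N" using xK K(9)[OF xK(1)] by (auto simp: pN_def)
      then show "\<bar>F (Sup K) - F (Inf K)\<bar> \<le> (f x + e) * measure lborel K"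
        unfolding K(7)[OF xK(1)] by (rule dout) (use K(2-6)[OF xK(1)] in auto)
    qed
    also have "\<dots> \<le> (\<Sum>(x, K)\<in>p. (f x + e) * measure lborel K)"
      by (rule sum_mono2[OF fin]) (use f0 e in \<open>auto intro!: mult_nonneg_nonneg add_nonneg_nonneg\<close>)
    also have "\<dots> = (\<Sum>(x, K)\<in>p. measure lborel K *\<^sub>R f x) + e * (\<Sum>(x, K)\<in>p. measure lborel K)"
      by (simp add: case_prod_unfold sum_distrib_left sum.distrib[symmetric] algebra_simps)
    also have "(\<Sum>(x, K)\<in>p. measure lborel K) = 1"
      using additive_content_tagged_division[of p 0 1] p(1) by simp
    also have "(\<Sum>(x, K)\<in>p. measure lborel K *\<^sub>R f x) \<le> I + e"
    proof -
      have "G0 fine p" using p(2) by (auto simp: fine_def G_def)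
      from G0I[THEN spec, THEN mp, OF conjI, OF p(1) this] show ?thesis by simp
    qed
    finally show ?thesis by simp
  qed
  also have "(\<Sum>(x, K)\<in>pN. \<bar>F (Sup K) - F (Inf K)\<bar>) \<le> C * e"
  proof -
    \<comment> \<open>Degenerate intervals contribute nothing. The remaining ones have nonempty
      disjoint interiors, which makes \<open>E\<close> injective and yields an admissible family for
      absolute continuity.\<close>
    define q where "q = {(x, K) \<in> pN. Inf K < Sup K}"
    have q: "q \<subseteq> pN" by (auto simp: q_def)
    have finq: "finite q" using finite_subset[OF _ fin] q pN by blast
    define E where "E = (\<lambda>(x::real, K::real set). (Inf K, Sup K))"
    have disj: "{Inf K<..<Sup K} \<inter> {Inf K'<..<Sup K'} = {}"
      if "(x, K) \<in> p" "(x', K') \<in> p" "(x, K) \<noteq> (x', K')" for x K x' K'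
    proof -
      have "interior K \<inter> interior K' = {}" using tagged_division_ofD(5)[OF p(1) that] .
      then show ?thesis using K(1)[OF that(1)] K(1)[OF that(2)] by (metis interior_atLeastAtMost_real)
    qed
    have inj: "inj_on E q"
    proof (rule inj_onI, clarsimp simp: E_def)
      fix x K x' K' assume a: "(x, K) \<in> q" "(x', K') \<in> q" "Inf K = Inf K'" "Sup K = Sup K'"
      have "{Inf K<..<Sup K} \<noteq> {}" using a(1) by (auto simp: q_def)
      then show "x = x' \<and> K = K'" using disj[of x K x' K'] a q pN by auto
    qed
    have dfam: "disjoint_family_on (\<lambda>(a, b). {a<..<b}) (E ` q)"
      unfolding disjoint_family_on_def
    proof (intro ballI impI)
      fix m n assume "m \<in> E ` q" "n \<in> E ` q" "m \<noteq> n"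
      then obtain x K x' K' where a: "(x, K) \<in> q" "(x', K') \<in> q" "m = (Inf K, Sup K)" "n = (Inf K', Sup K')"
        by (auto simp: E_def)
      with \<open>m \<noteq> n\<close> have "(x, K) \<noteq> (x', K')" by auto
      then show "(case m of (a, b) \<Rightarrow> {a<..<b}) \<inter> (case n of (a, b) \<Rightarrow> {a<..<b}) = {}"
        using disj[of x K x' K'] a q pN by auto
    qed
    have len: "(\<Sum>(a, b)\<in>E ` q. b - a) < \<delta>"
    proof -
      have "(\<Sum>(a, b)\<in>E ` q. b - a) = (\<Sum>m\<in>E ` q. measure lebesgue (case m of (a, b) \<Rightarrow> {a<..<b}))"
        by (rule sum.cong) (auto simp: E_def q_def)
      also have "\<dots> = measure lebesgue (\<Union>m\<in>E ` q. case m of (a, b) \<Rightarrow> {a<..<b})"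
        using dfam finq
        by (intro measure_UNION'[symmetric]) (auto simp: pairwise_def disjoint_family_on_def disjnt_def split: prod.splits)
      also have "\<dots> \<le> measure lebesgue T"
      proof (rule measure_mono_fmeasurable)
        show "(\<Union>m\<in>E ` q. case m of (a, b) \<Rightarrow> {a<..<b}) \<subseteq> T"
        proof (clarsimp simp: E_def)
          fix y x K assume a: "(x, K) \<in> q" "Inf K < y" "y < Sup K"
          then have xp: "(x, K) \<in> p" "x \<in> N" by (auto simp: q_def pN_def)
          have "y \<in> K" using a K(1)[OF xp(1)] by (metis atLeastAtMost_iff less_imp_le)
          then show "y \<in> T" using K(8)[OF xp(1)] xp(2) by (auto simp: G_def)
        qed
        show "(\<Union>m\<in>E ` q. case m of (a, b) \<Rightarrow> {a<..<b}) \<in> sets lebesgue"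
          by (intro sets.finite_UN) (auto simp: finq split: prod.splits)
      qed (rule T(3))
      finally show ?thesis using T(4) by simp
    qed
    have "(\<Sum>(x, K)\<in>pN. \<bar>F (Sup K) - F (Inf K)\<bar>) = (\<Sum>(x, K)\<in>q. \<bar>F (Sup K) - F (Inf K)\<bar>)"
    proof (rule sum.mono_neutral_right[OF finite_subset[OF pN fin] q], safe)
      fix x K assume a: "(x, K) \<in> pN" "(x, K) \<notin> q"
      then have "Inf K = Sup K" using K(2,3)[of x K] pN by (force simp: q_def)
      then show "\<bar>F (Sup K) - F (Inf K)\<bar> = 0" by simp
    qed
    also have "\<dots> \<le> (\<Sum>(x, K)\<in>q. C * norm (\<gamma> (Sup K) - \<gamma> (Inf K)))"
    proof (rule sum_mono, safe)
      fix x K assume a: "(x, K) \<in> q"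
      then have xp: "(x, K) \<in> p" "x \<in> N" by (auto simp: q_def pN_def)
      show "\<bar>F (Sup K) - F (Inf K)\<bar> \<le> C * norm (\<gamma> (Sup K) - \<gamma> (Inf K))"
        by (rule dinn[of x]) (use K(2-6,9)[OF xp(1)] xp(2) in auto)
    qed
    also have "\<dots> = C * (\<Sum>(a, b)\<in>E ` q. norm (\<gamma> b - \<gamma> a))"
      by (subst sum.reindex[OF inj]) (simp add: sum_distrib_left E_def case_prod_unfold)
    also have "\<dots> \<le> C * e"
    proof (rule mult_left_mono[OF less_imp_le C])
      show "(\<Sum>(a, b)\<in>E ` q. norm (\<gamma> b - \<gamma> a)) < e"
      proof (rule \<delta>2[OF _ _ dfam len])
        show "\<forall>(a, b)\<in>E ` q. a \<le> b \<and> {a..b} \<subseteq> {0..1}"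
        proof (clarsimp simp: E_def)
          fix x K assume "(x, K) \<in> q"
          then have xp: "(x, K) \<in> p" by (auto simp: q_def pN_def)
          show "Inf K \<le> Sup K \<and> (Inf K \<le> Sup K \<longrightarrow> 0 \<le> Inf K \<and> Sup K \<le> 1)"
            using K(2-5)[OF xp] by auto
        qed
      qed (use finq in simp)
    qed
    finally show ?thesis .
  qed
  finally have "\<bar>F 1 - F 0\<bar> \<le> I + (C + 2) * e" by (simp add: algebra_simps)
  also have "(C + 2) * e = e0" using C by (simp add: e_def)
  finally show "\<bar>F 1 - F 0\<bar> \<le> I + e0" .
qed

lemma abs_continuous_imp_continuous:
  assumes "abs_continuous_on {0..1} \<gamma>" shows "continuous_on {0..1} \<gamma>"
  unfolding continuous_on_iff
proof (intro ballI allI impI)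
  fix x e :: real assume x: "x \<in> {0..1}" and e: "e > 0"
  obtain d where d: "d > 0" and dI: "\<forall>J. finite J \<and> (\<forall>(a, b)\<in>J. a \<le> b \<and> {a..b} \<subseteq> {0..1}) \<and>
      disjoint_family_on (\<lambda>(a, b). {a<..<b}) J \<and> (\<Sum>(a, b)\<in>J. b - a) < d \<longrightarrow>
      (\<Sum>(a, b)\<in>J. norm (\<gamma> b - \<gamma> a)) < e"
    using assms[unfolded abs_continuous_on_def, THEN spec, THEN mp, OF e] by (elim exE conjE) (rule that)
  have one: "norm (\<gamma> b - \<gamma> a) < e" if "a \<in> {0..1}" "b \<in> {0..1}" "a \<le> b" "b - a < d" for a b
    using dI[THEN spec, of "{(a, b)}"] that by (simp add: disjoint_family_on_def)
  have "dist (\<gamma> y) (\<gamma> x) < e" if "y \<in> {0..1}" "dist y x < d" for y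
    using one[of x y] one[of y x] x that by (cases "x \<le> y") (auto simp: dist_norm norm_minus_commute dist_real_def)
  with d show "\<exists>d>0. \<forall>y\<in>{0..1}. dist y x < d \<longrightarrow> dist (\<gamma> y) (\<gamma> x) < e" by blast
qed

text \<open>The increment is split at \<open>x\<close>; since \<open>x\<close> lies between
  \<open>u\<close> and \<open>v\<close>, the two distances add up to \<open>v - u\<close>.\<close>

lemma vector_derivative_straddle:
  assumes d: "(\<gamma> has_vector_derivative D) (at x within S)" and e: "(e::real) > 0"
  obtains d where "d > 0" "\<And>u v. u \<in> S \<Longrightarrow> v \<in> S \<Longrightarrow> u \<le> x \<Longrightarrow> x \<le> v \<Longrightarrow> v - u < d \<Longrightarrow>
    norm (\<gamma> v - \<gamma> u) \<le> (norm D + e) * (v - u)"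
proof -
  obtain d where d: "d > 0" "\<And>y. y \<in> S \<Longrightarrow> norm (y - x) < d \<Longrightarrow>
      norm (\<gamma> y - \<gamma> x - (y - x) *\<^sub>R D) \<le> e * norm (y - x)"
    using assms unfolding has_vector_derivative_def has_derivative_within_alt by blast
  have one: "norm (\<gamma> y - \<gamma> x) \<le> (norm D + e) * \<bar>y - x\<bar>" if "y \<in> S" "\<bar>y - x\<bar> < d" for y
  proof -
    have "norm (\<gamma> y - \<gamma> x) \<le> norm (\<gamma> y - \<gamma> x - (y - x) *\<^sub>R D) + norm ((y - x) *\<^sub>R D)"
      using norm_triangle_ineq[of "\<gamma> y - \<gamma> x - (y - x) *\<^sub>R D" "(y - x) *\<^sub>R D"] by simp
    also have "\<dots> \<le> e * \<bar>y - x\<bar> + \<bar>y - x\<bar> * norm D" using d(2)[of y] that by simp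
    finally show ?thesis by (simp add: algebra_simps)
  qed
  show ?thesis
  proof (rule that[OF d(1)])
    fix u v assume uv: "u \<in> S" "v \<in> S" "u \<le> x" "x \<le> v" "v - u < d"
    have "norm (\<gamma> v - \<gamma> u) \<le> norm (\<gamma> v - \<gamma> x) + norm (\<gamma> u - \<gamma> x)"
      using norm_triangle_ineq4[of "\<gamma> v - \<gamma> x" "\<gamma> u - \<gamma> x"] by simp
    also have "\<dots> \<le> (norm D + e) * \<bar>v - x\<bar> + (norm D + e) * \<bar>u - x\<bar>"
      using uv by (intro add_mono one) auto
    also have "\<dots> = (norm D + e) * (v - u)" using uv by (simp add: algebra_simps)
    finally show "norm (\<gamma> v - \<gamma> u) \<le> (norm D + e) * (v - u)" .
  qed
qed

text \<open>Writing the derivative as a limit of a sequence provides both a measurable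
  representative and its membership in the closed subspace \<open>h0\<close>. The minimum keeps all
  terms inside the domain.\<close>

lemma vector_derivative_quotients:
  assumes d: "(\<gamma> has_vector_derivative D) (at x within {0..1})" and x: "0 \<le> x" "x < 1"
  shows "(\<lambda>n. real (Suc n) *\<^sub>R (\<gamma> (min 1 (x + 1 / real (Suc n))) - \<gamma> x)) \<longlonglongrightarrow> D"
proof (rule LIMSEQ_I)
  fix e :: real assume e: "e > 0"
  then have "e / 2 > 0" by simp
  then obtain d where d: "d > 0" "\<And>y. y \<in> {0..1} \<Longrightarrow> norm (y - x) < d \<Longrightarrow>
      norm (\<gamma> y - \<gamma> x - (y - x) *\<^sub>R D) \<le> e / 2 * norm (y - x)"
    using d unfolding has_vector_derivative_def has_derivative_within_alt by blast
  have lim0: "(\<lambda>n. 1 / real (Suc n)) \<longlonglongrightarrow> 0" by (rule LIMSEQ_inverse_real_of_nat[unfolded inverse_eq_divide])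
  have "min d (1 - x) > 0" using d(1) x by simp
  from order_tendstoD(2)[OF lim0 this]
  obtain n0 where n0: "\<And>n. n \<ge> n0 \<Longrightarrow> 1 / real (Suc n) < min d (1 - x)"
    unfolding eventually_sequentially by blast
  have "norm (real (Suc n) *\<^sub>R (\<gamma> (min 1 (x + 1 / real (Suc n))) - \<gamma> x) - D) < e" if n: "n \<ge> n0" for n
  proof -
    define \<eta> where "\<eta> = 1 / real (Suc n)"
    have \<eta>: "\<eta> > 0" "\<eta> < d" "x + \<eta> \<le> 1" "real (Suc n) = 1 / \<eta>" using n0[OF n] by (auto simp: \<eta>_def)
    have b: "norm (\<gamma> (x + \<eta>) - \<gamma> x - \<eta> *\<^sub>R D) \<le> e / 2 * \<eta>"
      using d(2)[of "x + \<eta>"] \<eta> x by simp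
    have "(1 / \<eta>) *\<^sub>R (\<gamma> (x + \<eta>) - \<gamma> x) - D = (1 / \<eta>) *\<^sub>R (\<gamma> (x + \<eta>) - \<gamma> x - \<eta> *\<^sub>R D)"
      using \<eta>(1) by (simp add: scaleR_diff_right)
    then have "norm ((1 / \<eta>) *\<^sub>R (\<gamma> (x + \<eta>) - \<gamma> x) - D) = (1 / \<eta>) * norm (\<gamma> (x + \<eta>) - \<gamma> x - \<eta> *\<^sub>R D)"
      using \<eta>(1) by simp
    also have "\<dots> \<le> (1 / \<eta>) * (e / 2 * \<eta>)" using \<eta>(1) by (intro mult_left_mono b) simp
    also have "\<dots> < e" using \<eta>(1) e by simp
    finally show ?thesis unfolding \<eta>(4) \<eta>_def[symmetric] using \<eta>(3) by (simp add: min_absorb2)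
  qed
  then show "\<exists>no. \<forall>n\<ge>no. norm (real (Suc n) *\<^sub>R (\<gamma> (min 1 (x + 1 / real (Suc n))) - \<gamma> x) - D) < e" by blast
qed

text \<open>If the length is finite, it is the integral of \<open>\<omega> t * norm (g t)\<close>,
  and this function bounds the local growth of the calibration at every time outside a null set.
  \<open>abs_continuous_gauge_bound\<close> turns that into a global bound.\<close>

lemma weighted_length_lower_bound:
  fixes \<gamma> \<gamma>' :: "real \<Rightarrow> cmat5"
  assumes h: "h > 0" and \<gamma>: "\<gamma> ` {0..1} \<subseteq> h0" "abs_continuous_on {0..1} \<gamma>"
    and der: "AE t in lborel. t \<in> {0..1} \<longrightarrow> (\<gamma> has_vector_derivative \<gamma>' t) (at t within {0..1})"
  shows "ennreal (calibration \<mu> h (\<gamma> 1) - calibration \<mu> h (\<gamma> 0))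
    \<le> 2 * (\<integral>\<^sup>+t\<in>{0..1}. ennreal (sqrt (crit_potential \<mu> h (\<gamma> t)) * frob_norm (\<gamma>' t)) \<partial>lborel)"
    (is "_ \<le> 2 * ?L")
proof (cases "?L = \<infinity>")
  case False
  define \<beta> where "\<beta> t = \<gamma> (max 0 (min 1 t))" for t
  have \<beta>h: "\<beta> t \<in> h0" for t using \<gamma>(1) by (auto simp: \<beta>_def)
  have \<beta>\<gamma>: "\<beta> t = \<gamma> t" if "t \<in> {0..1}" for t using that by (simp add: \<beta>_def)
  have \<beta>c: "continuous_on UNIV \<beta>" unfolding \<beta>_def
    by (rule continuous_on_compose2[OF abs_continuous_imp_continuous[OF \<gamma>(2)]]) (auto intro!: continuous_intros)
  have [measurable]: "\<beta> \<in> borel_measurable borel" by (rule borel_measurable_continuous_onI[OF \<beta>c])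
  define \<omega> where "\<omega> t = 2 * sqrt (crit_potential \<mu> h (\<beta> t))" for t
  have \<omega>c: "continuous_on UNIV \<omega>" unfolding \<omega>_def
    by (intro continuous_intros continuous_on_compose2[OF continuous_crit_potential \<beta>c]) auto
  have [measurable]: "\<omega> \<in> borel_measurable borel" by (rule borel_measurable_continuous_onI[OF \<omega>c])
  have \<omega>0: "\<omega> t \<ge> 0" for t using crit_potential_nonneg[OF h \<beta>h] by (simp add: \<omega>_def)
  define Dq where "Dq n t = real (Suc n) *\<^sub>R (\<beta> (t + 1 / real (Suc n)) - \<beta> t)" for n t
  have [measurable]: "Dq n \<in> borel_measurable borel" for n unfolding Dq_def by measurable
  \<comment> \<open>The given \<open>\<gamma>'\<close> is determined almost everywhere only and need
    not be measurable; this limit is a measurable representative.\<close>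
  define g where "g t = lim (\<lambda>n. Dq n t)" for t
  have [measurable]: "g \<in> borel_measurable borel" unfolding g_def by measurable
  \<comment> \<open>Time 1 counts as exceptional, since \<open>\<beta>\<close> is constant beyond it
    and forward quotients miss the derivative there.\<close>
  define good where "good t \<longleftrightarrow> (t \<in> {0..1} \<longrightarrow> t < 1 \<and> (\<gamma> has_vector_derivative g t) (at t within {0..1}) \<and> g t = \<gamma>' t)" for t
  have "AE t in lborel. good t"
    using der AE_lborel_singleton[of 1]
  proof eventually_elim
    case (elim t)
    show ?case
    proof (cases "t \<in> {0..1}")
      case True
      then have t: "0 \<le> t" "t < 1" and d: "(\<gamma> has_vector_derivative \<gamma>' t) (at t within {0..1})" using elim by auto
      have "(\<lambda>n. Dq n t) \<longlonglongrightarrow> \<gamma>' t"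
        using vector_derivative_quotients[OF d t] t by (simp add: Dq_def \<beta>_def)
      then have "g t = \<gamma>' t" unfolding g_def by (rule limI)
      with d t show ?thesis by (simp add: good_def)
    next
      case False
      then show ?thesis unfolding good_def by blast
    qed
  qed
  then obtain N where N: "{t. \<not> good t} \<subseteq> N" "emeasure lborel N = 0" "N \<in> sets lborel"
    by (auto elim: AE_E)
  have negN: "negligible N"
    using N(2,3) by (simp add: negligible_iff_null_sets null_sets_def)
  define f where "f t = indicator {0..1} t * (\<omega> t * norm (g t))" for t
  have fm[measurable]: "f \<in> borel_measurable borel" unfolding f_def by measurable
  have f0: "f t \<ge> 0" for t using \<omega>0 by (auto simp: f_def indicator_def)
  have sb: "(\<lambda>t. ennreal (f t)) \<in> borel_measurable lborel" by measurable
  have "(\<integral>\<^sup>+t. ennreal (f t) \<partial>lborel) = (\<integral>\<^sup>+t. ennreal 2 * ennreal (f t / 2) \<partial>lborel)"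
  proof (rule nn_integral_cong)
    fix t
    have "ennreal (2 * (f t / 2)) = ennreal 2 * ennreal (f t / 2)" by (rule ennreal_mult) (simp_all add: f0)
    then show "ennreal (f t) = ennreal 2 * ennreal (f t / 2)" by simp
  qed
  also have "\<dots> = ennreal 2 * (\<integral>\<^sup>+t. ennreal (f t / 2) \<partial>lborel)"
    by (rule nn_integral_cmult) measurable
  also have "(\<integral>\<^sup>+t. ennreal (f t / 2) \<partial>lborel) = ?L"
  proof (rule nn_integral_cong_AE)
    show "AE t in lborel. ennreal (f t / 2) = ennreal (sqrt (crit_potential \<mu> h (\<gamma> t)) * frob_norm (\<gamma>' t)) * indicator {0..1} t"
      using \<open>AE t in lborel. good t\<close>
    proof eventually_elim
      case (elim t)
      show ?case
      proof (cases "t \<in> {0..1}")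
        case True
        then have d: "(\<gamma> has_vector_derivative \<gamma>' t) (at t within {0..1})" and gt: "g t = \<gamma>' t" and t1: "t < 1"
          using elim by (auto simp: good_def)
        have "\<gamma>' t \<in> h0"
        proof -
          have lim: "(\<lambda>n. real (Suc n) *\<^sub>R (\<gamma> (min 1 (t + 1 / real (Suc n))) - \<gamma> t)) \<longlonglongrightarrow> \<gamma>' t"
            using vector_derivative_quotients[OF d _ t1] True by simp
          have mem: "real (Suc n) *\<^sub>R (\<gamma> (min 1 (t + 1 / real (Suc n))) - \<gamma> t) \<in> h0" for n
            using True \<gamma>(1) by (intro subspace_scale subspace_diff h0_subspace) (auto simp: image_subset_iff)
          show ?thesis by (rule closed_sequentially[OF closed_subspace[OF h0_subspace] mem lim])
        qed
        then have "frob_norm (\<gamma>' t) = norm (\<gamma>' t)" by (rule frob_norm_eq_norm)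
        then show ?thesis using True by (simp add: f_def gt \<omega>_def \<beta>\<gamma>)
      qed (simp add: f_def)
    qed
  qed
  finally have nn: "(\<integral>\<^sup>+t. ennreal (f t) \<partial>lborel) = 2 * ?L" by simp
  have "2 * ?L < \<infinity>"
    unfolding infinity_ennreal_def ennreal_mult_less_top using False by (simp add: less_top[symmetric])
  with nn have fin: "(\<integral>\<^sup>+t. ennreal (f t) \<partial>lborel) < \<infinity>" by (rule ssubst)
  have fint: "integrable lborel f" by (rule integrableI_nonneg) (use f0 fin in auto)
  define I where "I = (LINT t|lborel. f t)"
  have I: "2 * ?L = ennreal I"
    unfolding nn[symmetric] I_def by (rule nn_integral_eq_integral[OF fint]) (simp add: f0)
  have "f = (\<lambda>t. if t \<in> {0..1} then f t else 0)" by (auto simp: f_def)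
  then have hI: "(f has_integral I) {0..1}"
    using has_integral_integral_lborel[OF fint] has_integral_restrict_UNIV[of "{0..1}" f I] by (simp add: I_def)
  have "compact (\<omega> ` {0..1})" by (intro compact_continuous_image continuous_on_subset[OF \<omega>c]) auto
  then have "bounded (\<omega> ` {0..1})" by (rule compact_imp_bounded)
  then obtain M where "\<forall>x\<in>{0..1}. \<bar>\<omega> x\<bar> \<le> M" by (auto simp: bounded_iff)
  then have M: "\<omega> x \<le> M" "M \<ge> 0" if "x \<in> {0..1}" for x using that by force+
  define F where "F t = calibration \<mu> h (\<gamma> t)" for t
  have close: "\<exists>d>0. \<forall>u v. 0 \<le> u \<and> u \<le> x \<and> x \<le> v \<and> v \<le> 1 \<and> v - u < d \<longrightarrow> \<bar>F v - F u\<bar> \<le> (\<omega> x + e) * norm (\<gamma> v - \<gamma> u)"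
    if x: "x \<in> {0..1}" and e: "e > 0" for x e
  proof -
    obtain r where r: "r > 0" "\<And>X Y. X \<in> h0 \<Longrightarrow> Y \<in> h0 \<Longrightarrow> norm (X - \<beta> x) < r \<Longrightarrow> norm (Y - \<beta> x) < r \<Longrightarrow>
      \<bar>calibration \<mu> h X - calibration \<mu> h Y\<bar> \<le> (2 * sqrt (crit_potential \<mu> h (\<beta> x)) + e) * norm (X - Y)"
      by (rule calibration_local[OF h \<beta>h[of x] e, of \<mu>]) blast
    have "isCont \<beta> x" using \<beta>c by (auto simp: continuous_on_eq_continuous_at)
    then obtain d where d: "d > 0" "\<And>z. dist z x < d \<Longrightarrow> dist (\<beta> z) (\<beta> x) < r"
      using r(1) unfolding continuous_at_eps_delta by blast
    show ?thesis
    proof (intro exI[of _ d] conjI d(1) allI impI)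
      fix u v assume uv: "0 \<le> u \<and> u \<le> x \<and> x \<le> v \<and> v \<le> 1 \<and> v - u < d"
      have uv01: "u \<in> {0..1}" "v \<in> {0..1}" using uv by auto
      have "dist u x < d" "dist v x < d" using uv by (auto simp: dist_real_def)
      then have "norm (\<beta> u - \<beta> x) < r" "norm (\<beta> v - \<beta> x) < r" using d(2) by (auto simp: dist_norm)
      from r(2)[OF \<beta>h \<beta>h this(2,1)]
      show "\<bar>F v - F u\<bar> \<le> (\<omega> x + e) * norm (\<gamma> v - \<gamma> u)"
        unfolding F_def \<omega>_def \<beta>\<gamma>[OF uv01(1)] \<beta>\<gamma>[OF uv01(2)] .
    qed
  qed
  have "\<bar>F 1 - F 0\<bar> \<le> I"
  \<comment> \<open>On the null set a uniform Lipschitz constant is enough: \<open>M\<close> bounds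
    \<open>\<omega>\<close>, and 1 is the slack in the local estimate.\<close>
  proof (rule abs_continuous_gauge_bound[OF \<gamma>(2) hI f0 negN, of "M + 1"])
    show "0 \<le> M + 1" using M(2)[of 0] by simp
    fix x
    assume x: "x \<in> {0..1} \<inter> N"
    obtain d where d: "d > 0" "\<And>u v. 0 \<le> u \<and> u \<le> x \<and> x \<le> v \<and> v \<le> 1 \<and> v - u < d \<Longrightarrow> \<bar>F v - F u\<bar> \<le> (\<omega> x + 1) * norm (\<gamma> v - \<gamma> u)"
      using close[of x 1] x by auto
    have "(\<omega> x + 1) * norm (\<gamma> v - \<gamma> u) \<le> (M + 1) * norm (\<gamma> v - \<gamma> u)" for u v
      using M(1)[of x] x by (intro mult_right_mono) auto
    with d show "\<exists>d>0. \<forall>u v. 0 \<le> u \<and> u \<le> x \<and> x \<le> v \<and> v \<le> 1 \<and> v - u < d \<longrightarrow> \<bar>F v - F u\<bar> \<le> (M + 1) * norm (\<gamma> v - \<gamma> u)"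
      by (meson order_trans)
  next
    fix x e :: real assume x: "x \<in> {0..1} - N" and e: "e > 0"
    have d: "(\<gamma> has_vector_derivative g x) (at x within {0..1})" using x N(1) by (auto simp: good_def)
    define S where "S = \<omega> x + norm (g x) + 1"
    have S: "S > 0" using \<omega>0[of x] by (simp add: S_def add_nonneg_pos)
    \<comment> \<open>Chosen so that expanding the product of the two perturbed factors costs at
      most \<open>e1 * S\<close>, hence at most \<open>e\<close>.\<close>
    define e1 where "e1 = min 1 (e / S)"
    have e1: "e1 > 0" "e1 \<le> 1" "e1 * S \<le> e" using e S by (auto simp: e1_def min_def field_simps)
    obtain d1 where d1: "d1 > 0" "\<And>u v. 0 \<le> u \<and> u \<le> x \<and> x \<le> v \<and> v \<le> 1 \<and> v - u < d1 \<Longrightarrow> \<bar>F v - F u\<bar> \<le> (\<omega> x + e1) * norm (\<gamma> v - \<gamma> u)"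
      using close[of x e1] x e1 by auto
    obtain d2 where d2: "d2 > 0" "\<And>u v. u \<in> {0..1} \<Longrightarrow> v \<in> {0..1} \<Longrightarrow> u \<le> x \<Longrightarrow> x \<le> v \<Longrightarrow> v - u < d2 \<Longrightarrow>
        norm (\<gamma> v - \<gamma> u) \<le> (norm (g x) + e1) * (v - u)"
      by (rule vector_derivative_straddle[OF d e1(1)]) blast
    have coeff: "(\<omega> x + e1) * (norm (g x) + e1) \<le> f x + e"
    proof -
      have "(\<omega> x + e1) * (norm (g x) + e1) = \<omega> x * norm (g x) + e1 * (\<omega> x + norm (g x) + e1)"
        by (simp add: algebra_simps)
      also have "\<dots> \<le> \<omega> x * norm (g x) + e1 * S" using e1 by (simp add: S_def)
      also have "\<dots> \<le> f x + e" using e1(3) x by (simp add: f_def)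
      finally show ?thesis .
    qed
    show "\<exists>d>0. \<forall>u v. 0 \<le> u \<and> u \<le> x \<and> x \<le> v \<and> v \<le> 1 \<and> v - u < d \<longrightarrow> \<bar>F v - F u\<bar> \<le> (f x + e) * (v - u)"
    proof (intro exI[of _ "min d1 d2"] conjI allI impI)
      fix u v assume uv: "0 \<le> u \<and> u \<le> x \<and> x \<le> v \<and> v \<le> 1 \<and> v - u < min d1 d2"
      have "\<bar>F v - F u\<bar> \<le> (\<omega> x + e1) * norm (\<gamma> v - \<gamma> u)" using uv by (intro d1(2)) auto
      also have "\<dots> \<le> (\<omega> x + e1) * ((norm (g x) + e1) * (v - u))"
        using uv \<omega>0[of x] e1 by (intro mult_left_mono d2(2)) auto
      also have "\<dots> \<le> (f x + e) * (v - u)"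
        using mult_right_mono[OF coeff, of "v - u"] uv by (simp add: mult.assoc)
      finally show "\<bar>F v - F u\<bar> \<le> (f x + e) * (v - u)" .
    qed (use d1 d2 in simp)
  qed
  then show ?thesis unfolding I F_def by (intro ennreal_leI) linarith
qed simp


section \<open>The kink and the minimal energy\<close>

definition kink_energy :: "real \<Rightarrow> real \<Rightarrow> real" where
  "kink_energy \<mu> h = 9 * sqrt 2 * \<mu> ^ 3 / (10 * h)"

lemma kink_amp_powers:
  assumes "h > 0"
  shows "h * (kink_amp \<mu> h)\<^sup>2 = 9 * \<mu>\<^sup>2 / 400" "sqrt h * (kink_amp \<mu> h)^3 = 27 * \<mu>^3 / (8000 * h)"
proof -
  have s: "sqrt h * sqrt h = h" "sqrt h > 0" using assms by simp_all
  show "h * (kink_amp \<mu> h)\<^sup>2 = 9 * \<mu>\<^sup>2 / 400"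
    using assms by (simp add: kink_amp_def power_divide power_mult_distrib)
  have "sqrt h * (kink_amp \<mu> h)^3 = 27 * \<mu>^3 / (8000 * (sqrt h * sqrt h))"
    using s(2) by (simp add: kink_amp_def power3_eq_cube field_simps)
  then show "sqrt h * (kink_amp \<mu> h)^3 = 27 * \<mu>^3 / (8000 * h)" by (simp only: s(1))
qed

text \<open>\<open>kink_coord\<close> depends on the spectrum alone and is constant on each orbit,
  so one value serves all pairs of endpoints.\<close>

lemma calibration_Sigma_diff:
  assumes h: "h > 0" and A: "A \<in> Sigma_minus \<mu> h" and B: "B \<in> Sigma_plus \<mu> h"
  shows "calibration \<mu> h B - calibration \<mu> h A = kink_energy \<mu> h"
proof -
  define c where "c = kink_amp \<mu> h"
  have "sqrt 30 * sqrt (2000/3 * h) = sqrt (10000 * 2 * h)" unfolding real_sqrt_mult[symmetric] by simp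
  also have "\<dots> = sqrt 10000 * sqrt 2 * sqrt h" by (simp only: real_sqrt_mult)
  also have "sqrt 10000 = 100" using real_sqrt_unique[of 100 10000] by simp
  finally have s: "sqrt 30 * sqrt (2000/3 * h) = 100 * sqrt 2 * sqrt h" .
  have "calibration \<mu> h B - calibration \<mu> h A = sqrt 30 * sqrt (2000/3 * h) * (8/3 * c^3)"
    unfolding calibration_def Let_def kink_coord_Sigma(1)[OF B] kink_coord_Sigma(2)[OF A] c_def[symmetric]
    by (simp add: power2_eq_square power3_eq_cube field_simps)
  also have "\<dots> = 800/3 * sqrt 2 * (sqrt h * c^3)" unfolding s by simp
  also have "\<dots> = kink_energy \<mu> h" unfolding c_def kink_amp_powers(2)[OF h] kink_energy_def by simp
  finally show ?thesis .
qed

text \<open>The increment of \<open>W\<close> over any bounded interval is at most the energy,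
  because the density dominates \<open>2 * sqrt V * norm g\<close>. The intervals from -t to t
  exhaust the line, and continuity of the calibration on \<open>h0\<close> yields its values at the
  two limits.\<close>

lemma energy_lower_bound:
  assumes h: "h > 0" and \<Psi>: "\<Psi> \<in> connecting_sets (crit_potential \<mu> h) (Sigma_minus \<mu> h) (Sigma_plus \<mu> h)"
  shows "kink_energy \<mu> h \<le> energy (crit_potential \<mu> h) \<Psi>"
proof -
  obtain A B where A: "A \<in> Sigma_minus \<mu> h" and B: "B \<in> Sigma_plus \<mu> h" and c: "\<Psi> \<in> connecting (crit_potential \<mu> h) A B"
    using \<Psi> by (auto simp: connecting_sets_def)
  define g where "g = weak_deriv \<Psi>"
  have cont: "continuous_on UNIV \<Psi>" and lims: "(\<Psi> \<longlongrightarrow> A) at_bot" "(\<Psi> \<longlongrightarrow> B) at_top"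
    and ex: "\<exists>g. has_weak_derivative \<Psi> g"
    and int: "integrable lborel (\<lambda>z. (frob_norm (g z))\<^sup>2)" "integrable lborel (\<lambda>z. crit_potential \<mu> h (\<Psi> z))"
    using c by (auto simp: connecting_def H1_loc_def g_def)
  have w: "has_weak_derivative \<Psi> g" unfolding g_def weak_deriv_def using ex by (rule someI_ex)
  have \<Psi>h: "range \<Psi> \<subseteq> h0" and gL: "g \<in> L2_loc" using w by (auto simp: has_weak_derivative_def L2_loc_def)
  have gm[measurable]: "g \<in> borel_measurable borel" using gL by (simp add: L2_loc_def)
  have V0: "crit_potential \<mu> h (\<Psi> z) \<ge> 0" for z using \<Psi>h by (intro crit_potential_nonneg h) auto
  define W where "W z = calibration \<mu> h (\<Psi> z)" for z
  define e where "e z = (frob_norm (g z))\<^sup>2 + crit_potential \<mu> h (\<Psi> z)" for z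
  have eint: "integrable lborel e" unfolding e_def by (rule Bochner_Integration.integrable_add[OF int])
  have E: "energy (crit_potential \<mu> h) \<Psi> = (LINT z|lborel. e z)" by (simp add: energy_def e_def g_def)
  have bd: "2 * sqrt (crit_potential \<mu> h (\<Psi> z)) * norm (g z) \<le> e z" for z
  proof -
    have "2 * sqrt (crit_potential \<mu> h (\<Psi> z)) * norm (g z) \<le> (sqrt (crit_potential \<mu> h (\<Psi> z)))\<^sup>2 + (norm (g z))\<^sup>2"
      using sum_squares_bound[of "sqrt (crit_potential \<mu> h (\<Psi> z))" "norm (g z)"] by (simp add: power2_eq_square)
    then show ?thesis using V0[of z] by (simp add: e_def L2_loc_norm[OF gL])
  qed
  have bound: "W t - W s \<le> energy (crit_potential \<mu> h) \<Psi>" if st: "s < t" for s t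
  proof -
    have "\<bar>W t - W s\<bar> \<le> (LINT x|lborel. indicator {s<..t} x * (2 * sqrt (crit_potential \<mu> h (\<Psi> x)) * norm (g x)))"
      unfolding W_def
      by (rule calibration_path_bound[OF h cont \<Psi>h weak_derivative_FTC(1)[OF w cont] weak_derivative_FTC(2)[OF w cont]])
        (use st in simp_all)
    also have "\<dots> \<le> (LINT z|lborel. e z)"
    proof (rule integral_mono')
      show "integrable lborel e" by (rule eint)
      fix z
      show "indicator {s<..t} z * (2 * sqrt (crit_potential \<mu> h (\<Psi> z)) * norm (g z)) \<le> e z"
        using bd[of z] V0[of z] by (auto simp: indicator_def e_def)
      show "0 \<le> e z" using V0[of z] by (simp add: e_def)
    qed
    finally show ?thesis by (simp add: E)
  qed
  have h0c: "closed h0" by (rule closed_subspace[OF h0_subspace])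
  have Ah: "A \<in> h0"
    by (rule Lim_in_closed_set[OF h0c _ _ lims(1)]) (use \<Psi>h in \<open>auto simp: image_subset_iff\<close>)
  have Bh: "B \<in> h0"
    by (rule Lim_in_closed_set[OF h0c _ _ lims(2)]) (use \<Psi>h in \<open>auto simp: image_subset_iff\<close>)
  have comp: "(W \<longlongrightarrow> calibration \<mu> h Z) F" if "(\<Psi> \<longlongrightarrow> Z) F" "Z \<in> h0" for Z F
    unfolding W_def
    by (rule continuous_on_tendsto_compose[OF continuous_calibration that]) (use \<Psi>h in \<open>auto simp: image_subset_iff\<close>)
  have WA: "((\<lambda>t. W (- t)) \<longlongrightarrow> calibration \<mu> h A) at_top"
    using comp[OF lims(1) Ah] unfolding filterlim_at_bot_mirror .
  have WB: "(W \<longlongrightarrow> calibration \<mu> h B) at_top" by (rule comp[OF lims(2) Bh])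
  have "calibration \<mu> h B - calibration \<mu> h A \<le> energy (crit_potential \<mu> h) \<Psi>"
  proof (rule tendsto_upperbound[OF tendsto_diff[OF WB WA]])
    show "\<forall>\<^sub>F t in at_top. W t - W (- t) \<le> energy (crit_potential \<mu> h) \<Psi>"
      using eventually_gt_at_top[of "0::real"] by eventually_elim (rule bound, simp)
  qed simp
  then show ?thesis by (simp add: calibration_Sigma_diff[OF h A B])
qed

text \<open>With T = tanh (k z) and T' = k (1 - T^2), the integrand is the derivative of (T -
  T^3/3)/k.\<close>

lemma integral_sech4:
  assumes k: "k > (0::real)"
  shows "integrable lborel (\<lambda>z. (1 - (tanh (k * z))\<^sup>2)\<^sup>2)" "(LINT z|lborel. (1 - (tanh (k * z))\<^sup>2)\<^sup>2) = 4 / (3 * k)"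
proof -
  define F where "F z = (tanh (k * z) - (tanh (k * z))^3 / 3) / k" for z
  have top: "filterlim (\<lambda>z. k * z) at_top at_top" "filterlim (\<lambda>z. k * z) at_bot at_bot"
    by (rule filterlim_tendsto_pos_mult_at_top[OF tendsto_const k filterlim_ident],
        rule filterlim_tendsto_pos_mult_at_bot[OF tendsto_const k filterlim_ident])
  have lim: "((\<lambda>z. tanh (k * z)) \<longlongrightarrow> 1) at_top" "((\<lambda>z. tanh (k * z)) \<longlongrightarrow> -1) at_bot"
    using filterlim_compose[OF tanh_real_at_top top(1)] filterlim_compose[OF tanh_real_at_bot top(2)] by auto
  have FA: "(F \<longlongrightarrow> (1 - 1^3 / 3) / k) at_top" "(F \<longlongrightarrow> (-1 - (-1)^3 / 3) / k) at_bot"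
    unfolding F_def by (intro tendsto_intros lim; use k in simp)+
  have dF: "(F has_real_derivative (1 - (tanh (k * z))\<^sup>2)\<^sup>2) (at z)" for z
    unfolding F_def using k
    by (auto intro!: derivative_eq_intros simp: field_simps power2_eq_square)
  have "set_integrable lborel (einterval (-\<infinity>) \<infinity>) (\<lambda>z. (1 - (tanh (k * z))\<^sup>2)\<^sup>2)"
    "(LBINT z=-\<infinity>..\<infinity>. (1 - (tanh (k * z))\<^sup>2)\<^sup>2) = (1 - 1^3 / 3) / k - (-1 - (-1)^3 / 3) / k"
    by (rule interval_integral_FTC_nonneg[where F = F];
        use dF FA in \<open>auto simp: ereal_tendsto_simps intro!: continuous_intros\<close>)+
  then show "integrable lborel (\<lambda>z. (1 - (tanh (k * z))\<^sup>2)\<^sup>2)" "(LINT z|lborel. (1 - (tanh (k * z))\<^sup>2)\<^sup>2) = 4 / (3 * k)"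
    using k by (simp_all add: set_integrable_def interval_lebesgue_integral_def set_lebesgue_integral_def field_simps)
qed

lemma kink_facts:
  assumes mu: "\<mu> > 0" and h: "h > 0"
  shows "kink \<mu> h \<in> connecting_sets (crit_potential \<mu> h) (Sigma_minus \<mu> h) (Sigma_plus \<mu> h)"
    "energy (crit_potential \<mu> h) (kink \<mu> h) = kink_energy \<mu> h"
proof -
  define c where "c = kink_amp \<mu> h"
  define k where "k = \<mu> / sqrt 2"
  have c: "c > 0" using mu h by (simp add: c_def kink_amp_def)
  have k: "k > 0" "k\<^sup>2 = \<mu>\<^sup>2 / 2" using mu by (auto simp: k_def power_divide)
  define T where "T z = tanh (k * z)" for z
  define g where "g z = (k * (1 - (T z)\<^sup>2)) *\<^sub>R kink_dir \<mu> h" for z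
  have kT: "kink \<mu> h z = kink_line \<mu> h (T z)" for z by (simp add: kink_eq T_def k_def mult.commute)
  have dT: "(T has_real_derivative k * (1 - (T z)\<^sup>2)) (at z)" for z
    unfolding T_def by (auto intro!: derivative_eq_intros)
  have dk: "(kink \<mu> h has_vector_derivative g z) (at z)" for z
  proof -
    have "((kink_line \<mu> h \<circ> T) has_vector_derivative (k * (1 - (T z)\<^sup>2)) *\<^sub>R kink_dir \<mu> h) (at z)"
      by (rule vector_diff_chain_at) (use dT kink_line_derivative in \<open>auto simp: has_real_derivative_iff_has_vector_derivative\<close>)
    moreover have "kink_line \<mu> h \<circ> T = kink \<mu> h" by (simp add: fun_eq_iff kT)
    ultimately show ?thesis by (simp add: g_def)
  qed
  have Tc: "continuous_on UNIV T" unfolding T_def by (intro continuous_intros) auto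
  have gc: "continuous_on UNIV g" unfolding g_def by (intro continuous_intros Tc)
  have kc: "continuous_on UNIV (kink \<mu> h)"
    using dk by (intro continuous_at_imp_continuous_on ballI) (blast intro: has_vector_derivative_continuous)
  have hw: "has_weak_derivative (kink \<mu> h) g"
    by (rule has_weak_derivativeI[OF dk gc]) (auto simp: kT kink_line_h0 g_def intro!: subspace_scale[OF h0_subspace] kink_dir_h0)
  note wd = AE_weak_deriv[OF hw kc]
  define s where "s z = (1 - (T z)\<^sup>2)\<^sup>2" for z
  have sint: "integrable lborel s" "(LINT z|lborel. s z) = 4 / (3 * k)"
    using integral_sech4[OF k(1)] by (simp_all add: s_def[abs_def] T_def)
  have V: "crit_potential \<mu> h (kink \<mu> h z) = 15 * \<mu>\<^sup>2 * c\<^sup>2 * s z" for z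
  proof -
    have "crit_potential \<mu> h (kink \<mu> h z) = 2000/3 * (h * c\<^sup>2) * c\<^sup>2 * s z"
      unfolding kT crit_potential_kink_line[OF h] c_def s_def by (simp add: power4_eq_xxxx power2_eq_square)
    then show ?thesis unfolding c_def kink_amp_powers(1)[OF h] by simp
  qed
  \<comment> \<open>The same expression as for the potential: the two energy densities agree at
    every point, which is equality in the arithmetic-geometric mean step of the lower bound.\<close>
  have G: "(norm (g z))\<^sup>2 = 15 * \<mu>\<^sup>2 * c\<^sup>2 * s z" for z
  proof -
    have "(norm (g z))\<^sup>2 = (k * (1 - (T z)\<^sup>2))\<^sup>2 * (norm (kink_dir \<mu> h))\<^sup>2"
      by (simp add: g_def power_mult_distrib)
    also have "(norm (kink_dir \<mu> h))\<^sup>2 = 30 * c\<^sup>2"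
      using norm_kink_dir[of \<mu> h] c by (simp add: c_def power_mult_distrib)
    finally show ?thesis by (simp add: power_mult_distrib k(2) s_def)
  qed
  have wL: "weak_deriv (kink \<mu> h) \<in> L2_loc" using wd(1) by (simp add: has_weak_derivative_def)
  have fn: "frob_norm (weak_deriv (kink \<mu> h) z) = norm (weak_deriv (kink \<mu> h) z)" for z by (rule L2_loc_norm[OF wL])
  have [measurable]: "weak_deriv (kink \<mu> h) \<in> borel_measurable borel" using wL by (simp add: L2_loc_def)
  have [measurable]: "s \<in> borel_measurable borel" using sint(1) by (auto dest: borel_measurable_integrable)
  have ae: "AE z in lborel. (norm (weak_deriv (kink \<mu> h) z))\<^sup>2 = 15 * \<mu>\<^sup>2 * c\<^sup>2 * s z"
    using wd(2) by eventually_elim (simp add: G)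
  have i1: "integrable lborel (\<lambda>z. (norm (weak_deriv (kink \<mu> h) z))\<^sup>2)"
    by (subst integrable_cong_AE[OF _ _ ae]) (auto intro: sint)
  have i2: "integrable lborel (\<lambda>z. crit_potential \<mu> h (kink \<mu> h z))" unfolding V by (intro integrable_mult_right sint)
  have top: "filterlim (\<lambda>z. k * z) at_top at_top" "filterlim (\<lambda>z. k * z) at_bot at_bot"
    by (rule filterlim_tendsto_pos_mult_at_top[OF tendsto_const k(1) filterlim_ident],
        rule filterlim_tendsto_pos_mult_at_bot[OF tendsto_const k(1) filterlim_ident])
  have lim: "(T \<longlongrightarrow> 1) at_top" "(T \<longlongrightarrow> -1) at_bot"
    using filterlim_compose[OF tanh_real_at_top top(1)] filterlim_compose[OF tanh_real_at_bot top(2)]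
    by (auto simp: T_def[abs_def])
  have klim: "((\<lambda>z. kink \<mu> h z) \<longlongrightarrow> kink_line \<mu> h r) F" if "(T \<longlongrightarrow> r) F" for r F
    unfolding kT kink_line_def by (intro tendsto_intros that)
  have "kink \<mu> h \<in> connecting (crit_potential \<mu> h) (kink_line \<mu> h (- 1)) (kink_line \<mu> h 1)"
    unfolding connecting_def H1_loc_def
    using hw kc i1 i2 klim[OF lim(1)] klim[OF lim(2)] by (auto simp: fn)
  then show "kink \<mu> h \<in> connecting_sets (crit_potential \<mu> h) (Sigma_minus \<mu> h) (Sigma_plus \<mu> h)"
    unfolding connecting_sets_def using kink_line_endpoints[of \<mu> h] by blast
  have "energy (crit_potential \<mu> h) (kink \<mu> h) = (LINT z|lborel. (norm (weak_deriv (kink \<mu> h) z))\<^sup>2) + (LINT z|lborel. crit_potential \<mu> h (kink \<mu> h z))"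
    unfolding energy_def fn by (rule Bochner_Integration.integral_add[OF i1 i2])
  also have "(LINT z|lborel. (norm (weak_deriv (kink \<mu> h) z))\<^sup>2) = (LINT z|lborel. 15 * \<mu>\<^sup>2 * c\<^sup>2 * s z)"
    by (rule integral_cong_AE[OF _ _ ae]) measurable
  also have "(LINT z|lborel. 15 * \<mu>\<^sup>2 * c\<^sup>2 * s z) + (LINT z|lborel. crit_potential \<mu> h (kink \<mu> h z)) = 40 * \<mu>\<^sup>2 * c\<^sup>2 / k"
    unfolding V by (simp add: sint(2) field_simps)
  also have "\<dots> = kink_energy \<mu> h"
  proof -
    have "c\<^sup>2 = 9 * \<mu>\<^sup>2 / (400 * h)" using kink_amp_powers(1)[OF h, of \<mu>] h by (simp add: c_def field_simps)
    then show ?thesis using mu h by (simp add: kink_energy_def k_def field_simps power2_eq_square power3_eq_cube)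
  qed
  finally show "energy (crit_potential \<mu> h) (kink \<mu> h) = kink_energy \<mu> h" .
qed

text \<open>Weighted length does not depend on the parametrisation, so the segment is traversed at
  constant speed on \<open>{0..1}\<close>; the tanh profile would reach the vacua only in infinite
  time.\<close>

lemma degenerate_dist_eq:
  assumes mu: "\<mu> > 0" and h: "h > 0"
  shows "degenerate_dist (crit_potential \<mu> h) (Sigma_minus \<mu> h) (Sigma_plus \<mu> h) = ennreal (kink_energy \<mu> h)"
proof (rule antisym)
  define c where "c = kink_amp \<mu> h"
  have c: "c > 0" using mu h by (simp add: c_def kink_amp_def)
  define \<gamma> where "\<gamma> t = kink_line \<mu> h (2 * t - 1)" for t
  define D where "D = 2 *\<^sub>R kink_dir \<mu> h"
  have \<gamma>h: "\<gamma> ` {0..1} \<subseteq> h0" by (auto simp: \<gamma>_def kink_line_h0)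
  have ends: "\<gamma> 0 \<in> Sigma_minus \<mu> h" "\<gamma> 1 \<in> Sigma_plus \<mu> h"
    using kink_line_endpoints[of \<mu> h] by (simp_all add: \<gamma>_def)
  have diff: "\<gamma> b - \<gamma> a = (b - a) *\<^sub>R D" for a b
  proof -
    have "\<gamma> b - \<gamma> a = (c * (2 * b - 1)) *\<^sub>R diag5 [2, 2, 2, -3, -3] - (c * (2 * a - 1)) *\<^sub>R diag5 [2, 2, 2, -3, -3]"
      by (simp add: \<gamma>_def kink_line_def c_def)
    also have "\<dots> = (c * (2 * b - 1) - c * (2 * a - 1)) *\<^sub>R diag5 [2, 2, 2, -3, -3]"
      by (rule scaleR_diff_left[symmetric])
    also have "c * (2 * b - 1) - c * (2 * a - 1) = (b - a) * (2 * c)" by (simp add: algebra_simps)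
    finally show ?thesis by (simp add: D_def kink_dir_def c_def)
  qed
  have Dn: "norm D = 2 * sqrt 30 * c" using norm_kink_dir[of \<mu> h] c by (simp add: D_def c_def)
  have D0: "norm D > 0" using c by (simp add: Dn)
  have ac: "abs_continuous_on {0..1} \<gamma>"
    unfolding abs_continuous_on_def
  proof (intro allI impI)
    fix e :: real assume e: "e > 0"
    show "\<exists>\<delta>>0. \<forall>I. finite I \<and> (\<forall>(a, b)\<in>I. a \<le> b \<and> {a..b} \<subseteq> {0..1}) \<and>
        disjoint_family_on (\<lambda>(a, b). {a<..<b}) I \<and> (\<Sum>(a, b)\<in>I. b - a) < \<delta> \<longrightarrow>
        (\<Sum>(a, b)\<in>I. norm (\<gamma> b - \<gamma> a)) < e"
    proof (intro exI[of _ "e / norm D"] conjI allI impI, goal_cases)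
      case 1
      then show ?case using e D0 by simp
    next
      case (2 I)
      have "(\<Sum>(a, b)\<in>I. norm (\<gamma> b - \<gamma> a)) = (\<Sum>(a, b)\<in>I. (b - a) * norm D)"
        using 2 by (intro sum.cong refl) (auto simp: diff)
      also have "\<dots> = (\<Sum>(a, b)\<in>I. b - a) * norm D" by (simp add: sum_distrib_right case_prod_unfold)
      also have "\<dots> < e" using 2 D0 by (simp add: pos_less_divide_eq)
      finally show ?case .
    qed
  qed
  have der: "(\<gamma> has_vector_derivative D) (at t within S)" for t S
  proof -
    define p where "p = \<gamma> 0"
    have "\<gamma> t = p + t *\<^sub>R D" for t using diff[of t 0] by (simp add: p_def diff_eq_eq add.commute)
    then have "\<gamma> = (\<lambda>t. p + t *\<^sub>R D)" by (rule ext)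
    moreover have "((\<lambda>t. p + t *\<^sub>R D) has_vector_derivative D) (at t within S)"
      by (auto intro!: derivative_eq_intros)
    ultimately show ?thesis by (simp only:)
  qed
  have Dh: "D \<in> h0" unfolding D_def by (intro subspace_scale[OF h0_subspace] kink_dir_h0)
  define K where "K = sqrt (2000/3 * h) * c\<^sup>2 * norm D"
  have V: "sqrt (crit_potential \<mu> h (\<gamma> t)) * frob_norm D = K * (1 - (2 * t - 1)\<^sup>2)" if "t \<in> {0..1}" for t
  proof -
    \<comment> \<open>Between the vacua the squared factor of the potential is nonnegative, so its
      root needs no modulus.\<close>
    have "\<bar>2 * t - 1\<bar> \<le> 1" using that by auto
    then have "(2 * t - 1)\<^sup>2 \<le> 1" by (simp add: abs_square_le_1)
    moreover have "crit_potential \<mu> h (\<gamma> t) = 2000/3 * h * (c\<^sup>2 * (1 - (2 * t - 1)\<^sup>2))\<^sup>2"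
      unfolding \<gamma>_def crit_potential_kink_line[OF h] c_def by (simp add: power_mult_distrib)
    ultimately have "sqrt (crit_potential \<mu> h (\<gamma> t)) = sqrt (2000/3 * h) * (c\<^sup>2 * (1 - (2 * t - 1)\<^sup>2))"
      by (simp only: real_sqrt_mult real_sqrt_abs) (simp add: abs_mult)
    then show ?thesis by (simp add: frob_norm_eq_norm[OF Dh] K_def)
  qed
  have K0: "K \<ge> 0" using h by (simp add: K_def)
  \<comment> \<open>A primitive of the weighted speed, since 1 - (2t - 1)^2 = 4t - 4t^2.\<close>
  define P where "P t = K * (2 * t\<^sup>2 - 4/3 * t^3)" for t :: real
  have "(\<integral>\<^sup>+t\<in>{0..1}. ennreal (sqrt (crit_potential \<mu> h (\<gamma> t)) * frob_norm D) \<partial>lborel)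
      = (\<integral>\<^sup>+t. ennreal (K * (1 - (2 * t - 1)\<^sup>2)) * indicator {0..1} t \<partial>lborel)"
    by (intro nn_integral_cong) (auto simp: indicator_def V)
  also have "\<dots> = ennreal (P 1 - P 0)"
  proof (rule nn_integral_FTC_Icc)
    show "(\<lambda>t. K * (1 - (2 * t - 1)\<^sup>2)) \<in> borel_measurable borel" by measurable
    show "(P has_real_derivative K * (1 - (2 * t - 1)\<^sup>2)) (at t)" for t
      unfolding P_def by (auto intro!: derivative_eq_intros simp: power2_eq_square algebra_simps)
    show "0 \<le> K * (1 - (2 * t - 1)\<^sup>2)" if "t \<in> {0..1}" for t
    proof -
      have "\<bar>2 * t - 1\<bar> \<le> 1" using that by auto
      then show ?thesis using K0 by (simp add: abs_square_le_1)
    qed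
  qed simp
  also have "P 1 - P 0 = 2/3 * K" by (simp add: P_def)
  finally have L: "(\<integral>\<^sup>+t\<in>{0..1}. ennreal (sqrt (crit_potential \<mu> h (\<gamma> t)) * frob_norm D) \<partial>lborel) = ennreal (2/3 * K)" .
  have "2 * ennreal (2/3 * K) = ennreal (4/3 * K)"
    using ennreal_mult[of 2 "2/3 * K"] K0 by simp
  also have "4/3 * K = calibration \<mu> h (\<gamma> 1) - calibration \<mu> h (\<gamma> 0)"
    unfolding calibration_def Let_def kink_coord_Sigma(1)[OF ends(2)] kink_coord_Sigma(2)[OF ends(1)] K_def Dn c_def[symmetric]
    by (simp add: power2_eq_square power3_eq_cube field_simps)
  also have "\<dots> = kink_energy \<mu> h" by (rule calibration_Sigma_diff[OF h ends])
  finally have len: "2 * (\<integral>\<^sup>+t\<in>{0..1}. ennreal (sqrt (crit_potential \<mu> h (\<gamma> t)) * frob_norm D) \<partial>lborel) = ennreal (kink_energy \<mu> h)"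
    unfolding L .
  show "degenerate_dist (crit_potential \<mu> h) (Sigma_minus \<mu> h) (Sigma_plus \<mu> h) \<le> ennreal (kink_energy \<mu> h)"
    unfolding degenerate_dist_def len[symmetric]
    by (rule Inf_lower, rule CollectI, intro exI[of _ \<gamma>] exI[of _ "\<lambda>_. D"] conjI refl \<gamma>h ac ends AE_I2 impI der)
  show "ennreal (kink_energy \<mu> h) \<le> degenerate_dist (crit_potential \<mu> h) (Sigma_minus \<mu> h) (Sigma_plus \<mu> h)"
    unfolding degenerate_dist_def
  proof (rule Inf_greatest, elim CollectE exE conjE, goal_cases)
    case (1 x \<gamma> \<gamma>')
    show ?case
      using weighted_length_lower_bound[OF h 1(2,3,4), of \<mu>] calibration_Sigma_diff[OF h 1(5,6)] 1(1) by simp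
  qed
qed

theorem theorem6:
  fixes \<mu> h lam V0 :: real and V :: "cmat5 \<Rightarrow> real"
  assumes "\<mu> > 0" and "h > 0"
    and "lam = - (10 / 9) * h"
    and "V0 = 9 * \<mu> ^ 4 / (10 * h)"
    and "V = potential \<mu> h lam V0"
  shows "is_arg_min (energy V)
           (\<lambda>\<Psi>. \<Psi> \<in> connecting_sets V (Sigma_minus \<mu> h) (Sigma_plus \<mu> h)) (kink \<mu> h)
       \<and> kink \<mu> h \<in> connecting_sets V (Sigma_minus \<mu> h) (Sigma_plus \<mu> h)
       \<and> (\<forall>\<Psi> \<in> connecting_sets V (Sigma_minus \<mu> h) (Sigma_plus \<mu> h).
            energy V \<Psi> \<ge> energy V (kink \<mu> h))
       \<and> energy V (kink \<mu> h) = 9 * sqrt 2 * \<mu> ^ 3 / (10 * h)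
       \<and> degenerate_dist V (Sigma_minus \<mu> h) (Sigma_plus \<mu> h) = ennreal (energy V (kink \<mu> h))"
proof -
  have V: "V = crit_potential \<mu> h" using assms(3-5) by (simp add: crit_potential_def)
  note mem = kink_facts(1)[OF assms(1,2)] and E = kink_facts(2)[OF assms(1,2)]
  have "kink_energy \<mu> h = 9 * sqrt 2 * \<mu> ^ 3 / (10 * h)" by (rule kink_energy_def)
  then show ?thesis
    unfolding V E is_arg_min_def degenerate_dist_eq[OF assms(1,2)]
    using mem energy_lower_bound[OF assms(2), of _ \<mu>] by (auto simp: not_less)
qed

end
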